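(* For a topological dynamical system $\Sigma=(X,\sigma)$, $C(X)'$ always has the intersection property for ideals of the associated $C^*$-crossed product $C^*(\Sigma)$. Furthermore, precisely one of the following two cases occurs: (i) $\Sigma$ is topologically free. Then $C(X)=C(X)'$; (ii) $\Sigma$ is not topologically free. Then $C(X)\subsetneq C(X)'$ and $C(X)$ does not have the intersection property for ideals of $C^*(\Sigma)$. In this case, there exist $C^*$-subalgebras $B_i$ of $C^*(\Sigma)$ with $C(X)\subsetneq B_i\subsetneq C(X)'$ for $i=1,2$ such that $B_1$ has the intersection property for ideals of $C^*(\Sigma)$ and $B_2$ does not.
   Context: A topological dynamical system $\Sigma=(X,\sigma)$ consists of a compact Hausdorff space $X$ and a homeomorphism $\sigma$ of $X$; it is topologically free if the set of its non-periodic points is dense in $X$. $C^*(\Sigma)=C(X)\rtimes_\alpha\mathbb{Z}$ is the $C^*$-crossed product for the automorphism $\alpha(f)=f\circ\sigma^{-1}$ of $C(X)$; $C(X)$ is identified with its canonical copy in $C^*(\Sigma)$. $C(X)'=\{a\in C^*(\Sigma): af=fa\text{ for all }f\in C(X)\}$, which is a commutative $C^*$-algebra. A commutative $C^*$-subalgebra $B$ of a unital $C^*$-algebra $A$, containing the unit of $A$, has the intersection property for ideals of $A$ if $J\cap B\ne\{0\}$ for every non-zero two-sided ideal $J$ of $A$, not necessarily closed or self-adjoint. *)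

theory Defs
  imports "HOL-Analysis.Analysis"
begin

section \<open>Unital C*-algebras\<close>

text \<open>The real scalar multiplication, the norm and completeness come from \<^class>\<open>banach\<close> and
  \<^class>\<open>real_normed_algebra_1\<close>; the class adds the complex scalar multiplication, the involution
  and the C*-identity.  The axiom \<open>norm 1 = 1\<close> of \<^class>\<open>real_normed_algebra_1\<close> only
  excludes the zero algebra.\<close>

class unital_cstar_algebra = banach + real_normed_algebra_1 +
  fixes scaleC :: "complex \<Rightarrow> 'a \<Rightarrow> 'a"  (infixr "*\<^sub>C" 75)
    and adj :: "'a \<Rightarrow> 'a"
  assumes scaleC_add_right: "c *\<^sub>C (x + y) = c *\<^sub>C x + c *\<^sub>C y"
    and scaleC_add_left: "(c + d) *\<^sub>C x = c *\<^sub>C x + d *\<^sub>C x"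
    and scaleC_scaleC: "c *\<^sub>C (d *\<^sub>C x) = (c * d) *\<^sub>C x"
    and scaleC_of_real: "complex_of_real r *\<^sub>C x = r *\<^sub>R x"
    and mult_scaleC_left: "(c *\<^sub>C x) * y = c *\<^sub>C (x * y)"
    and mult_scaleC_right: "x * (c *\<^sub>C y) = c *\<^sub>C (x * y)"
    and norm_scaleC: "norm (c *\<^sub>C x) = cmod c * norm x"
    and adj_adj: "adj (adj x) = x"
    and adj_add: "adj (x + y) = adj x + adj y"
    and adj_scaleC: "adj (c *\<^sub>C x) = cnj c *\<^sub>C adj x"
    and adj_mult: "adj (x * y) = adj y * adj x"
    and cstar_identity: "norm (adj x * x) = (norm x)\<^sup>2"

definition csubspace :: "'b::unital_cstar_algebra set \<Rightarrow> bool" where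
  "csubspace S \<longleftrightarrow> 0 \<in> S \<and> (\<forall>x\<in>S. \<forall>y\<in>S. x + y \<in> S) \<and> (\<forall>c. \<forall>x\<in>S. c *\<^sub>C x \<in> S)"

definition cstar_subalgebra :: "'b::unital_cstar_algebra set \<Rightarrow> bool" where
  "cstar_subalgebra B \<longleftrightarrow> csubspace B \<and> (\<forall>x\<in>B. \<forall>y\<in>B. x * y \<in> B) \<and>
     (\<forall>x\<in>B. adj x \<in> B) \<and> closed B"

definition commutative_unital_cstar_subalgebra :: "'b::unital_cstar_algebra set \<Rightarrow> bool" where
  "commutative_unital_cstar_subalgebra B \<longleftrightarrow>
     cstar_subalgebra B \<and> 1 \<in> B \<and> (\<forall>x\<in>B. \<forall>y\<in>B. x * y = y * x)"

definition two_sided_ideal :: "'b::unital_cstar_algebra set \<Rightarrow> bool" where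
  "two_sided_ideal J \<longleftrightarrow> csubspace J \<and> (\<forall>a. \<forall>x\<in>J. a * x \<in> J \<and> x * a \<in> J)"

definition commutant :: "'b::unital_cstar_algebra set \<Rightarrow> 'b set" where
  "commutant S = {a. \<forall>b\<in>S. a * b = b * a}"

text \<open>Intended for sets \<open>B\<close> with \<^const>\<open>commutative_unital_cstar_subalgebra\<close>.  That requirement is
  kept outside the definition so that the negation says exactly that some non-zero ideal
  meets \<open>B\<close> trivially.\<close>

definition intersection_property :: "'b::unital_cstar_algebra set \<Rightarrow> bool" where
  "intersection_property B \<longleftrightarrow> (\<forall>J. two_sided_ideal J \<and> J \<noteq> {0} \<longrightarrow> J \<inter> B \<noteq> {0})"

section \<open>Topological dynamical systems\<close>

definition topological_dynamical_system :: "('a::t2_space \<Rightarrow> 'a) \<Rightarrow> bool" where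
  "topological_dynamical_system \<sigma> \<longleftrightarrow>
     compact (UNIV :: 'a set) \<and> homeomorphism UNIV UNIV \<sigma> (inv \<sigma>)"

definition topologically_free :: "('a::t2_space \<Rightarrow> 'a) \<Rightarrow> bool" where
  "topologically_free \<sigma> \<longleftrightarrow> closure {x. \<forall>n>0. (\<sigma> ^^ n) x \<noteq> x} = UNIV"

definition int_iterate :: "('a \<Rightarrow> 'a) \<Rightarrow> int \<Rightarrow> 'a \<Rightarrow> 'a" where
  "int_iterate \<sigma> k = (if k \<ge> 0 then \<sigma> ^^ nat k else inv \<sigma> ^^ nat (- k))"

section \<open>The C*-crossed product\<close>

text \<open>The *-algebra of finitely supported functions \<open>a\<close> from the integers to \<open>C(X)\<close>, where \<open>a\<close>
  stands for the formal sum of the \<open>a n * u ^ n\<close>, with \<open>u\<close> unitary and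
  \<open>u * f * u\<^sup>-\<^sup>1 = \<alpha> f = f \<circ> \<sigma>\<^sup>-\<^sup>1\<close>.\<close>

definition fin_supp :: "(int \<Rightarrow> 'a::t2_space \<Rightarrow> complex) set" where
  "fin_supp = {a. (\<forall>n. continuous_on UNIV (a n)) \<and> finite {n. a n \<noteq> (\<lambda>_. 0)}}"

definition fs_mult ::
  "('a \<Rightarrow> 'a) \<Rightarrow> (int \<Rightarrow> 'a \<Rightarrow> complex) \<Rightarrow> (int \<Rightarrow> 'a \<Rightarrow> complex) \<Rightarrow> int \<Rightarrow> 'a \<Rightarrow> complex" where
  "fs_mult \<sigma> a b =
     (\<lambda>n x. \<Sum>k | a k \<noteq> (\<lambda>_. 0). a k x * b (n - k) (int_iterate \<sigma> (- k) x))"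

definition fs_adj :: "('a \<Rightarrow> 'a) \<Rightarrow> (int \<Rightarrow> 'a \<Rightarrow> complex) \<Rightarrow> int \<Rightarrow> 'a \<Rightarrow> complex" where
  "fs_adj \<sigma> a = (\<lambda>n x. cnj (a (- n) (int_iterate \<sigma> (- n) x)))"

definition fs_embed :: "('a \<Rightarrow> complex) \<Rightarrow> int \<Rightarrow> 'a \<Rightarrow> complex" where
  "fs_embed f = (\<lambda>n. if n = 0 then f else (\<lambda>_. 0))"

definition cstar_seminorm ::
  "('a::t2_space \<Rightarrow> 'a) \<Rightarrow> ((int \<Rightarrow> 'a \<Rightarrow> complex) \<Rightarrow> real) \<Rightarrow> bool" where
  "cstar_seminorm \<sigma> p \<longleftrightarrow>
     (\<forall>a\<in>fin_supp. 0 \<le> p a) \<and>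
     (\<forall>a\<in>fin_supp. \<forall>b\<in>fin_supp. p (\<lambda>n x. a n x + b n x) \<le> p a + p b) \<and>
     (\<forall>c. \<forall>a\<in>fin_supp. p (\<lambda>n x. c * a n x) = cmod c * p a) \<and>
     (\<forall>a\<in>fin_supp. \<forall>b\<in>fin_supp. p (fs_mult \<sigma> a b) \<le> p a * p b) \<and>
     (\<forall>a\<in>fin_supp. p (fs_mult \<sigma> (fs_adj \<sigma> a) a) = (p a)\<^sup>2)"

definition unital_star_hom ::
  "('a::t2_space \<Rightarrow> 'a) \<Rightarrow> ((int \<Rightarrow> 'a \<Rightarrow> complex) \<Rightarrow> 'b::unital_cstar_algebra) \<Rightarrow> bool" where
  "unital_star_hom \<sigma> j \<longleftrightarrow>
     (\<forall>a\<in>fin_supp. \<forall>b\<in>fin_supp. j (\<lambda>n x. a n x + b n x) = j a + j b) \<and>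
     (\<forall>c. \<forall>a\<in>fin_supp. j (\<lambda>n x. c * a n x) = c *\<^sub>C j a) \<and>
     (\<forall>a\<in>fin_supp. \<forall>b\<in>fin_supp. j (fs_mult \<sigma> a b) = j a * j b) \<and>
     (\<forall>a\<in>fin_supp. j (fs_adj \<sigma> a) = adj (j a)) \<and>
     j (fs_embed (\<lambda>_. 1)) = 1"

text \<open>The full crossed product is the (Hausdorff) completion of \<^const>\<open>fin_supp\<close> in its largest
  C*-seminorm.  This determines the C*-algebra \<open>'b\<close> together with the canonical map \<open>j\<close> up to
  isomorphism.  A *-homomorphism \<open>j\<close> makes \<open>norm \<circ> j\<close> a C*-seminorm, so the last
  conjunct says that it is the largest one.  No bound on \<open>p\<close> is needed: every C*-seminorm is
  dominated by the \<open>\<ell>\<^sup>1\<close>-norm, so completing the \<open>\<ell>\<^sup>1\<close>-algebra gives the same C*-algebra.\<close>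

definition is_crossed_product ::
  "('a::t2_space \<Rightarrow> 'a) \<Rightarrow> ((int \<Rightarrow> 'a \<Rightarrow> complex) \<Rightarrow> 'b::unital_cstar_algebra) \<Rightarrow> bool" where
  "is_crossed_product \<sigma> j \<longleftrightarrow>
     unital_star_hom \<sigma> j \<and>
     closure (j ` fin_supp) = UNIV \<and>
     (\<forall>p. cstar_seminorm \<sigma> p \<longrightarrow> (\<forall>a\<in>fin_supp. p a \<le> norm (j a)))"

text \<open>The canonical copy of \<open>C(X)\<close>.\<close>

definition CX :: "((int \<Rightarrow> 'a::t2_space \<Rightarrow> complex) \<Rightarrow> 'b::unital_cstar_algebra) \<Rightarrow> 'b set" where
  "CX j = (\<lambda>f. j (fs_embed f)) ` {f. continuous_on UNIV f}"

end

theory Submission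
  imports Defs
begin

text \<open>An element \<open>a\<close> of the crossed product is determined by its Fourier coefficients
  \<open>a\<^sub>k\<close>, where \<open>a\<close> is formally the sum of the \<open>a\<^sub>k
  u\<^sup>k\<close>. They exist because the regular representations over the orbits give C*-seminorms, and the
  norm is the largest one; they determine \<open>a\<close> because the dual action of the circle is isometric,
  so that the Fejer means of \<open>a\<close> converge to \<open>a\<close> in norm
  (\<open>cesaro_tendsto\<close>). Comparing coefficients, \<open>a\<close> commutes with \<open>C(X)\<close>
  exactly when every \<open>a\<^sub>k\<close> vanishes off the fixed points of \<open>\<sigma>\<^sup>k\<close>
  (\<open>commutant_CX\<close>). If the non-periodic points are dense, only \<open>a\<^sub>0\<close> survives
  and the commutant is \<open>C(X)\<close>.

  On the commutant multiplication is pointwise convolution of coefficients.  It is therefore commutative, and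
  \<open>hat a x z\<close>, the
  value at \<open>z\<close> of the Fejer sum of the Fourier series with coefficients \<open>a\<^sub>k(x)\<close>, is
  multiplicative for all points \<open>x\<close> and all \<open>z\<close> on the unit circle. This transform is
  isometric for the supremum norm (\<open>hat_bound\<close>, \<open>norm_le_hat\<close>): both inequalities are
  clear up to a factor linear in the degree, and passing to high powers removes the factor.
  Weierstrass approximation then yields a functional calculus for elements with real transform.

  Given a non-zero ideal \<open>J\<close>, multiply an element by a power of \<open>u\<close> to get
  \<open>a\<close> in \<open>J\<close> with \<open>a\<^sub>0(y) \<noteq> 0\<close> for some \<open>y\<close>,
  and approximate \<open>a\<close> by a finite sum \<open>b\<close>. On a suitable small open set near
  \<open>y\<close> each of the finitely many \<open>\<sigma>\<^sup>k\<close> involved is the identity or moves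
  the set off itself. For a bump function \<open>f\<close> on that set, \<open>f b f\<close> therefore lies in
  the commutant, and it is closer to \<open>f a f\<close> in \<open>J\<close> than its own norm. A Neumann
  series turns this proximity into an actual non-zero element of the intersection
  (\<open>ideal_meets_commutant\<close>), whether or not \<open>J\<close> is closed.

  If the system is not topologically free, Baire's theorem gives \<open>n > 0\<close> for which the fixed points
  of \<open>\<sigma>\<^sup>n\<close> have non-empty interior \<open>V\<close>. Intermediate algebras arise by
  prescribing equalities between the values \<open>hat a x z\<close> and \<open>hat a x w\<close>. Gluing just
  two points of the circle over one point of \<open>V\<close> keeps the intersection property, since an ideal of
  the commutant can be multiplied into the glued algebra without vanishing. Gluing every \<open>z\<close> to its
  conjugate destroys it: the elements that live over \<open>V\<close> and on the arcs \<open>Im z\<^sup>n <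
  -1/2\<close> lie in an ideal that meets the symmetric transforms only in \<open>0\<close>. That ideal meets
  the smaller algebra \<open>C(X)\<close> in \<open>0\<close> as well.\<close>

section \<open>Finitely supported functions\<close>

locale dynamics =
  fixes \<sigma> :: "'a::t2_space \<Rightarrow> 'a"
  assumes tds: "topological_dynamical_system \<sigma>"
begin

abbreviation "it \<equiv> int_iterate \<sigma>"

lemma compact_X: "compact (UNIV :: 'a set)"
  and homeo: "homeomorphism UNIV UNIV \<sigma> (inv \<sigma>)"
  using tds by (auto simp: topological_dynamical_system_def)

lemma \<sigma>_inv [simp]: "\<sigma> (inv \<sigma> x) = x" "inv \<sigma> (\<sigma> x) = x"
  using homeo by (auto simp: homeomorphism_def)

lemma it_0 [simp]: "it 0 x = x"
  by (simp add: int_iterate_def)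

lemma it_succ: "it (k + 1) x = \<sigma> (it k x)"
proof (cases "k \<ge> 0")
  case True
  then have "nat (k + 1) = Suc (nat k)" by simp
  with True show ?thesis by (simp add: int_iterate_def)
next
  case False
  then have "nat (- k) = Suc (nat (- (k + 1)))" by simp
  moreover have "(if k + 1 \<ge> 0 then \<sigma> ^^ nat (k + 1) else inv \<sigma> ^^ nat (- (k + 1)))
      = inv \<sigma> ^^ nat (- (k + 1))"
    using False by (cases "k + 1 = 0") auto
  ultimately show ?thesis using False by (simp add: int_iterate_def)
qed

lemma it_pred: "it (k - 1) x = inv \<sigma> (it k x)"
  using it_succ[of "k - 1" x] by simp

lemma it_add: "it (k + l) x = it k (it l x)"
proof (induction k rule: int_induct[where k = 0])
  case (step1 i)
  then show ?case using it_succ[of "i + l" x] it_succ[of i "it l x"] by (simp add: add.commute add.left_commute)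
next
  case (step2 i)
  then show ?case using it_pred[of "i + l" x] it_pred[of i "it l x"] by (simp add: algebra_simps)
qed simp

lemma it_cancel [simp]: "it k (it (- k) x) = x" "it (- k) (it k x) = x"
  by (simp_all flip: it_add)

lemma continuous_it: "continuous_on UNIV (it k)"
proof -
  have *: "continuous_on UNIV (f ^^ n)" if "continuous_on UNIV f" for f :: "'a \<Rightarrow> 'a" and n
    using that
  proof (induction n)
    case (Suc n)
    have "continuous_on UNIV (f \<circ> (f ^^ n))"
      by (rule continuous_on_compose) (use Suc continuous_on_subset in auto)
    then show ?case by simp
  qed simp
  show ?thesis
    using homeo by (auto simp: int_iterate_def homeomorphism_def intro!: *)
qed

lemma continuous_comp_it: "continuous_on UNIV f \<Longrightarrow> continuous_on UNIV (\<lambda>x. f (it k x))"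
  using continuous_on_compose[OF continuous_it[of k], of f] continuous_on_subset
  by (auto simp: o_def)

end

text \<open>The monomial \<open>f u\<^sup>k\<close>.\<close>

definition mon :: "('a \<Rightarrow> complex) \<Rightarrow> int \<Rightarrow> int \<Rightarrow> 'a \<Rightarrow> complex" where
  "mon f k = (\<lambda>n. if n = k then f else (\<lambda>_. 0))"

lemma fin_supp_mon: "continuous_on UNIV f \<Longrightarrow> mon f k \<in> fin_supp"
  by (auto simp: fin_supp_def mon_def intro!: finite_subset[of _ "{k}"])

lemma fin_supp_add:
  assumes "a \<in> fin_supp" "b \<in> fin_supp"
  shows "(\<lambda>n x. a n x + b n x) \<in> fin_supp"
proof -
  have "{n. (\<lambda>x. a n x + b n x) \<noteq> (\<lambda>_. 0)} \<subseteq> {n. a n \<noteq> (\<lambda>_. 0)} \<union> {n. b n \<noteq> (\<lambda>_. 0)}"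
    by auto
  with assms show ?thesis
    by (auto simp: fin_supp_def intro!: continuous_intros intro: finite_subset)
qed

lemma fin_supp_scale:
  assumes "a \<in> fin_supp"
  shows "(\<lambda>n x. c n * a n x) \<in> fin_supp"
proof -
  have "{n. (\<lambda>x. c n * a n x) \<noteq> (\<lambda>_. 0)} \<subseteq> {n. a n \<noteq> (\<lambda>_. 0)}"
    by auto
  with assms show ?thesis
    by (auto simp: fin_supp_def intro!: continuous_intros intro: finite_subset)
qed

lemma fin_supp_diff:
  assumes "a \<in> fin_supp" "b \<in> fin_supp"
  shows "(\<lambda>n x. a n x - b n x) \<in> fin_supp"
  using fin_supp_add[OF assms(1) fin_supp_scale[OF assms(2), of "\<lambda>_. -1"]] by simp

text \<open>Every identity between products and adjoints is additive in each argument, so that it need only be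
  checked on monomials.\<close>

lemma fin_supp_induct [consumes 1, case_names mon add]:
  assumes "a \<in> fin_supp"
    and mon: "\<And>f k. continuous_on UNIV f \<Longrightarrow> P (mon f k)"
    and add: "\<And>a b. a \<in> fin_supp \<Longrightarrow> b \<in> fin_supp \<Longrightarrow> P a \<Longrightarrow> P b \<Longrightarrow> P (\<lambda>n x. a n x + b n x)"
  shows "P a"
proof -
  have "P a" if "finite K" "{n. a n \<noteq> (\<lambda>_. 0)} \<subseteq> K" "\<forall>n. continuous_on UNIV (a n)" for K a
    using that
  proof (induction K arbitrary: a rule: finite_induct)
    case empty
    then have "a = mon (\<lambda>_. 0) 0" by (auto simp: mon_def)
    then show ?case using mon[of "\<lambda>_. 0" 0] by simp
  next
    case (insert k K)
    define b where "b = (\<lambda>n. if n = k then (\<lambda>_. 0) else a n)"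
    have b: "{n. b n \<noteq> (\<lambda>_. 0)} \<subseteq> K" "\<forall>n. continuous_on UNIV (b n)"
      using insert.prems by (auto simp: b_def)
    have "a = (\<lambda>n x. mon (a k) k n x + b n x)" by (auto simp: mon_def b_def fun_eq_iff)
    moreover have "P (\<lambda>n x. mon (a k) k n x + b n x)"
      using insert.prems insert.hyps b
      by (intro add mon fin_supp_mon insert.IH) (auto simp: fin_supp_def intro: finite_subset)
    ultimately show ?case by metis
  qed
  then show ?thesis using assms(1) by (auto simp: fin_supp_def)
qed

lemma fs_mult_eq:
  assumes "finite K" "{k. a k \<noteq> (\<lambda>_. 0)} \<subseteq> K"
  shows "fs_mult \<sigma> a b n x = (\<Sum>k\<in>K. a k x * b (n - k) (int_iterate \<sigma> (- k) x))"
  unfolding fs_mult_def by (rule sum.mono_neutral_left) (use assms in auto)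

lemma fs_mult_mon_left:
  "fs_mult \<sigma> (mon f k) b = (\<lambda>n x. f x * b (n - k) (int_iterate \<sigma> (- k) x))"
proof (intro ext)
  fix n x
  show "fs_mult \<sigma> (mon f k) b n x = f x * b (n - k) (int_iterate \<sigma> (- k) x)"
    by (subst fs_mult_eq[of "{k}"]) (auto simp: mon_def)
qed

lemma fs_mult_mon_mon:
  "fs_mult \<sigma> (mon f k) (mon g l) = mon (\<lambda>x. f x * g (int_iterate \<sigma> (- k) x)) (k + l)"
  unfolding fs_mult_mon_left by (auto simp: mon_def fun_eq_iff)

lemma fs_mult_add_left:
  assumes "a \<in> fin_supp" "b \<in> fin_supp"
  shows "fs_mult \<sigma> (\<lambda>n x. a n x + b n x) c = (\<lambda>n x. fs_mult \<sigma> a c n x + fs_mult \<sigma> b c n x)"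
proof (intro ext)
  fix n x
  let ?K = "{n. a n \<noteq> (\<lambda>_. 0)} \<union> {n. b n \<noteq> (\<lambda>_. 0)}"
  have "finite ?K" using assms by (auto simp: fin_supp_def)
  then show "fs_mult \<sigma> (\<lambda>n x. a n x + b n x) c n x = fs_mult \<sigma> a c n x + fs_mult \<sigma> b c n x"
    by (subst (1 2 3) fs_mult_eq[of ?K]) (auto simp: algebra_simps sum.distrib)
qed

lemma fs_mult_add_right:
  "fs_mult \<sigma> c (\<lambda>n x. a n x + b n x) = (\<lambda>n x. fs_mult \<sigma> c a n x + fs_mult \<sigma> c b n x)"
  by (simp add: fs_mult_def algebra_simps sum.distrib)

lemma fs_mult_scale_left: "fs_mult \<sigma> (\<lambda>n x. c * a n x) b = (\<lambda>n x. c * fs_mult \<sigma> a b n x)"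
proof (cases "c = 0")
  case True
  then show ?thesis by (simp add: fs_mult_def)
next
  case False
  then have "{k. (\<lambda>x. c * a k x) \<noteq> (\<lambda>_. 0)} = {k. a k \<noteq> (\<lambda>_. 0)}" by (auto simp: fun_eq_iff)
  then show ?thesis by (simp add: fs_mult_def sum_distrib_left mult.assoc)
qed

context dynamics
begin

lemma fs_adj_mon: "fs_adj \<sigma> (mon f k) = mon (\<lambda>x. cnj (f (it k x))) (- k)"
  by (auto simp: fs_adj_def mon_def fun_eq_iff)

lemma fs_adj_add:
  "fs_adj \<sigma> (\<lambda>n x. a n x + b n x) = (\<lambda>n x. fs_adj \<sigma> a n x + fs_adj \<sigma> b n x)"
  by (simp add: fs_adj_def)

lemma fin_supp_fs_mult:
  assumes "a \<in> fin_supp" "b \<in> fin_supp"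
  shows "fs_mult \<sigma> a b \<in> fin_supp"
  using assms
proof (induction a rule: fin_supp_induct)
  case (mon f k)
  from \<open>b \<in> fin_supp\<close> show ?case
  proof (induction b rule: fin_supp_induct)
    case (mon g l)
    then show ?case using \<open>continuous_on UNIV f\<close>
      by (auto simp: fs_mult_mon_mon intro!: fin_supp_mon continuous_intros continuous_comp_it)
  qed (auto simp: fs_mult_add_right intro: fin_supp_add)
qed (auto simp: fs_mult_add_left intro: fin_supp_add)

lemma fin_supp_fs_adj: "a \<in> fin_supp \<Longrightarrow> fs_adj \<sigma> a \<in> fin_supp"
proof (induction a rule: fin_supp_induct)
  case (mon f k)
  then show ?case by (auto simp: fs_adj_mon intro!: fin_supp_mon continuous_intros continuous_comp_it)
qed (auto simp: fs_adj_add intro: fin_supp_add)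

lemma fs_mult_assoc:
  assumes "a \<in> fin_supp" "b \<in> fin_supp" "c \<in> fin_supp"
  shows "fs_mult \<sigma> (fs_mult \<sigma> a b) c = fs_mult \<sigma> a (fs_mult \<sigma> b c)"
  using assms
proof (induction a rule: fin_supp_induct)
  case (mon f k)
  from mon(2) show ?case
  proof (induction b rule: fin_supp_induct)
    case (mon g l)
    from it_add[of "- l" "- k"] show ?case
      unfolding fs_mult_mon_mon unfolding fs_mult_mon_left by (simp add: fun_eq_iff algebra_simps)
  next
    case (add b b')
    then show ?case using mon
      by (simp add: fs_mult_add_left fs_mult_add_right fin_supp_fs_mult fin_supp_mon)
  qed
qed (simp_all add: fs_mult_add_left fin_supp_fs_mult)

lemma fs_adj_adj: "fs_adj \<sigma> (fs_adj \<sigma> a) = a"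
  by (simp add: fs_adj_def)

section \<open>The regular representations\<close>

text \<open>In the coordinates \<open>\<xi>\<^sub>k = b\<^sub>k(\<sigma>\<^sup>k x)\<close>, left multiplication
  on the finitely supported functions is the representation of the crossed product on square-summable functions
  on the orbit of \<open>x\<close>. Using the algebra itself as the space of vectors makes multiplicativity of
  the representation the associativity of the product, and no Hilbert space has to be completed.\<close>

definition l2_inner :: "'a \<Rightarrow> (int \<Rightarrow> 'a \<Rightarrow> complex) \<Rightarrow> (int \<Rightarrow> 'a \<Rightarrow> complex) \<Rightarrow> complex" where
  "l2_inner x b c = (\<Sum>k | b k \<noteq> (\<lambda>_. 0). b k (it k x) * cnj (c k (it k x)))"

definition l2_norm :: "'a \<Rightarrow> (int \<Rightarrow> 'a \<Rightarrow> complex) \<Rightarrow> real" where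
  "l2_norm x b = L2_set (\<lambda>k. cmod (b k (it k x))) {k. b k \<noteq> (\<lambda>_. 0)}"

lemma l2_inner_eq:
  assumes "finite K" "{k. b k \<noteq> (\<lambda>_. 0)} \<subseteq> K"
  shows "l2_inner x b c = (\<Sum>k\<in>K. b k (it k x) * cnj (c k (it k x)))"
  unfolding l2_inner_def by (rule sum.mono_neutral_left) (use assms in auto)

lemma l2_norm_eq:
  assumes "finite K" "{k. b k \<noteq> (\<lambda>_. 0)} \<subseteq> K"
  shows "l2_norm x b = L2_set (\<lambda>k. cmod (b k (it k x))) K"
  unfolding l2_norm_def L2_set_def by (intro arg_cong[where f = sqrt] sum.mono_neutral_left) (use assms in auto)

lemma l2_norm_nonneg: "0 \<le> l2_norm x b"
  by (simp add: l2_norm_def)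

lemma l2_inner_self:
  shows "l2_inner x b b = of_real ((l2_norm x b)\<^sup>2)"
  by (simp add: l2_inner_def l2_norm_def L2_set_def sum_nonneg complex_norm_square flip: of_real_power)

lemma l2_inner_bound:
  assumes "b \<in> fin_supp" "c \<in> fin_supp"
  shows "cmod (l2_inner x b c) \<le> l2_norm x b * l2_norm x c"
proof -
  let ?K = "{n. b n \<noteq> (\<lambda>_. 0)} \<union> {n. c n \<noteq> (\<lambda>_. 0)}"
  have fin: "finite ?K" using assms by (auto simp: fin_supp_def)
  have "cmod (l2_inner x b c) \<le> (\<Sum>k\<in>?K. \<bar>cmod (b k (it k x))\<bar> * \<bar>cmod (c k (it k x))\<bar>)"
    unfolding l2_inner_eq[OF fin Un_upper1] by (rule order_trans[OF norm_sum]) (simp add: norm_mult)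
  also have "\<dots> \<le> l2_norm x b * l2_norm x c"
    unfolding l2_norm_eq[OF fin Un_upper1] l2_norm_eq[OF fin Un_upper2] by (rule L2_set_mult_ineq)
  finally show ?thesis .
qed

lemma l2_norm_add:
  assumes "b \<in> fin_supp" "c \<in> fin_supp"
  shows "l2_norm x (\<lambda>n y. b n y + c n y) \<le> l2_norm x b + l2_norm x c"
proof -
  let ?K = "{n. b n \<noteq> (\<lambda>_. 0)} \<union> {n. c n \<noteq> (\<lambda>_. 0)}"
  have fin: "finite ?K" using assms by (auto simp: fin_supp_def)
  have sub: "{n. (\<lambda>y. b n y + c n y) \<noteq> (\<lambda>_. 0)} \<subseteq> ?K" by auto
  have "l2_norm x (\<lambda>n y. b n y + c n y) \<le> L2_set (\<lambda>k. cmod (b k (it k x)) + cmod (c k (it k x))) ?K"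
    unfolding l2_norm_eq[OF fin sub] by (intro L2_set_mono norm_triangle_ineq) auto
  also have "\<dots> \<le> l2_norm x b + l2_norm x c"
    unfolding l2_norm_eq[OF fin Un_upper1] l2_norm_eq[OF fin Un_upper2] by (rule L2_set_triangle_ineq)
  finally show ?thesis .
qed

lemma l2_norm_scale: "l2_norm x (\<lambda>n y. c * b n y) = cmod c * l2_norm x b"
proof (cases "c = 0")
  case True
  then show ?thesis by (simp add: l2_norm_def L2_set_def)
next
  case False
  then have "{k. (\<lambda>x. c * b k x) \<noteq> (\<lambda>_. 0)} = {k. b k \<noteq> (\<lambda>_. 0)}" by (auto simp: fun_eq_iff)
  then show ?thesis by (simp add: l2_norm_def norm_mult L2_set_right_distrib)
qed

lemma l2_inner_add_left:
  assumes "b \<in> fin_supp" "b' \<in> fin_supp"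
  shows "l2_inner x (\<lambda>n y. b n y + b' n y) c = l2_inner x b c + l2_inner x b' c"
proof -
  let ?K = "{n. b n \<noteq> (\<lambda>_. 0)} \<union> {n. b' n \<noteq> (\<lambda>_. 0)}"
  have fin: "finite ?K" using assms by (auto simp: fin_supp_def)
  then show ?thesis
    by (subst (1 2 3) l2_inner_eq[of ?K]) (auto simp: algebra_simps sum.distrib)
qed

lemma l2_inner_add_right: "l2_inner x b (\<lambda>n y. c n y + c' n y) = l2_inner x b c + l2_inner x b c'"
  by (simp add: l2_inner_def algebra_simps sum.distrib)

lemma l2_inner_mon: "l2_inner x (mon f k) c = f (it k x) * cnj (c k (it k x))"
  by (subst l2_inner_eq[of "{k}"]) (auto simp: mon_def)

lemma l2_inner_adjoint:
  assumes "a \<in> fin_supp" "b \<in> fin_supp" "c \<in> fin_supp"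
  shows "l2_inner x (fs_mult \<sigma> a b) c = l2_inner x b (fs_mult \<sigma> (fs_adj \<sigma> a) c)"
  using assms
proof (induction a rule: fin_supp_induct)
  case (mon f k)
  from mon(2) show ?case
  proof (induction b rule: fin_supp_induct)
    case (mon g l)
    have "it (- k) (it (k + l) x) = it l x" using it_add[of "- k" "k + l" x] by simp
    moreover have "it k (it l x) = it (k + l) x" by (simp add: it_add)
    ultimately show ?case
      unfolding fs_mult_mon_mon l2_inner_mon fs_adj_mon unfolding fs_mult_mon_left by (simp add: algebra_simps)
  next
    case (add b b')
    then show ?case using mon
      by (simp add: fs_mult_add_right l2_inner_add_left fin_supp_fs_mult fin_supp_mon)
  qed
next
  case (add a a')
  then show ?case
    by (simp add: fs_mult_add_left fs_adj_add l2_inner_add_left l2_inner_add_right fin_supp_fs_mult fin_supp_fs_adj)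
qed

text \<open>This is \<open>\<parallel>a \<xi>\<parallel>\<^sup>2 = \<langle>\<xi>, a\<^sup>*a
  \<xi>\<rangle>\<close> followed by Cauchy-Schwarz. Together with submultiplicativity it yields the C*-identity
  for the operator norm.\<close>

lemma l2_norm_mult_square_le:
  assumes "a \<in> fin_supp" "b \<in> fin_supp"
  shows "(l2_norm x (fs_mult \<sigma> a b))\<^sup>2 \<le> l2_norm x b * l2_norm x (fs_mult \<sigma> (fs_mult \<sigma> (fs_adj \<sigma> a) a) b)"
proof -
  have "complex_of_real ((l2_norm x (fs_mult \<sigma> a b))\<^sup>2) = l2_inner x b (fs_mult \<sigma> (fs_adj \<sigma> a) (fs_mult \<sigma> a b))"
    using assms by (subst l2_inner_self[symmetric], subst l2_inner_adjoint) (simp_all add: fin_supp_fs_mult)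
  then have "(l2_norm x (fs_mult \<sigma> a b))\<^sup>2 = cmod (l2_inner x b (fs_mult \<sigma> (fs_adj \<sigma> a) (fs_mult \<sigma> a b)))"
    by (metis abs_of_nonneg norm_of_real zero_le_power2)
  also have "\<dots> \<le> l2_norm x b * l2_norm x (fs_mult \<sigma> (fs_adj \<sigma> a) (fs_mult \<sigma> a b))"
    using assms by (intro l2_inner_bound) (simp_all add: fin_supp_fs_mult fin_supp_fs_adj)
  finally show ?thesis using assms by (simp add: fs_mult_assoc fin_supp_fs_adj)
qed

lemma continuous_bounded:
  assumes "continuous_on UNIV (f :: 'a \<Rightarrow> complex)"
  obtains K where "0 \<le> K" "\<And>x. cmod (f x) \<le> K"
proof -
  have "bounded (range f)"
    using compact_continuous_image[OF assms compact_X] by (simp add: compact_imp_bounded)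
  then obtain K where "\<forall>y\<in>range f. norm y \<le> K" by (auto simp: bounded_iff)
  then show ?thesis using that[of K] by (metis norm_ge_zero order_trans rangeI)
qed

lemma l2_norm_mult_bounded:
  assumes "a \<in> fin_supp"
  shows "\<exists>K\<ge>0. \<forall>b\<in>fin_supp. l2_norm x (fs_mult \<sigma> a b) \<le> K * l2_norm x b"
  using assms
proof (induction a rule: fin_supp_induct)
  case (mon f k)
  obtain K where K: "0 \<le> K" "\<And>x. cmod (f x) \<le> K" using continuous_bounded[OF mon] by blast
  have "l2_norm x (fs_mult \<sigma> (mon f k) b) \<le> K * l2_norm x b" if b: "b \<in> fin_supp" for b
  proof -
    let ?S = "{n. b n \<noteq> (\<lambda>_. 0)}"
    have fin: "finite ?S" using b by (auto simp: fin_supp_def)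
    have sub: "{n. fs_mult \<sigma> (mon f k) b n \<noteq> (\<lambda>_. 0)} \<subseteq> (+) k ` ?S"
    proof
      fix n assume "n \<in> {n. fs_mult \<sigma> (mon f k) b n \<noteq> (\<lambda>_. 0)}"
      then have "b (n - k) \<noteq> (\<lambda>_. 0)" by (auto simp: fs_mult_mon_left)
      then show "n \<in> (+) k ` ?S" by (auto intro!: image_eqI[of _ _ "n - k"])
    qed
    have *: "it (- k) (it (k + m) x) = it m x" for m using it_add[of "- k" "k + m" x] by simp
    have "l2_norm x (fs_mult \<sigma> (mon f k) b)
        = L2_set (\<lambda>m. cmod (fs_mult \<sigma> (mon f k) b (k + m) (it (k + m) x))) ?S"
      unfolding l2_norm_eq[OF finite_imageI[OF fin] sub] L2_set_def
      by (subst sum.reindex) (auto simp: o_def)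
    also have "\<dots> \<le> L2_set (\<lambda>m. K * cmod (b m (it m x))) ?S"
      by (intro L2_set_mono) (auto simp: fs_mult_mon_left * norm_mult K intro!: mult_right_mono)
    also have "\<dots> = K * l2_norm x b"
      by (simp add: l2_norm_def L2_set_right_distrib K)
    finally show ?thesis .
  qed
  with K show ?case by blast
next
  case (add a a')
  then obtain K K' where K: "K \<ge> 0" "\<forall>b\<in>fin_supp. l2_norm x (fs_mult \<sigma> a b) \<le> K * l2_norm x b"
    "K' \<ge> 0" "\<forall>b\<in>fin_supp. l2_norm x (fs_mult \<sigma> a' b) \<le> K' * l2_norm x b" by blast
  have "l2_norm x (fs_mult \<sigma> (\<lambda>n x. a n x + a' n x) b) \<le> (K + K') * l2_norm x b" if "b \<in> fin_supp" for b
    using l2_norm_add[of "fs_mult \<sigma> a b" "fs_mult \<sigma> a' b" x] K that add.hyps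
    by (force simp: fs_mult_add_left fin_supp_fs_mult distrib_right)
  then show ?case using K by (intro exI[of _ "K + K'"]) auto
qed

text \<open>The operator norm, as the least bound; in this form the bound holds without normalising vectors,
  some of which have length zero.\<close>

definition regular_norm :: "'a \<Rightarrow> (int \<Rightarrow> 'a \<Rightarrow> complex) \<Rightarrow> real" where
  "regular_norm x a = Inf {K. 0 \<le> K \<and> (\<forall>b\<in>fin_supp. l2_norm x (fs_mult \<sigma> a b) \<le> K * l2_norm x b)}"

lemma regular_norm_le:
  assumes "0 \<le> K" "\<And>b. b \<in> fin_supp \<Longrightarrow> l2_norm x (fs_mult \<sigma> a b) \<le> K * l2_norm x b"
  shows "regular_norm x a \<le> K"
  unfolding regular_norm_def by (rule cInf_lower) (use assms in \<open>auto simp: bdd_below_def\<close>)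

lemma regular_norm:
  assumes "a \<in> fin_supp"
  shows "0 \<le> regular_norm x a"
    and "b \<in> fin_supp \<Longrightarrow> l2_norm x (fs_mult \<sigma> a b) \<le> regular_norm x a * l2_norm x b"
proof -
  let ?S = "{K. 0 \<le> K \<and> (\<forall>b\<in>fin_supp. l2_norm x (fs_mult \<sigma> a b) \<le> K * l2_norm x b)}"
  have ne: "?S \<noteq> {}" using l2_norm_mult_bounded[OF assms, of x] by auto
  show "0 \<le> regular_norm x a"
    unfolding regular_norm_def by (rule cInf_greatest[OF ne]) auto
  assume b: "b \<in> fin_supp"
  show "l2_norm x (fs_mult \<sigma> a b) \<le> regular_norm x a * l2_norm x b"
  proof (cases "l2_norm x b = 0")
    case True
    then show ?thesis using ne b by fastforce
  next
    case False
    then have pos: "l2_norm x b > 0" using l2_norm_nonneg[of x b] by linarith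
    have "l2_norm x (fs_mult \<sigma> a b) / l2_norm x b \<le> regular_norm x a"
      unfolding regular_norm_def by (rule cInf_greatest[OF ne]) (use b pos in \<open>auto simp: field_simps\<close>)
    then show ?thesis using pos by (simp add: field_simps)
  qed
qed

lemma regular_norm_mult:
  assumes a: "a \<in> fin_supp" and b: "b \<in> fin_supp"
  shows "regular_norm x (fs_mult \<sigma> a b) \<le> regular_norm x a * regular_norm x b"
proof (rule regular_norm_le)
  fix c :: "int \<Rightarrow> 'a \<Rightarrow> complex" assume c: "c \<in> fin_supp"
  have "l2_norm x (fs_mult \<sigma> a (fs_mult \<sigma> b c)) \<le> regular_norm x a * l2_norm x (fs_mult \<sigma> b c)"
    using a b c by (simp add: regular_norm fin_supp_fs_mult)
  also have "\<dots> \<le> regular_norm x a * (regular_norm x b * l2_norm x c)"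
    using a b c by (intro mult_left_mono) (auto simp: regular_norm)
  finally show "l2_norm x (fs_mult \<sigma> (fs_mult \<sigma> a b) c) \<le> regular_norm x a * regular_norm x b * l2_norm x c"
    using a b c by (simp add: fs_mult_assoc)
qed (use regular_norm(1) a b in auto)

lemma cstar_seminorm_regular: "cstar_seminorm \<sigma> (regular_norm x)"
  unfolding cstar_seminorm_def
proof (intro conjI ballI allI)
  fix a b :: "int \<Rightarrow> 'a \<Rightarrow> complex" assume a: "a \<in> fin_supp" and b: "b \<in> fin_supp"
  show "regular_norm x (\<lambda>n x. a n x + b n x) \<le> regular_norm x a + regular_norm x b"
  proof (rule regular_norm_le)
    fix c :: "int \<Rightarrow> 'a \<Rightarrow> complex" assume c: "c \<in> fin_supp"
    show "l2_norm x (fs_mult \<sigma> (\<lambda>n x. a n x + b n x) c) \<le> (regular_norm x a + regular_norm x b) * l2_norm x c"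
      using l2_norm_add[of "fs_mult \<sigma> a c" "fs_mult \<sigma> b c" x] regular_norm(2)[OF a c, of x]
        regular_norm(2)[OF b c, of x] a b c
      by (auto simp: fs_mult_add_left fin_supp_fs_mult distrib_right intro: order_trans)
  qed (use regular_norm(1) a b in auto)
  show "regular_norm x (fs_mult \<sigma> a b) \<le> regular_norm x a * regular_norm x b"
    by (rule regular_norm_mult[OF a b])
next
  fix c and a :: "int \<Rightarrow> 'a \<Rightarrow> complex" assume a: "a \<in> fin_supp"
  have le: "regular_norm x (\<lambda>n x. c * a n x) \<le> cmod c * regular_norm x a"
    if "a \<in> fin_supp" for c and a :: "int \<Rightarrow> 'a \<Rightarrow> complex"
    using that
    by (intro regular_norm_le) (auto simp: regular_norm fs_mult_scale_left l2_norm_scale mult.assoc intro!: mult_left_mono)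
  show "regular_norm x (\<lambda>n x. c * a n x) = cmod c * regular_norm x a"
  proof (cases "c = 0")
    case True
    then show ?thesis using le[OF a, of 0] regular_norm(1)[OF fin_supp_scale[OF a, of "\<lambda>_. 0"], of x] by simp
  next
    case False
    have "regular_norm x a \<le> cmod (inverse c) * regular_norm x (\<lambda>n x. c * a n x)"
      using le[OF fin_supp_scale[OF a, of "\<lambda>_. c"], of "inverse c"] False by (simp flip: mult.assoc)
    then show ?thesis using le[OF a, of c] False by (simp add: norm_inverse norm_divide divide_simps mult.commute)
  qed
next
  fix a :: "int \<Rightarrow> 'a \<Rightarrow> complex" assume a: "a \<in> fin_supp"
  show "0 \<le> regular_norm x a" by (rule regular_norm(1)[OF a])
  let ?R = "regular_norm x"
  \<comment> \<open>The inequality for \<open>a\<close> and its adjoint shows first that the adjoint is isometric.\<close>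
  have sq: "(?R a)\<^sup>2 \<le> ?R (fs_mult \<sigma> (fs_adj \<sigma> a) a)" if a: "a \<in> fin_supp" for a
  proof -
    let ?K = "?R (fs_mult \<sigma> (fs_adj \<sigma> a) a)"
    have K: "0 \<le> ?K" using a by (simp add: regular_norm fin_supp_fs_mult fin_supp_fs_adj)
    have "?R a \<le> sqrt ?K"
    proof (rule regular_norm_le)
      fix b :: "int \<Rightarrow> 'a \<Rightarrow> complex" assume b: "b \<in> fin_supp"
      have "(l2_norm x (fs_mult \<sigma> a b))\<^sup>2 \<le> l2_norm x b * (?K * l2_norm x b)"
        using a b by (intro order_trans[OF l2_norm_mult_square_le] mult_left_mono regular_norm)
          (simp_all add: l2_norm_nonneg fin_supp_fs_mult fin_supp_fs_adj)
      also have "\<dots> = (sqrt ?K * l2_norm x b)\<^sup>2"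
        using K by (simp add: power_mult_distrib power2_eq_square)
      finally show "l2_norm x (fs_mult \<sigma> a b) \<le> sqrt ?K * l2_norm x b"
        by (rule power2_le_imp_le) (simp add: K l2_norm_nonneg)
    qed (simp add: K)
    then show ?thesis using K regular_norm(1)[OF a, of x] by (metis power_mono real_sqrt_pow2)
  qed
  have le: "?R a \<le> ?R (fs_adj \<sigma> a)" if a: "a \<in> fin_supp" for a
  proof -
    have "?R a * ?R a \<le> ?R (fs_adj \<sigma> a) * ?R a"
      using sq[OF a] regular_norm_mult[OF fin_supp_fs_adj[OF a] a, of x] by (simp add: power2_eq_square)
    then show ?thesis
      using regular_norm(1)[OF a, of x] regular_norm(1)[OF fin_supp_fs_adj[OF a], of x]
      by (cases "?R a = 0") auto
  qed
  have "?R (fs_adj \<sigma> a) \<le> ?R a" using le[OF fin_supp_fs_adj[OF a]] by (simp add: fs_adj_adj)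
  then have "?R (fs_mult \<sigma> (fs_adj \<sigma> a) a) \<le> ?R a * ?R a"
    using regular_norm_mult[OF fin_supp_fs_adj[OF a] a, of x] regular_norm(1)[OF a, of x] by (meson mult_right_mono order_trans)
  with sq[OF a] show "?R (fs_mult \<sigma> (fs_adj \<sigma> a) a) = (?R a)\<^sup>2"
    by (simp add: power2_eq_square)
qed

text \<open>Apply \<open>a\<close> to the unit: the coordinates of the resulting vector are the values of the
  coefficients along the orbit.\<close>

lemma coefficient_le_regular_norm:
  assumes "a \<in> fin_supp"
  shows "cmod (a k y) \<le> regular_norm (it (- k) y) a"
proof -
  let ?x = "it (- k) y" and ?e = "mon (\<lambda>_. 1) 0 :: int \<Rightarrow> 'a \<Rightarrow> complex"
  have e: "?e \<in> fin_supp" by (simp add: fin_supp_mon)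
  have ae: "fs_mult \<sigma> a ?e = a"
    using assms
  proof (induction a rule: fin_supp_induct)
    case (add a b)
    then show ?case by (simp add: fs_mult_add_left)
  qed (simp add: fs_mult_mon_mon)
  have "l2_norm ?x ?e = L2_set (\<lambda>k. cmod (?e k (it k ?x))) {0}"
    by (rule l2_norm_eq) (auto simp: mon_def)
  then have "l2_norm ?x ?e = 1" by (simp add: mon_def L2_set_def)
  then have "l2_norm ?x a \<le> regular_norm ?x a" using regular_norm(2)[OF assms e, of ?x] ae by simp
  moreover have "cmod (a k (it k ?x)) \<le> l2_norm ?x a"
  proof (cases "a k = (\<lambda>_. 0)")
    case False
    then show ?thesis unfolding l2_norm_def using assms
      by (intro member_le_L2_set[where f = "\<lambda>k. cmod (a k (it k ?x))"]) (auto simp: fin_supp_def)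
  qed (simp add: l2_norm_nonneg)
  ultimately show ?thesis by simp
qed

end

section \<open>Generalities on C*-algebras\<close>

lemma scaleC_one [simp]: "1 *\<^sub>C (x::'b::unital_cstar_algebra) = x"
  using scaleC_of_real[of 1 x] by simp

lemma scaleC_zero [simp]: "0 *\<^sub>C (x::'b::unital_cstar_algebra) = 0"
  using scaleC_of_real[of 0 x] by simp

lemma scaleC_minus_one: "(-1) *\<^sub>C (x::'b::unital_cstar_algebra) = - x"
  using scaleC_of_real[of "-1" x] by simp

lemma adj_zero [simp]: "adj (0::'b::unital_cstar_algebra) = 0"
  using adj_scaleC[of 0 "0::'b"] by simp

lemma adj_diff: "adj (x - y) = adj x - adj (y::'b::unital_cstar_algebra)"
  using adj_add[of x "(-1) *\<^sub>C y"] adj_scaleC[of "-1" y] by (simp add: scaleC_minus_one)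

lemma norm_adj [simp]: "norm (adj (x::'b::unital_cstar_algebra)) = norm x"
proof -
  have le: "norm y \<le> norm (adj y)" for y :: 'b
  proof (cases "y = 0")
    case False
    have "norm y * norm y \<le> norm (adj y) * norm y"
      using cstar_identity[of y] norm_mult_ineq[of "adj y" y] by (simp add: power2_eq_square)
    with False show ?thesis by simp
  qed simp
  from le[of x] le[of "adj x"] show ?thesis by (simp add: adj_adj)
qed

lemma continuous_on_adj [continuous_intros]:
  assumes "continuous_on S f"
  shows "continuous_on S (\<lambda>x. adj (f x :: 'b::unital_cstar_algebra))"
proof -
  have "continuous_on UNIV (adj :: 'b \<Rightarrow> 'b)"
    unfolding continuous_on_iff by (metis adj_diff dist_norm norm_adj)
  then show ?thesis using continuous_on_compose2[OF _ assms] by blast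
qed

section \<open>Generators of the crossed product\<close>

locale crossed_product = dynamics \<sigma> for \<sigma> :: "'a::t2_space \<Rightarrow> 'a" +
  fixes j :: "(int \<Rightarrow> 'a \<Rightarrow> complex) \<Rightarrow> 'b::unital_cstar_algebra"
  assumes icp: "is_crossed_product \<sigma> j"
begin

lemma j_add: "a \<in> fin_supp \<Longrightarrow> b \<in> fin_supp \<Longrightarrow> j (\<lambda>n x. a n x + b n x) = j a + j b"
  and j_scale: "a \<in> fin_supp \<Longrightarrow> j (\<lambda>n x. c * a n x) = c *\<^sub>C j a"
  and j_mult: "a \<in> fin_supp \<Longrightarrow> b \<in> fin_supp \<Longrightarrow> j (fs_mult \<sigma> a b) = j a * j b"
  and j_adj: "a \<in> fin_supp \<Longrightarrow> j (fs_adj \<sigma> a) = adj (j a)"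
  and j_maximal: "cstar_seminorm \<sigma> p \<Longrightarrow> a \<in> fin_supp \<Longrightarrow> p a \<le> norm (j a)"
  and j_dense: "closure (j ` fin_supp) = UNIV"
  using icp unfolding is_crossed_product_def unital_star_hom_def by blast+

lemma fin_supp_zero: "(\<lambda>n x. 0) \<in> fin_supp"
  by (simp add: fin_supp_def)

lemma j_zero: "j (\<lambda>n x. 0) = 0"
  using j_scale[OF fin_supp_zero, of 0] by simp

lemma j_diff:
  assumes "a \<in> fin_supp" "b \<in> fin_supp"
  shows "j (\<lambda>n x. a n x - b n x) = j a - j b"
  using j_add[OF assms(1) fin_supp_scale[OF assms(2), of "\<lambda>_. -1"]] j_scale[OF assms(2), of "-1"]
  by (simp add: scaleC_minus_one)

lemma j_sum:
  assumes "finite T" "\<And>t. t \<in> T \<Longrightarrow> g t \<in> fin_supp"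
  shows "(\<lambda>n x. \<Sum>t\<in>T. g t n x) \<in> fin_supp \<and> j (\<lambda>n x. \<Sum>t\<in>T. g t n x) = (\<Sum>t\<in>T. j (g t))"
  using assms
proof (induction T rule: finite_induct)
  case empty
  then show ?case using fin_supp_mon[of "\<lambda>_. 0" 0] by (simp add: j_zero mon_def)
next
  case (insert t T)
  then show ?case by (simp add: fin_supp_add j_add)
qed

definition C :: "('a \<Rightarrow> complex) \<Rightarrow> 'b" where "C f = j (fs_embed f)"
definition U :: "int \<Rightarrow> 'b" where "U k = j (mon (\<lambda>_. 1) k)"

lemma C_mon: "C f = j (mon f 0)"
  by (simp add: C_def fs_embed_def mon_def)

lemma C_one: "C (\<lambda>_. 1) = 1"
  using icp by (simp add: C_def is_crossed_product_def unital_star_hom_def)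

lemma U_zero [simp]: "U 0 = 1"
  using C_one by (simp add: U_def C_mon)

lemma C_U: "continuous_on UNIV f \<Longrightarrow> C f * U k = j (mon f k)"
  unfolding C_mon U_def by (subst j_mult[symmetric]) (auto simp: fin_supp_mon fs_mult_mon_mon)

lemma C_mult: "continuous_on UNIV f \<Longrightarrow> continuous_on UNIV g \<Longrightarrow> C f * C g = C (\<lambda>x. f x * g x)"
  unfolding C_mon by (subst j_mult[symmetric]) (auto simp: fin_supp_mon fs_mult_mon_mon)

lemma C_add: "continuous_on UNIV f \<Longrightarrow> continuous_on UNIV g \<Longrightarrow> C f + C g = C (\<lambda>x. f x + g x)"
  unfolding C_mon by (subst j_add[symmetric])
    (auto simp: fin_supp_mon, auto simp: mon_def fun_eq_iff intro!: arg_cong[where f = j])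

lemma C_scale: "continuous_on UNIV f \<Longrightarrow> c *\<^sub>C C f = C (\<lambda>x. c * f x)"
  unfolding C_mon by (subst j_scale[symmetric])
    (auto simp: fin_supp_mon, auto simp: mon_def fun_eq_iff intro!: arg_cong[where f = j])

lemma C_adj: "continuous_on UNIV f \<Longrightarrow> adj (C f) = C (\<lambda>x. cnj (f x))"
  unfolding C_mon by (subst j_adj[symmetric]) (auto simp: fin_supp_mon fs_adj_mon)

lemma U_mult: "U k * U l = U (k + l)"
  unfolding U_def by (subst j_mult[symmetric]) (auto simp: fin_supp_mon fs_mult_mon_mon)

lemma U_adj: "adj (U k) = U (- k)"
  unfolding U_def by (subst j_adj[symmetric]) (auto simp: fin_supp_mon fs_adj_mon)

lemma norm_unitary:
  assumes "adj w * w = (1::'b)"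
  shows "norm w = 1"
  using cstar_identity[of w] assms norm_ge_zero[of w] by (simp add: power2_eq_1_iff)

lemma norm_U: "norm (U k) = 1"
  by (rule norm_unitary) (simp add: U_adj U_mult)

text \<open>A real function with values in \<open>[-1, 1]\<close> is the mean of the unitaries \<open>g
  \<plusminus> i sqrt(1 - g\<^sup>2)\<close>, and the C*-identity reduces complex functions to real ones.\<close>

lemma norm_C_le:
  assumes f: "continuous_on UNIV f" and K: "\<And>x. cmod (f x) \<le> K"
  shows "norm (C f) \<le> K"
proof -
  have real: "norm (C (\<lambda>x. of_real (g x))) \<le> 1"
    if g: "continuous_on UNIV g" and g1: "\<And>x. \<bar>g x\<bar> \<le> 1" for g :: "'a \<Rightarrow> real"
  proof -
    define w where "w x = Complex (g x) (sqrt (1 - (g x)\<^sup>2))" for x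
    have gg: "(g x)\<^sup>2 \<le> 1" for x using g1[of x] by (simp add: abs_square_le_1)
    have w: "continuous_on UNIV w" and w': "continuous_on UNIV (\<lambda>x. cnj (w x))"
      unfolding w_def Complex_eq using g by (auto intro!: continuous_intros)
    have "cnj (w x) * w x = 1" for x
      using gg[of x] by (simp add: w_def complex_eq_iff power2_eq_square)
    then have "adj (C w) * C w = 1"
      using w w' C_one by (simp add: C_adj C_mult)
    then have "norm (C w) = 1" by (rule norm_unitary)
    moreover have "C (\<lambda>x. of_real (g x)) = (1/2) *\<^sub>C (C w + adj (C w))"
      using w w' by (auto simp: C_adj C_add C_scale w_def complex_eq_iff continuous_intros intro!: arg_cong[where f = C])
    ultimately show ?thesis
      using norm_triangle_ineq[of "C w" "adj (C w)"] by (simp add: norm_scaleC)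
  qed
  show ?thesis
  proof (cases "K > 0")
    case True
    let ?g = "\<lambda>x. (cmod (f x) / K)\<^sup>2"
    have g: "continuous_on UNIV ?g" using f True by (auto intro!: continuous_intros)
    have le: "norm (C (\<lambda>x. of_real (?g x))) \<le> 1"
      using K True by (intro real g) (auto simp: abs_square_le_1)
    have square: "cnj z * z = (of_real (cmod z))\<^sup>2" for z
      using complex_norm_square[of z] by (simp add: mult.commute)
    have "adj (C f) * C f = (of_real (K\<^sup>2)) *\<^sub>C C (\<lambda>x. of_real (?g x))"
      using f g True
      by (auto simp: C_adj C_mult C_scale continuous_intros power_divide square
          intro!: arg_cong[where f = C])
    then have "(norm (C f))\<^sup>2 = K\<^sup>2 * norm (C (\<lambda>x. of_real (?g x)))"
      using cstar_identity[of "C f"] by (simp only: norm_scaleC norm_of_real abs_power2)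
    also have "\<dots> \<le> K\<^sup>2 * 1" by (rule mult_left_mono[OF le]) simp
    finally have "(norm (C f))\<^sup>2 \<le> K\<^sup>2" by simp
    then show ?thesis by (rule power2_le_imp_le) (use True in simp)
  next
    case False
    have "cmod (f x) = 0" for x using K[of x] False norm_ge_zero[of "f x"] by linarith
    then have "f = (\<lambda>_. 0)" by auto
    moreover have "K \<ge> 0" using K norm_ge_zero by (rule order_trans[rotated])
    ultimately show ?thesis using C_mon[of "\<lambda>_. 0"] j_zero by (simp add: mon_def)
  qed
qed

lemma norm_j_le:
  assumes "b \<in> fin_supp" "finite K" "{k. b k \<noteq> (\<lambda>_. 0)} \<subseteq> K" "\<And>k x. k \<in> K \<Longrightarrow> cmod (b k x) \<le> B k"
  shows "norm (j b) \<le> (\<Sum>k\<in>K. B k)"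
proof -
  have cont: "continuous_on UNIV (b k)" for k using assms(1) by (auto simp: fin_supp_def)
  have "b = (\<lambda>n x. \<Sum>k\<in>K. mon (b k) k n x)"
  proof (intro ext)
    fix n x
    have "(\<Sum>k\<in>K. mon (b k) k n x) = (\<Sum>k\<in>K. if n = k then b k x else 0)"
      by (intro sum.cong) (auto simp: mon_def)
    also have "\<dots> = b n x" using assms(2,3) by (auto simp: fun_eq_iff)
    finally show "b n x = (\<Sum>k\<in>K. mon (b k) k n x)" by simp
  qed
  then have "j b = (\<Sum>k\<in>K. j (mon (b k) k))"
    using j_sum[OF assms(2), of "\<lambda>k. mon (b k) k"] cont by (metis fin_supp_mon)
  also have "norm \<dots> \<le> (\<Sum>k\<in>K. B k)"
  proof (rule sum_norm_le)
    fix k assume "k \<in> K"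
    have "norm (j (mon (b k) k)) \<le> norm (C (b k)) * norm (U k)"
      using norm_mult_ineq[of "C (b k)" "U k"] C_U[OF cont] by simp
    also have "\<dots> \<le> B k" using norm_C_le[OF cont assms(4)[OF \<open>k \<in> K\<close>]] by (simp add: norm_U)
    finally show "norm (j (mon (b k) k)) \<le> B k" .
  qed
  finally show ?thesis .
qed

section \<open>Fourier coefficients\<close>

lemma coefficient_bound: "b \<in> fin_supp \<Longrightarrow> cmod (b k x) \<le> norm (j b)"
  using coefficient_le_regular_norm j_maximal[OF cstar_seminorm_regular] by (blast intro: order_trans)

lemma approx:
  assumes "e > 0"
  obtains b where "b \<in> fin_supp" "norm (a - j b) < e"
proof -
  have "a \<in> closure (j ` fin_supp)" by (simp add: j_dense)
  then show ?thesis using assms that by (force simp: closure_approachable dist_norm norm_minus_commute)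
qed

lemma dense_induct:
  assumes "closed {a. P a}" "\<And>b. b \<in> fin_supp \<Longrightarrow> P (j b)"
  shows "P a"
  using closure_minimal[of "j ` fin_supp" "{a. P a}"] assms j_dense by auto

text \<open>The extension of the coefficient by continuity: the estimates for all finitely supported
  \<open>b\<close> leave room for one value only, because the images of these \<open>b\<close> are dense.\<close>

definition coef :: "'b \<Rightarrow> int \<Rightarrow> 'a \<Rightarrow> complex" where
  "coef a k x = (SOME c. \<forall>b\<in>fin_supp. cmod (c - b k x) \<le> norm (a - j b))"

lemma coef_approx:
  assumes "b \<in> fin_supp"
  shows "cmod (coef a k x - b k x) \<le> norm (a - j b)"
proof -
  have "a \<in> closure (j ` fin_supp)" by (simp add: j_dense)
  then obtain u where u: "\<And>N. u N \<in> j ` fin_supp" "u \<longlonglongrightarrow> a"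
    unfolding closure_sequential by blast
  have "\<forall>N. \<exists>b. b \<in> fin_supp \<and> u N = j b" using u(1) by auto
  from choice[OF this] obtain s where s: "\<And>N. s N \<in> fin_supp" "\<And>N. u N = j (s N)"
    by blast
  have diff: "cmod (s N k x - b k x) \<le> norm (u N - j b)" if "b \<in> fin_supp" for N b
    using coefficient_bound[OF fin_supp_diff[OF s(1) that]] s that by (simp add: j_diff)
  have "Cauchy (\<lambda>N. s N k x)"
    unfolding Cauchy_def dist_norm
  proof (intro allI impI)
    fix e :: real assume "e > 0"
    then obtain M where "\<And>m n. m \<ge> M \<Longrightarrow> n \<ge> M \<Longrightarrow> norm (u m - u n) < e"
      using LIMSEQ_imp_Cauchy[OF u(2)] unfolding Cauchy_def dist_norm by blast
    then show "\<exists>M. \<forall>m\<ge>M. \<forall>n\<ge>M. cmod (s m k x - s n k x) < e"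
      using diff[OF s(1)] s(2) by (metis le_less_trans)
  qed
  then obtain c where c: "(\<lambda>N. s N k x) \<longlonglongrightarrow> c" using Cauchy_convergent convergent_def by blast
  have "\<forall>b\<in>fin_supp. cmod (c - b k x) \<le> norm (a - j b)"
  proof
    fix b :: "int \<Rightarrow> 'a \<Rightarrow> complex" assume b: "b \<in> fin_supp"
    show "cmod (c - b k x) \<le> norm (a - j b)"
      by (rule LIMSEQ_le[of "\<lambda>N. cmod (s N k x - b k x)" _ "\<lambda>N. norm (u N - j b)"])
        (use c u diff[OF b] in \<open>auto intro!: tendsto_intros\<close>)
  qed
  then have "\<forall>b\<in>fin_supp. cmod (coef a k x - b k x) \<le> norm (a - j b)"
    unfolding coef_def by (rule someI)
  with assms show ?thesis by blast
qed

lemma coef_j [simp]: "b \<in> fin_supp \<Longrightarrow> coef (j b) k x = b k x"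
  using coef_approx[of b "j b" k x] by simp

lemma coef_diff: "coef (a - a') k x = coef a k x - coef a' k x"
proof -
  have "cmod (coef (a - a') k x - (coef a k x - coef a' k x)) \<le> 0 + e" if e: "e > 0" for e
  proof -
    obtain b where b: "b \<in> fin_supp" "norm (a - j b) < e/4" using approx[of "e/4"] e by auto
    obtain b' where b': "b' \<in> fin_supp" "norm (a' - j b') < e/4" using approx[of "e/4"] e by auto
    let ?b = "\<lambda>n x. b n x - b' n x"
    have "norm (a - a' - j ?b) = norm ((a - j b) - (a' - j b'))"
      using b b' by (simp add: j_diff algebra_simps)
    also have "\<dots> \<le> e/4 + e/4" using norm_triangle_ineq4[of "a - j b" "a' - j b'"] b b' by linarith
    finally have "cmod (coef (a - a') k x - (b k x - b' k x)) \<le> e/4 + e/4"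
      using coef_approx[OF fin_supp_diff[OF b(1) b'(1)], of "a - a'" k x] by simp
    moreover have "cmod (coef a k x - b k x) \<le> e/4" "cmod (coef a' k x - b' k x) \<le> e/4"
      using coef_approx[OF b(1), of a k x] coef_approx[OF b'(1), of a' k x] b b' by linarith+
    moreover have "cmod (coef (a - a') k x - (coef a k x - coef a' k x)) =
       cmod ((coef (a - a') k x - (b k x - b' k x)) - ((coef a k x - b k x) - (coef a' k x - b' k x)))"
      by (simp add: algebra_simps)
    ultimately show ?thesis
      using norm_triangle_ineq4[of "coef (a - a') k x - (b k x - b' k x)"
          "(coef a k x - b k x) - (coef a' k x - b' k x)"]
        norm_triangle_ineq4[of "coef a k x - b k x" "coef a' k x - b' k x"] by linarith
  qed
  then have "cmod (coef (a - a') k x - (coef a k x - coef a' k x)) \<le> 0"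
    by (rule field_le_epsilon)
  then show ?thesis by simp
qed

lemma coef_zero [simp]: "coef 0 k x = 0"
  using coef_diff[of 0 0 k x] by simp

lemma coef_bound: "cmod (coef a k x) \<le> norm a"
  using coef_approx[OF fin_supp_zero, of a k x] by (simp add: j_zero)

lemma continuous_coef_fst: "continuous_on UNIV (\<lambda>a. coef a k x)"
  unfolding continuous_on_iff dist_norm by (metis coef_bound coef_diff le_less_trans)

lemma continuous_coef_comp [continuous_intros]:
  "continuous_on S g \<Longrightarrow> continuous_on S (\<lambda>a. coef (g a) k x)"
  using continuous_on_compose2[OF continuous_coef_fst] by blast

lemma coef_add: "coef (a + a') k x = coef a k x + coef a' k x"
  using coef_diff[of "a + a'" a' k x] by simp

lemma continuous_coef: "continuous_on UNIV (coef a k)"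
proof -
  have "\<exists>b. (\<forall>n. continuous_on UNIV (b n)) \<and> (\<forall>n. \<forall>x. cmod (coef a k x - b n x) \<le> inverse (Suc n))"
  proof -
    have "\<exists>b. continuous_on UNIV b \<and> (\<forall>x. cmod (coef a k x - b x) \<le> inverse (Suc n))" for n
    proof -
      obtain b where b: "b \<in> fin_supp" "norm (a - j b) < inverse (Suc n)"
        using approx[of "inverse (Suc n)"] by auto
      then have "continuous_on UNIV (b k)" by (auto simp: fin_supp_def)
      moreover have "cmod (coef a k x - b k x) \<le> inverse (Suc n)" for x
        using coef_approx[OF b(1), of a k x] b(2) by linarith
      ultimately show ?thesis by blast
    qed
    then show ?thesis by metis
  qed
  then obtain b where b: "\<And>n. continuous_on UNIV (b n)"
    "\<And>n x. cmod (coef a k x - b n x) \<le> inverse (real (Suc n))" by blast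
  have "uniform_limit UNIV b (coef a k) sequentially"
  proof (rule uniform_limitI)
    fix e :: real assume "e > 0"
    then have "\<forall>\<^sub>F n in sequentially. inverse (real (Suc n)) < e"
      by (rule order_tendstoD(2)[OF LIMSEQ_inverse_real_of_nat])
    then show "\<forall>\<^sub>F n in sequentially. \<forall>x\<in>UNIV. dist (b n x) (coef a k x) < e"
      by eventually_elim (use b(2) in \<open>auto simp: dist_norm norm_minus_commute intro: le_less_trans\<close>)
  qed
  then show ?thesis using b(1) by (intro uniform_limit_theorem[of _ b]) auto
qed

lemma coef_mon_mult:
  assumes "continuous_on UNIV f"
  shows "coef (C f * U k * a) n x = f x * coef a (n - k) (it (- k) x)"
proof (rule dense_induct[where a = a])
  show "closed {a. coef (C f * U k * a) n x = f x * coef a (n - k) (it (- k) x)}"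
    by (intro closed_Collect_eq continuous_intros)
  fix b :: "int \<Rightarrow> 'a \<Rightarrow> complex" assume b: "b \<in> fin_supp"
  have "C f * U k * j b = j (fs_mult \<sigma> (mon f k) b)"
    using assms b by (simp add: C_U j_mult fin_supp_mon)
  then show "coef (C f * U k * j b) n x = f x * coef (j b) (n - k) (it (- k) x)"
    using assms b coef_j[OF fin_supp_fs_mult[OF fin_supp_mon[OF assms] b], of k n x]
    by (simp add: fs_mult_mon_left)
qed

lemma coef_C_mult: "continuous_on UNIV f \<Longrightarrow> coef (C f * a) n x = f x * coef a n x"
  using coef_mon_mult[of f 0 a n x] by simp

lemma coef_U_mult: "coef (U k * a) n x = coef a (n - k) (it (- k) x)"
  using coef_mon_mult[of "\<lambda>_. 1" k a n x] by (simp add: C_one)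

lemma coef_mult_mon:
  assumes f: "continuous_on UNIV f"
  shows "coef (a * (C f * U k)) n x = coef a (n - k) x * f (it (k - n) x)"
proof (rule dense_induct[where a = a])
  show "closed {a. coef (a * (C f * U k)) n x = coef a (n - k) x * f (it (k - n) x)}"
    by (intro closed_Collect_eq continuous_intros)
  fix b :: "int \<Rightarrow> 'a \<Rightarrow> complex" assume b: "b \<in> fin_supp"
  have "j b * (C f * U k) = j (fs_mult \<sigma> b (mon f k))"
    using f b by (simp add: C_U j_mult fin_supp_mon)
  moreover have "fs_mult \<sigma> b (mon f k) n x = b (n - k) x * f (it (k - n) x)"
  proof -
    let ?K = "insert (n - k) {m. b m \<noteq> (\<lambda>_. 0)}"
    have fin: "finite ?K" using b by (auto simp: fin_supp_def)
    have "fs_mult \<sigma> b (mon f k) n x = (\<Sum>m\<in>?K. if m = n - k then b m x * f (it (- m) x) else 0)"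
      by (subst fs_mult_eq[OF fin]) (auto simp: mon_def intro!: sum.cong)
    then show ?thesis using fin by simp
  qed
  ultimately show "coef (j b * (C f * U k)) n x = coef (j b) (n - k) x * f (it (k - n) x)"
    using f b by (simp add: fin_supp_fs_mult fin_supp_mon)
qed

lemma coef_mult_C: "continuous_on UNIV f \<Longrightarrow> coef (a * C f) n x = coef a n x * f (it (- n) x)"
  using coef_mult_mon[of f a 0 n x] by simp

lemma coef_mult_U: "coef (a * U k) n x = coef a (n - k) x"
  using coef_mult_mon[of "\<lambda>_. 1" a k n x] by (simp add: C_one)

lemma coef_C: "continuous_on UNIV f \<Longrightarrow> coef (C f) n x = (if n = 0 then f x else 0)"
  by (simp add: C_mon fin_supp_mon) (simp add: mon_def)

lemma coef_C_U: "continuous_on UNIV f \<Longrightarrow> coef (C f * U k) n x = (if n = k then f x else 0)"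
  by (simp add: C_U fin_supp_mon) (simp add: mon_def)

lemma coef_adj: "coef (adj a) n x = cnj (coef a (- n) (it (- n) x))"
proof (rule dense_induct[where a = a])
  show "closed {a. coef (adj a) n x = cnj (coef a (- n) (it (- n) x))}"
    by (intro closed_Collect_eq continuous_intros)
  fix b :: "int \<Rightarrow> 'a \<Rightarrow> complex" assume b: "b \<in> fin_supp"
  then show "coef (adj (j b)) n x = cnj (coef (j b) (- n) (it (- n) x))"
    using coef_j[OF fin_supp_fs_adj[OF b], of n x] by (simp add: j_adj) (simp add: fs_adj_def)
qed

end

section \<open>Fejer means\<close>

lemma sum_roots_of_unity_powi:
  assumes "M > 0" "\<bar>n\<bar> < int M"
  shows "(\<Sum>t<M. cis (2 * pi * real t / real M) powi n) = (if n = 0 then of_nat M else 0)"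
proof (cases "n = 0")
  case False
  define w where "w = cis (2 * pi * of_int n / real M)"
  have pow: "cis (2 * pi * real t / real M) powi n = w ^ t" for t
    by (simp add: w_def cis_power_int Complex.DeMoivre mult_ac)
  have wM: "w ^ M = 1"
    using assms(1) by (simp add: w_def Complex.DeMoivre cis_multiple_2pi)
  have "w \<noteq> 1"
  proof
    assume "w = 1"
    then have "cos (2 * pi * of_int n / real M) = 1" by (simp add: w_def complex_eq_iff)
    then obtain m :: int where "2 * pi * of_int n / real M = of_int m * 2 * pi"
      using cos_one_2pi_int by auto
    then have "real_of_int n = of_int m * real M" using assms(1) by (simp add: field_simps)
    then have "n = m * int M" by (metis of_int_eq_iff of_int_mult of_int_of_nat_eq)
    then have "\<bar>m\<bar> * int M < int M" "m \<noteq> 0" using assms False by (auto simp: abs_mult)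
    then show False using assms(1) by (simp add: mult_less_cancel_right1)
  qed
  then have "(\<Sum>t<M. w ^ t) = 0" by (simp add: geometric_sum wM)
  then show ?thesis using False by (simp add: pow)
qed simp

lemma cnj_powi:
  assumes "cmod z = 1"
  shows "cnj z powi k = z powi (- k)"
proof -
  have "z * cnj z = 1" using complex_norm_square[of z] assms by simp
  then have "cnj z = inverse z" by (metis inverse_unique)
  then show ?thesis by (simp add: power_int_minus power_int_inverse)
qed

definition fejer :: "nat \<Rightarrow> int \<Rightarrow> real" where
  "fejer N n = max 0 (1 - \<bar>of_int n\<bar> / of_nat N)"

lemma fejer_0 [simp]: "fejer N 0 = 1"
  by (simp add: fejer_def)

lemma fejer_bounds: "0 \<le> fejer N n" "fejer N n \<le> 1"
  by (auto simp: fejer_def)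

lemma fejer_eq_0: "N > 0 \<Longrightarrow> \<bar>n\<bar> \<ge> int N \<Longrightarrow> fejer N n = 0"
proof -
  assume N: "N > 0" and "\<bar>n\<bar> \<ge> int N"
  then have "real N \<le> \<bar>of_int n\<bar>" by linarith
  with N show ?thesis by (simp add: fejer_def divide_simps)
qed

lemma fejer_tendsto: "(\<lambda>N. fejer N n) \<longlonglongrightarrow> 1"
proof -
  have "(\<lambda>N. max 0 (1 - \<bar>of_int n\<bar> / real N)) \<longlonglongrightarrow> max 0 (1 - 0)"
    by (intro tendsto_intros lim_const_over_n)
  then show ?thesis by (simp add: fejer_def)
qed

text \<open>The Fejer weight is the autocorrelation of the interval \<open>{..<N}\<close>, which makes it
  positive definite.\<close>

lemma fejer_count:
  assumes "N > 0"
  shows "(\<Sum>i<N. \<Sum>l<N. if int i - int l + n = 0 then 1 else 0 :: real) = real N * fejer N n"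
proof -
  have "(\<Sum>l<N. if int i - int l + n = 0 then 1 else 0 :: real)
      = (if 0 \<le> int i + n \<and> int i + n < int N then 1 else 0)" for i
  proof -
    have "(\<Sum>l<N. if int i - int l + n = 0 then 1 else 0 :: real)
        = (\<Sum>l<N. if l = nat (int i + n) \<and> 0 \<le> int i + n then 1 else 0)"
      by (intro sum.cong) auto
    also have "\<dots> = (if 0 \<le> int i + n \<and> int i + n < int N then 1 else 0)"
      by (cases "0 \<le> int i + n") (auto simp: nat_less_iff)
    finally show ?thesis .
  qed
  then have "(\<Sum>i<N. \<Sum>l<N. if int i - int l + n = 0 then 1 else 0 :: real)
      = (\<Sum>i<N. if 0 \<le> int i + n \<and> int i + n < int N then 1 else 0)" by simp
  also have "\<dots> = real (card {i. i < N \<and> 0 \<le> int i + n \<and> int i + n < int N})"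
    by (simp add: sum.If_cases Int_def lessThan_def conj_ac)
  also have "{i. i < N \<and> 0 \<le> int i + n \<and> int i + n < int N} = {nat (- n)..<nat (min (int N) (int N - n))}"
    by auto
  also have "real (card \<dots>) = real N * fejer N n"
    using assms by (auto simp: fejer_def max_def field_simps min_def)
  finally show ?thesis .
qed

text \<open>Sampling the Fejer kernel at the roots of unity of large order turns the usual integral over the
  circle into a finite average: there is no aliasing as long as the order exceeds all frequencies that occur.\<close>

lemma fejer_weights:
  assumes "N > 0" "\<And>n. n \<in> S \<Longrightarrow> \<bar>n\<bar> + int N < int M"  "0 \<in> S"
  obtains w where "\<And>t. 0 \<le> w t"
    "\<And>n. n \<in> S \<Longrightarrow> (\<Sum>t<M. of_real (w t) * cis (2 * pi * real t / real M) powi n) = of_real (fejer N n)"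
proof -
  have M: "M > 0" using assms by fastforce
  define z where "z t = cis (2 * pi * real t / real M)" for t
  define D where "D t = (\<Sum>i<N. z t powi int i)" for t
  define w where "w t = (cmod (D t))\<^sup>2 / (real N * real M)" for t
  have z: "z t \<noteq> 0" for t by (simp add: z_def)
  have cnj_z: "cnj (z t powi k) = z t powi (- k)" for t k
    by (simp add: z_def cis_power_int cis_cnj)
  have D: "of_real ((cmod (D t))\<^sup>2) = (\<Sum>i<N. \<Sum>l<N. z t powi (int i - int l))" for t
    unfolding complex_norm_square D_def cnj_sum sum_product cnj_z
    by (simp only: power_int_add[OF disjI1[OF z], symmetric] diff_conv_add_uminus)
  have "(\<Sum>t<M. of_real (w t) * z t powi n) = of_real (fejer N n)" if n: "n \<in> S" for n
  proof -
    have "(\<Sum>t<M. of_real (w t) * z t powi n)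
       = (\<Sum>t<M. of_real ((cmod (D t))\<^sup>2) * z t powi n) / (of_nat N * of_nat M)"
      by (simp add: w_def sum_divide_distrib)
    also have "(\<Sum>t<M. of_real ((cmod (D t))\<^sup>2) * z t powi n)
       = (\<Sum>t<M. \<Sum>i<N. \<Sum>l<N. z t powi (int i - int l + n))"
      by (simp add: D sum_distrib_right power_int_add[OF disjI1[OF z]] del: of_real_power)
    also have "\<dots> = (\<Sum>i<N. \<Sum>l<N. \<Sum>t<M. z t powi (int i - int l + n))"
      by (subst sum.swap) (intro sum.cong refl sum.swap)
    also have "\<dots> = (\<Sum>i<N. \<Sum>l<N. of_nat M * of_real (if int i - int l + n = 0 then 1 else 0))"
    proof (intro sum.cong refl)
      fix i l assume "i \<in> {..<N}" "l \<in> {..<N}"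
      then have "\<bar>int i - int l + n\<bar> < int M" using assms(2)[OF n] by auto
      then show "(\<Sum>t<M. z t powi (int i - int l + n))
          = of_nat M * of_real (if int i - int l + n = 0 then 1 else 0)"
        unfolding z_def using sum_roots_of_unity_powi[OF M] by simp
    qed
    also have "\<dots> = of_nat M * of_real (\<Sum>i<N. \<Sum>l<N. if int i - int l + n = 0 then 1 else 0)"
      by (simp add: sum_distrib_left)
    also have "\<dots> = of_nat M * of_real (real N * fejer N n)"
      using fejer_count[OF assms(1), of n] by simp
    finally show ?thesis using assms(1) M by simp
  qed
  then show ?thesis using that[of w] unfolding w_def z_def by simp
qed

context crossed_product
begin

text \<open>Multiplying the \<open>n\<close>-th coefficient by \<open>z\<^sup>n\<close> is a *-automorphism, so
  it pulls the norm back to a C*-seminorm; maximality of the norm bounds the latter.\<close>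

lemma norm_dual_action:
  assumes z: "cmod z = 1" and b: "b \<in> fin_supp"
  shows "norm (j (\<lambda>n x. z powi n * b n x)) \<le> norm (j b)"
proof -
  define \<theta> where "\<theta> a = (\<lambda>n x. z powi n * a n x)" for a :: "int \<Rightarrow> 'a \<Rightarrow> complex"
  have z0: "z \<noteq> 0" using z by auto
  have fs: "\<theta> a \<in> fin_supp" if "a \<in> fin_supp" for a
    using fin_supp_scale[OF that] by (simp add: \<theta>_def)
  have mult: "\<theta> (fs_mult \<sigma> a b) = fs_mult \<sigma> (\<theta> a) (\<theta> b)" for a b
  proof -
    have supp: "{k. (\<lambda>x. z powi k * a k x) \<noteq> (\<lambda>_. 0)} = {k. a k \<noteq> (\<lambda>_. 0)}"
      using z0 by (auto simp: fun_eq_iff)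
    have "z powi n = z powi k * z powi (n - k)" for n k
      using z0 power_int_add[of z k "n - k"] by simp
    then have "z powi n * (a k x * c) = z powi k * a k x * (z powi (n - k) * c)" for n k x c
      by simp
    then show ?thesis
      unfolding \<theta>_def fs_mult_def supp sum_distrib_left by (simp only:)
  qed
  have cnj: "cnj z powi (- n) = z powi n" for n
    using cnj_powi[OF z, of "- n"] by simp
  have adj: "\<theta> (fs_adj \<sigma> a) = fs_adj \<sigma> (\<theta> a)" for a
    by (simp add: \<theta>_def fs_adj_def cnj fun_eq_iff)
  have add: "\<theta> (\<lambda>n x. a n x + b n x) = (\<lambda>n x. \<theta> a n x + \<theta> b n x)" for a b
    by (simp add: \<theta>_def algebra_simps)
  have scale: "\<theta> (\<lambda>n x. c * a n x) = (\<lambda>n x. c * \<theta> a n x)" for c a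
    by (simp add: \<theta>_def algebra_simps)
  have "cstar_seminorm \<sigma> (\<lambda>a. norm (j (\<theta> a)))"
    unfolding cstar_seminorm_def
    by (auto simp: add scale mult adj fs fin_supp_fs_adj j_add j_scale j_mult j_adj
        norm_triangle_ineq norm_mult_ineq norm_scaleC cstar_identity)
  from j_maximal[OF this b] show ?thesis by (simp add: \<theta>_def)
qed

text \<open>The Fejer means are convex combinations of images under the dual action.\<close>

lemma norm_fejer_fin_supp:
  assumes b: "b \<in> fin_supp" and N: "N > 0"
  shows "norm (j (\<lambda>n x. of_real (fejer N n) * b n x)) \<le> norm (j b)"
proof -
  let ?S = "insert 0 {n. b n \<noteq> (\<lambda>_. 0)}"
  have fin: "finite ?S" using b by (auto simp: fin_supp_def)
  define M where "M = nat (Max (abs ` ?S)) + N + 1"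
  have "\<bar>n\<bar> + int N < int M" if "n \<in> ?S" for n
    using Max_ge[OF finite_imageI[OF fin] imageI[OF that], of abs] unfolding M_def by linarith
  then obtain w where w: "\<And>t. 0 \<le> w t"
    "\<And>n. n \<in> ?S \<Longrightarrow> (\<Sum>t<M. of_real (w t) * cis (2 * pi * real t / real M) powi n) = of_real (fejer N n)"
    using fejer_weights[OF N, of ?S M] by blast
  define g where "g t = (\<lambda>n x. of_real (w t) * (cis (2 * pi * real t / real M) powi n * b n x))" for t
  have g: "g t \<in> fin_supp" for t
    unfolding g_def using fin_supp_scale[OF b] by (simp add: fin_supp_scale)
  have "of_real (fejer N n) * b n x = (\<Sum>t<M. g t n x)" for n x
  proof (cases "n \<in> ?S")
    case True
    then show ?thesis by (simp add: g_def w(2)[symmetric] sum_distrib_right mult.assoc)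
  qed (simp add: g_def)
  then have "j (\<lambda>n x. of_real (fejer N n) * b n x) = (\<Sum>t<M. j (g t))"
    using j_sum[of "{..<M}" g] g by simp
  also have "norm \<dots> \<le> (\<Sum>t<M. w t * norm (j b))"
  proof (rule sum_norm_le)
    fix t
    have "norm (j (\<lambda>n x. cis (2 * pi * real t / real M) powi n * b n x)) \<le> norm (j b)"
      by (rule norm_dual_action) (use b in simp_all)
    then show "norm (j (g t)) \<le> w t * norm (j b)"
      unfolding g_def using w(1)[of t] by (simp add: j_scale fin_supp_scale b norm_scaleC mult_left_mono)
  qed
  also have "\<dots> = norm (j b)"
  proof -
    have "complex_of_real (\<Sum>t<M. w t) = 1" using w(2)[of 0] by simp
    then have "(\<Sum>t<M. w t) = 1" by (metis of_real_eq_1_iff)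
    then show ?thesis by (simp flip: sum_distrib_right)
  qed
  finally show ?thesis .
qed

definition cesaro :: "nat \<Rightarrow> 'b \<Rightarrow> int \<Rightarrow> 'a \<Rightarrow> complex" where
  "cesaro N a = (\<lambda>n x. of_real (fejer N n) * coef a n x)"

lemma cesaro_supp: "N > 0 \<Longrightarrow> {n. cesaro N a n \<noteq> (\<lambda>_. 0)} \<subseteq> {- int N..int N}"
proof (rule subsetI, rule ccontr)
  fix n assume N: "N > 0" and n: "n \<in> {n. cesaro N a n \<noteq> (\<lambda>_. 0)}" "n \<notin> {- int N..int N}"
  then have "\<bar>n\<bar> \<ge> int N" by auto
  with N n(1) show False by (simp add: cesaro_def fejer_eq_0)
qed

lemma fin_supp_cesaro: "N > 0 \<Longrightarrow> cesaro N a \<in> fin_supp"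
  unfolding fin_supp_def using finite_subset[OF cesaro_supp]
  by (auto simp: cesaro_def intro!: continuous_intros continuous_coef)

lemma cesaro_diff: "cesaro N (a - b) = (\<lambda>n x. cesaro N a n x - cesaro N b n x)"
  by (simp add: cesaro_def coef_diff algebra_simps)

lemma norm_cesaro_le:
  assumes N: "N > 0"
  shows "norm (j (cesaro N a)) \<le> norm a"
proof (rule field_le_epsilon)
  fix e :: real assume e: "e > 0"
  let ?K = "{- int N..int N}"
  define \<delta> where "\<delta> = e / (real (card ?K) + 1)"
  have \<delta>: "\<delta> > 0" using e by (simp add: \<delta>_def)
  obtain b where b: "b \<in> fin_supp" "norm (a - j b) < \<delta>" using approx[OF \<delta>] by blast
  have bound: "cmod (cesaro N (a - j b) k x) \<le> \<delta>" for k x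
  proof -
    have "cmod (cesaro N (a - j b) k x) \<le> 1 * cmod (coef (a - j b) k x)"
      unfolding cesaro_def norm_mult using fejer_bounds[of N k] by (intro mult_right_mono) auto
    also have "\<dots> \<le> \<delta>" using coef_bound[of "a - j b" k x] b by simp
    finally show ?thesis .
  qed
  have "j (cesaro N a) = j (cesaro N (a - j b)) + j (cesaro N (j b))"
    using N by (simp add: cesaro_diff j_diff fin_supp_cesaro)
  then have "norm (j (cesaro N a)) \<le> norm (j (cesaro N (a - j b))) + norm (j (cesaro N (j b)))"
    by (simp add: norm_triangle_ineq)
  moreover have "norm (j (cesaro N (a - j b))) \<le> (\<Sum>k\<in>?K. \<delta>)"
    by (rule norm_j_le[OF fin_supp_cesaro[OF N] _ cesaro_supp[OF N]]) (auto simp: bound)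
  moreover have "norm (j (cesaro N (j b))) \<le> norm (j b)"
    using norm_fejer_fin_supp[OF b(1) N] b(1) by (simp add: cesaro_def)
  moreover have "norm (j b) \<le> norm a + \<delta>"
    using b norm_triangle_ineq3[of a "j b"] by linarith
  moreover have "(\<Sum>k\<in>?K. \<delta>) + \<delta> = e"
    unfolding sum_constant by (simp add: \<delta>_def divide_simps) (simp add: algebra_simps)
  ultimately show "norm (j (cesaro N a)) \<le> norm a + e"
    by linarith
qed

text \<open>Contractivity lets the convergence be checked on finitely supported elements, where only finitely
  many weights matter, each of which tends to \<open>1\<close>.\<close>

lemma cesaro_tendsto: "(\<lambda>N. j (cesaro N a)) \<longlonglongrightarrow> a"
proof (rule metric_LIMSEQ_I)
  fix e :: real assume e: "e > 0"
  obtain b where b: "b \<in> fin_supp" "norm (a - j b) < e/3" using approx[of "e/3"] e by auto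
  let ?K = "{n. b n \<noteq> (\<lambda>_. 0)}"
  have fin: "finite ?K" using b by (simp add: fin_supp_def)
  have "(\<lambda>N. \<Sum>k\<in>?K. \<bar>fejer N k - 1\<bar> * norm (j b)) \<longlonglongrightarrow> (\<Sum>k\<in>?K. \<bar>1 - 1\<bar> * norm (j b))"
    by (intro tendsto_intros fejer_tendsto)
  then have "\<forall>\<^sub>F N in sequentially. (\<Sum>k\<in>?K. \<bar>fejer N k - 1\<bar> * norm (j b)) < e/3"
    using e by (intro order_tendstoD(2)) auto
  then have "\<forall>\<^sub>F N in sequentially. dist (j (cesaro N a)) a < e"
    using eventually_gt_at_top[of 0]
  proof eventually_elim
    fix N :: nat assume small: "(\<Sum>k\<in>?K. \<bar>fejer N k - 1\<bar> * norm (j b)) < e/3" and N: "N > 0"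
    let ?d = "\<lambda>n x. of_real (fejer N n - 1) * b n x"
    have "j (cesaro N (j b)) - j b = j ?d"
      using b N j_diff[OF fin_supp_cesaro[OF N] b(1), of "j b"] by (simp add: cesaro_def algebra_simps)
    also have "norm \<dots> \<le> (\<Sum>k\<in>?K. \<bar>fejer N k - 1\<bar> * norm (j b))"
    proof (rule norm_j_le[OF fin_supp_scale[OF b(1)] fin])
      fix k x
      have "cmod (of_real (fejer N k - 1)) * cmod (b k x) \<le> cmod (of_real (fejer N k - 1)) * norm (j b)"
        by (intro mult_left_mono coefficient_bound[OF b(1)]) simp
      then show "cmod (of_real (fejer N k - 1) * b k x) \<le> \<bar>fejer N k - 1\<bar> * norm (j b)"
        by (simp only: norm_mult norm_of_real)
    qed auto
    finally have 1: "norm (j (cesaro N (j b)) - j b) < e/3" using small by linarith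
    have 2: "norm (j (cesaro N a) - j (cesaro N (j b))) < e/3"
      using norm_cesaro_le[OF N, of "a - j b"] b N by (simp add: cesaro_diff j_diff fin_supp_cesaro)
    have "dist (j (cesaro N a)) a = norm ((j (cesaro N a) - j (cesaro N (j b)))
       + (j (cesaro N (j b)) - j b) + (j b - a))" by (simp add: dist_norm)
    also have "\<dots> \<le> norm (j (cesaro N a) - j (cesaro N (j b)))
       + norm (j (cesaro N (j b)) - j b) + norm (j b - a)"
      by (rule norm_triangle_le, rule add_right_mono, rule norm_triangle_ineq)
    also have "\<dots> < e" using 1 2 b(2) by (simp add: norm_minus_commute)
    finally show "dist (j (cesaro N a)) a < e" .
  qed
  then show "\<exists>N0. \<forall>N\<ge>N0. dist (j (cesaro N a)) a < e" by (simp add: eventually_sequentially)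
qed

lemma coef_eqI:
  assumes "\<And>k x. coef a k x = coef b k x"
  shows "a = b"
proof -
  have "cesaro N a = cesaro N b" for N using assms by (simp add: cesaro_def)
  then have "(\<lambda>N. j (cesaro N a)) \<longlonglongrightarrow> b" using cesaro_tendsto[of b] by simp
  with cesaro_tendsto[of a] show ?thesis by (rule LIMSEQ_unique)
qed

section \<open>The commutant of C(X)\<close>

lemma Urysohn:
  assumes "closed S" "closed T" "S \<inter> T = {}"
  obtains f :: "'a \<Rightarrow> real" where "continuous_on UNIV f" "\<And>x. 0 \<le> f x" "\<And>x. f x \<le> 1"
    "\<And>x. x \<in> S \<Longrightarrow> f x = 0" "\<And>x. x \<in> T \<Longrightarrow> f x = 1"
proof -
  have "normal_space (euclidean :: 'a topology)"
    using compact_X hausdorff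
    by (intro compact_Hausdorff_or_regular_imp_normal_space disjI1)
      (auto simp: compact_space_def Hausdorff_space_def disjnt_def)
  then obtain f where f: "continuous_map euclidean (top_of_set {0..1::real}) f"
    "f ` S \<subseteq> {0}" "f ` T \<subseteq> {1}"
    using Urysohn_lemma[of "euclidean :: 'a topology" S T 0 1] assms by (auto simp: disjnt_def)
  then show ?thesis
    using that[of f] by (auto simp: continuous_map_in_subtopology image_subset_iff Pi_iff)
qed

lemma bump:
  assumes "open V" "x \<in> V"
  obtains f :: "'a \<Rightarrow> real" where "continuous_on UNIV f" "\<And>x. 0 \<le> f x" "\<And>x. f x \<le> 1"
    "\<And>x. x \<notin> V \<Longrightarrow> f x = 0" "f x = 1"
proof -
  have "closed (- V)" "closed {x}" "- V \<inter> {x} = {}" using assms by auto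
  from Urysohn[OF this] show ?thesis using that by auto
qed

abbreviation comm :: "'b set" where "comm \<equiv> commutant (CX j)"

lemma CX_eq: "CX j = {C f | f. continuous_on UNIV f}"
  by (auto simp: CX_def C_def)

lemma C_in_CX: "continuous_on UNIV f \<Longrightarrow> C f \<in> CX j"
  by (auto simp: CX_eq)

text \<open>Compare the coefficients \<open>f(x) a\<^sub>k(x)\<close> of \<open>f a\<close> and
  \<open>a\<^sub>k(x) f(\<sigma>\<^sup>-\<^sup>k x)\<close> of \<open>a f\<close>; continuous functions separate
  \<open>x\<close> from \<open>\<sigma>\<^sup>-\<^sup>k x\<close> if these differ.\<close>

lemma commutant_CX:
  "a \<in> comm \<longleftrightarrow> (\<forall>k x. coef a k x \<noteq> 0 \<longrightarrow> it k x = x)"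
proof
  assume a: "a \<in> comm"
  show "\<forall>k x. coef a k x \<noteq> 0 \<longrightarrow> it k x = x"
  proof (intro allI impI, rule ccontr)
    fix k x assume nz: "coef a k x \<noteq> 0" and "it k x \<noteq> x"
    then have "it (- k) x \<noteq> x" by (metis it_cancel(1))
    then obtain f :: "'a \<Rightarrow> real" where f: "continuous_on UNIV f" "f x = 1" "f (it (- k) x) = 0"
      using bump[of "- {it (- k) x}" x] by (metis Compl_iff open_Compl closed_singleton singleton_iff)
    define g where "g y = complex_of_real (f y)" for y
    have g: "continuous_on UNIV g" unfolding g_def using f by (intro continuous_intros)
    then have "coef (C g * a) k x = coef (a * C g) k x"
      using a C_in_CX[OF g] by (simp add: commutant_def)
    then show False using nz f g by (simp add: coef_C_mult coef_mult_C g_def)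
  qed
next
  assume *: "\<forall>k x. coef a k x \<noteq> 0 \<longrightarrow> it k x = x"
  have "a * C f = C f * a" if "continuous_on UNIV f" for f
  proof (rule coef_eqI)
    fix k x
    show "coef (a * C f) k x = coef (C f * a) k x"
      using *[rule_format, of k x] that it_cancel(2)[of k x]
      by (cases "coef a k x = 0") (auto simp: coef_C_mult coef_mult_C)
  qed
  then show "a \<in> comm" by (auto simp: commutant_def CX_eq)
qed

end

section \<open>The Gelfand transform of the commutant\<close>

text \<open>A factor that is linear in the exponent disappears after taking roots. Exponents that are powers of
  two suffice, and for these the C*-identity computes the norm of a power.\<close>

lemma le_of_power_le:
  fixes u v c :: real
  assumes "0 \<le> u" "0 \<le> v" "\<And>m. u ^ (2 ^ m) \<le> (c * 2 ^ m + 1) * v ^ (2 ^ m)"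
  shows "u \<le> v"
proof (rule ccontr)
  assume "\<not> u \<le> v"
  then have uv: "v < u" by simp
  define s where "s = v / u"
  have s: "0 \<le> s" "s < 1" using assms uv by (auto simp: s_def)
  have "(\<lambda>n. c * (of_nat n * s ^ n) + s ^ n) \<longlonglongrightarrow> c * 0 + 0"
    using s by (intro tendsto_intros powser_times_n_limit_0) (auto intro: LIMSEQ_power_zero)
  from LIMSEQ_subseq_LIMSEQ[OF this, of "\<lambda>m. 2 ^ m"]
  have "(\<lambda>m. c * (of_nat (2 ^ m) * s ^ (2 ^ m)) + s ^ (2 ^ m)) \<longlonglongrightarrow> 0"
    by (simp add: o_def strict_mono_def)
  moreover have "1 \<le> c * (of_nat (2 ^ m) * s ^ (2 ^ m)) + s ^ (2 ^ m)" for m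
  proof -
    have "u ^ (2 ^ m) > 0" using uv assms(2) by simp
    then have "1 \<le> (c * 2 ^ m + 1) * v ^ (2 ^ m) / u ^ (2 ^ m)"
      using assms(3)[of m] by simp
    then show ?thesis by (simp add: s_def power_divide algebra_simps add_divide_distrib)
  qed
  ultimately have "1 \<le> (0::real)" using LIMSEQ_le_const by blast
  then show False by simp
qed

lemma norm_power_normal:
  fixes a :: "'b::unital_cstar_algebra"
  assumes "adj a * a = a * adj a"
  shows "norm (a ^ (2 ^ m)) = norm a ^ (2 ^ m)"
  using assms
proof (induction m arbitrary: a)
  case (Suc m)
  let ?h = "adj a * a"
  have "(norm (a\<^sup>2))\<^sup>2 = norm (adj a * (adj a * a) * a)"
    using cstar_identity[of "a\<^sup>2"] by (simp add: power2_eq_square adj_mult mult.assoc)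
  also have "adj a * (adj a * a) * a = adj a * (a * adj a) * a" using Suc.prems by simp
  also have "\<dots> = adj ?h * ?h" by (simp add: adj_mult adj_adj mult.assoc)
  also have "norm \<dots> = ((norm a)\<^sup>2)\<^sup>2" by (simp only: cstar_identity)
  finally have sq: "norm (a\<^sup>2) = (norm a)\<^sup>2"
    by (rule power2_eq_imp_eq) simp_all
  have "adj (a\<^sup>2) * a\<^sup>2 = adj a * (adj a * a) * a"
    by (simp add: power2_eq_square adj_mult mult.assoc)
  also have "\<dots> = adj a * (a * adj a) * a" using Suc.prems by simp
  also have "\<dots> = (adj a * a) * (adj a * a)" by (simp add: mult.assoc)
  also have "\<dots> = (a * adj a) * (a * adj a)" using Suc.prems by simp
  also have "\<dots> = a * (adj a * a) * adj a" by (simp add: mult.assoc)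
  also have "\<dots> = a * (a * adj a) * adj a" using Suc.prems by simp
  also have "\<dots> = a\<^sup>2 * adj (a\<^sup>2)" by (simp add: power2_eq_square adj_mult mult.assoc)
  finally have "norm ((a\<^sup>2) ^ (2 ^ m)) = norm (a\<^sup>2) ^ (2 ^ m)" by (rule Suc.IH)
  then show ?case by (simp add: sq power_mult flip: power_mult)
qed simp

context crossed_product
begin

text \<open>The finitely supported elements of the commutant, before their image in the crossed product is
  taken.\<close>

definition fin_comm :: "(int \<Rightarrow> 'a \<Rightarrow> complex) set" where
  "fin_comm = {F \<in> fin_supp. \<forall>k x. F k x \<noteq> 0 \<longrightarrow> it k x = x}"

text \<open>On \<open>fin_comm\<close> the twist by \<open>\<sigma>\<close> in the product has no effect, so
  evaluating the trigonometric polynomial with coefficients \<open>F k x\<close> at \<open>z\<close> is a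
  character.\<close>

definition fin_hat :: "(int \<Rightarrow> 'a \<Rightarrow> complex) \<Rightarrow> 'a \<Rightarrow> complex \<Rightarrow> complex" where
  "fin_hat F x z = (\<Sum>k | F k \<noteq> (\<lambda>_. 0). F k x * z powi k)"

lemma fin_hat_eq:
  assumes "finite K" "{k. F k \<noteq> (\<lambda>_. 0)} \<subseteq> K"
  shows "fin_hat F x z = (\<Sum>k\<in>K. F k x * z powi k)"
  unfolding fin_hat_def by (rule sum.mono_neutral_left) (use assms in auto)

lemma fin_comm_fin_supp: "F \<in> fin_comm \<Longrightarrow> F \<in> fin_supp"
  by (simp add: fin_comm_def)

lemma finite_fin_comm: "F \<in> fin_comm \<Longrightarrow> finite {k. F k \<noteq> (\<lambda>_. 0)}"
  by (simp add: fin_comm_def fin_supp_def)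

lemma fin_comm_it: "F \<in> fin_comm \<Longrightarrow> F k x * g (it (- k) x) = F k x * g x"
  unfolding fin_comm_def by (cases "F k x = 0") (auto, metis it_cancel(2))

lemma fin_comm_diff:
  assumes "F \<in> fin_comm" "G \<in> fin_comm"
  shows "(\<lambda>n x. F n x - G n x) \<in> fin_comm"
  unfolding fin_comm_def
proof (intro CollectI conjI allI impI)
  fix n x assume "F n x - G n x \<noteq> 0"
  then have "F n x \<noteq> 0 \<or> G n x \<noteq> 0" by auto
  then show "it n x = x" using assms by (auto simp: fin_comm_def)
qed (use assms in \<open>simp add: fin_comm_fin_supp fin_supp_diff\<close>)

lemma fin_comm_mon: "continuous_on UNIV f \<Longrightarrow> (\<And>x. f x \<noteq> 0 \<Longrightarrow> it k x = x) \<Longrightarrow> mon f k \<in> fin_comm"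
  by (simp add: fin_comm_def fin_supp_mon) (simp add: mon_def)

lemma fs_mult_fin_comm:
  assumes "F \<in> fin_comm" "finite K" "{k. F k \<noteq> (\<lambda>_. 0)} \<subseteq> K"
  shows "fs_mult \<sigma> F G n x = (\<Sum>k\<in>K. F k x * G (n - k) x)"
  by (subst fs_mult_eq[OF assms(2,3)]) (simp add: fin_comm_it[OF assms(1)])

lemma fs_mult_fin_comm_supp:
  assumes "F \<in> fin_comm" "fs_mult \<sigma> F G n x \<noteq> 0"
  obtains k where "F k x \<noteq> 0" "G (n - k) x \<noteq> 0"
proof -
  obtain k where "F k x * G (n - k) x \<noteq> 0"
    using assms(2) unfolding fs_mult_fin_comm[OF assms(1) finite_fin_comm[OF assms(1)] subset_refl]
    by (rule sum.not_neutral_contains_not_neutral)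
  then show ?thesis using that[of k] by simp
qed

lemma fin_comm_mult:
  assumes "F \<in> fin_comm" "G \<in> fin_comm"
  shows "fs_mult \<sigma> F G \<in> fin_comm"
  unfolding fin_comm_def
proof (intro CollectI conjI allI impI)
  fix n x assume "fs_mult \<sigma> F G n x \<noteq> 0"
  then obtain k where "F k x \<noteq> 0" "G (n - k) x \<noteq> 0" using fs_mult_fin_comm_supp[OF assms(1)] by blast
  then have "it k x = x" "it (n - k) x = x" using assms by (auto simp: fin_comm_def)
  then show "it n x = x" using it_add[of k "n - k" x] by simp
qed (use assms in \<open>simp add: fin_comm_fin_supp fin_supp_fs_mult\<close>)

lemma fin_comm_mult_commute:
  assumes "F \<in> fin_comm" "G \<in> fin_comm"
  shows "fs_mult \<sigma> F G = fs_mult \<sigma> G F"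
proof (intro ext)
  fix n x
  let ?K = "{k. F k \<noteq> (\<lambda>_. 0)} \<union> (\<lambda>l. n - l) ` {l. G l \<noteq> (\<lambda>_. 0)}"
  have K: "finite ?K" using assms by (simp add: finite_fin_comm)
  have sub: "{l. G l \<noteq> (\<lambda>_. 0)} \<subseteq> (\<lambda>l. n - l) ` ?K" by (auto simp: image_Un image_image)
  have "fs_mult \<sigma> G F n x = (\<Sum>l\<in>(\<lambda>l. n - l) ` ?K. G l x * F (n - l) x)"
    by (rule fs_mult_fin_comm[OF assms(2) finite_imageI[OF K] sub])
  also have "\<dots> = (\<Sum>k\<in>?K. F k x * G (n - k) x)"
    by (subst sum.reindex) (auto simp: inj_on_def mult.commute)
  also have "\<dots> = fs_mult \<sigma> F G n x"
    by (rule fs_mult_fin_comm[OF assms(1) K, symmetric]) auto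
  finally show "fs_mult \<sigma> F G n x = fs_mult \<sigma> G F n x" ..
qed

lemma fin_hat_mult:
  assumes "F \<in> fin_comm" "G \<in> fin_comm" "z \<noteq> 0"
  shows "fin_hat (fs_mult \<sigma> F G) x z = fin_hat F x z * fin_hat G x z"
proof -
  let ?K = "{k. F k \<noteq> (\<lambda>_. 0)}" and ?L = "{k. G k \<noteq> (\<lambda>_. 0)}"
  let ?S = "(\<lambda>(k, l). k + l) ` (?K \<times> ?L)"
  have fin: "finite ?K" "finite ?L" "finite ?S" using assms by (simp_all add: finite_fin_comm)
  have sub: "{n. fs_mult \<sigma> F G n \<noteq> (\<lambda>_. 0)} \<subseteq> ?S"
  proof
    fix n assume "n \<in> {n. fs_mult \<sigma> F G n \<noteq> (\<lambda>_. 0)}"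
    then obtain x where "fs_mult \<sigma> F G n x \<noteq> 0" by auto
    then obtain k where "F k x \<noteq> 0" "G (n - k) x \<noteq> 0" using fs_mult_fin_comm_supp[OF assms(1)] by blast
    then have "(k, n - k) \<in> ?K \<times> ?L" by auto
    then show "n \<in> ?S" by force
  qed
  have "fin_hat (fs_mult \<sigma> F G) x z = (\<Sum>n\<in>?S. \<Sum>k\<in>?K. F k x * G (n - k) x * z powi n)"
    unfolding fin_hat_eq[OF fin(3) sub] fs_mult_fin_comm[OF assms(1) fin(1) subset_refl] sum_distrib_right ..
  also have "\<dots> = (\<Sum>k\<in>?K. \<Sum>n\<in>?S. F k x * G (n - k) x * z powi n)" by (rule sum.swap)
  also have "\<dots> = (\<Sum>k\<in>?K. F k x * z powi k * fin_hat G x z)"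
  proof (rule sum.cong[OF refl])
    fix k assume k: "k \<in> ?K"
    let ?T = "(\<lambda>n. n - k) ` ?S"
    have "?L \<subseteq> ?T" using k by force
    then have "F k x * z powi k * fin_hat G x z = (\<Sum>l\<in>?T. F k x * z powi k * (G l x * z powi l))"
      using fin by (subst fin_hat_eq[of ?T]) (auto simp: sum_distrib_left)
    also have "\<dots> = (\<Sum>n\<in>?S. F k x * z powi k * (G (n - k) x * z powi (n - k)))"
      by (subst sum.reindex) (auto simp: inj_on_def)
    also have "\<dots> = (\<Sum>n\<in>?S. F k x * G (n - k) x * z powi n)"
    proof (rule sum.cong[OF refl])
      fix n
      have "z powi n = z powi k * z powi (n - k)" using assms(3) power_int_add[of z k "n - k"] by simp
      then show "F k x * z powi k * (G (n - k) x * z powi (n - k)) = F k x * G (n - k) x * z powi n"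
        by simp
    qed
    finally show "(\<Sum>n\<in>?S. F k x * G (n - k) x * z powi n) = F k x * z powi k * fin_hat G x z" ..
  qed
  also have "\<dots> = fin_hat F x z * fin_hat G x z" by (simp add: fin_hat_def sum_distrib_right)
  finally show ?thesis .
qed

lemma fin_hat_diff:
  assumes "F \<in> fin_comm" "G \<in> fin_comm"
  shows "fin_hat (\<lambda>n x. F n x - G n x) x z = fin_hat F x z - fin_hat G x z"
proof -
  let ?K = "{n. F n \<noteq> (\<lambda>_. 0)} \<union> {n. G n \<noteq> (\<lambda>_. 0)}"
  have fin: "finite ?K" using assms by (auto simp: finite_fin_comm)
  then show ?thesis
    by (subst (1 2 3) fin_hat_eq[of ?K]) (auto simp: algebra_simps sum_subtractf)
qed

lemma fin_hat_mon: "fin_hat (mon f k) x z = f x * z powi k"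
  by (subst fin_hat_eq[of "{k}"]) (auto simp: mon_def)

lemma fin_comm_powers:
  assumes "F \<in> fin_comm" "{k. F k \<noteq> (\<lambda>_. 0)} \<subseteq> {- int d..int d}"
  obtains G where "G \<in> fin_comm" "{k. G k \<noteq> (\<lambda>_. 0)} \<subseteq> {- int (N * d)..int (N * d)}" "j G = j F ^ N"
    "\<And>x z. z \<noteq> 0 \<Longrightarrow> fin_hat G x z = fin_hat F x z ^ N"
proof (induction N arbitrary: thesis)
  case 0
  have "j (mon (\<lambda>_. 1) 0) = 1" using C_one by (simp add: C_mon)
  moreover have "{k. mon (\<lambda>_. 1 :: complex) 0 k \<noteq> (\<lambda>_::'a. 0)} \<subseteq> {0}" by (auto simp: mon_def)
  ultimately show ?case using 0[of "mon (\<lambda>_. 1) 0"] by (simp add: fin_hat_mon fin_comm_mon)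
next
  case (Suc N)
  obtain G where G: "G \<in> fin_comm" "{k. G k \<noteq> (\<lambda>_. 0)} \<subseteq> {- int (N * d)..int (N * d)}" "j G = j F ^ N"
    "\<And>x z. z \<noteq> 0 \<Longrightarrow> fin_hat G x z = fin_hat F x z ^ N" using Suc.IH by blast
  show ?case
  proof (rule Suc.prems)
    show "fs_mult \<sigma> F G \<in> fin_comm" by (rule fin_comm_mult[OF assms(1) G(1)])
    show "j (fs_mult \<sigma> F G) = j F ^ Suc N" using assms G by (simp add: j_mult fin_comm_fin_supp)
    show "fin_hat (fs_mult \<sigma> F G) x z = fin_hat F x z ^ Suc N" if "z \<noteq> 0" for x z
      using that assms G by (simp add: fin_hat_mult)
    show "{k. fs_mult \<sigma> F G k \<noteq> (\<lambda>_. 0)} \<subseteq> {- int (Suc N * d)..int (Suc N * d)}"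
    proof
      fix n assume "n \<in> {n. fs_mult \<sigma> F G n \<noteq> (\<lambda>_. 0)}"
      then obtain x where "fs_mult \<sigma> F G n x \<noteq> 0" by auto
      then obtain k where "F k x \<noteq> 0" "G (n - k) x \<noteq> 0" using fs_mult_fin_comm_supp[OF assms(1)] by blast
      then have "k \<in> {- int d..int d}" "n - k \<in> {- int (N * d)..int (N * d)}"
        using assms(2) G(2) by fastforce+
      then show "n \<in> {- int (Suc N * d)..int (Suc N * d)}" by auto
    qed
  qed
qed

lemma fin_comm_degree:
  assumes "F \<in> fin_comm"
  obtains d where "{k. F k \<noteq> (\<lambda>_. 0)} \<subseteq> {- int d..int d}"
proof -
  have fin: "finite (insert 0 {k. F k \<noteq> (\<lambda>_. 0)})" using finite_fin_comm[OF assms] by simp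
  show ?thesis
  proof (rule that[of "nat (Max (abs ` insert 0 {k. F k \<noteq> (\<lambda>_. 0)}))"], rule subsetI)
    fix k assume "k \<in> {k. F k \<noteq> (\<lambda>_. 0)}"
    then have "\<bar>k\<bar> \<le> Max (abs ` insert 0 {k. F k \<noteq> (\<lambda>_. 0)})"
      using Max_ge[OF finite_imageI[OF fin] imageI[of k _ abs]] by simp
    then show "k \<in> {- int (nat (Max (abs ` insert 0 {k. F k \<noteq> (\<lambda>_. 0)})))..int (nat (Max (abs ` insert 0 {k. F k \<noteq> (\<lambda>_. 0)})))}"
      by auto
  qed
qed

lemma coefficient_le_fin_hat:
  assumes F: "F \<in> fin_comm" and K: "\<And>z. cmod z = 1 \<Longrightarrow> cmod (fin_hat F x z) \<le> K"
  shows "cmod (F k x) \<le> K"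
proof -
  obtain d where d: "{k. F k \<noteq> (\<lambda>_. 0)} \<subseteq> {- int d..int d}" using fin_comm_degree[OF F] by blast
  define M where "M = nat \<bar>k\<bar> + d + 1"
  define w where "w t = cis (2 * pi * real t / real M)" for t
  have w: "cmod (w t) = 1" "w t \<noteq> 0" for t by (simp_all add: w_def)
  let ?S = "insert k {- int d..int d}"
  have S: "finite ?S" "{k. F k \<noteq> (\<lambda>_. 0)} \<subseteq> ?S" using d by auto
  have "(\<Sum>t<M. fin_hat F x (w t) * w t powi (- k)) = (\<Sum>t<M. \<Sum>l\<in>?S. F l x * w t powi (l - k))"
    by (simp add: fin_hat_eq[OF S] sum_distrib_right mult.assoc diff_conv_add_uminus
        power_int_add[OF disjI1[OF w(2)], symmetric] del: add_uminus_conv_diff)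
  also have "\<dots> = (\<Sum>l\<in>?S. F l x * (\<Sum>t<M. w t powi (l - k)))"
    by (subst sum.swap) (simp add: sum_distrib_left)
  also have "\<dots> = (\<Sum>l\<in>?S. if l = k then F l x * of_nat M else 0)"
  proof (rule sum.cong[OF refl])
    fix l assume "l \<in> ?S"
    then have "\<bar>l - k\<bar> < int M" unfolding M_def by auto
    then show "F l x * (\<Sum>t<M. w t powi (l - k)) = (if l = k then F l x * of_nat M else 0)"
      unfolding w_def using sum_roots_of_unity_powi[of M "l - k"] by (auto simp: M_def)
  qed
  also have "\<dots> = F k x * of_nat M" by (subst sum.delta[OF S(1)]) simp
  finally have "cmod (F k x) * real M = cmod (\<Sum>t<M. fin_hat F x (w t) * w t powi (- k))"
    by (simp add: norm_mult)
  also have "\<dots> \<le> (\<Sum>t<M. K)"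
    by (rule sum_norm_le) (simp add: norm_mult norm_power_int w K)
  finally have "cmod (F k x) * real M \<le> K * real M" by (simp add: mult.commute)
  then show ?thesis unfolding M_def by (simp add: mult_le_cancel_right)
qed

text \<open>Each coefficient is bounded by the norm, so \<open>|fin_hat F|\<close> is at most the number of
  coefficients times the norm. Applied to powers of \<open>F\<close>, whose degree grows only linearly, this
  gives the estimate without the factor.\<close>

lemma fin_hat_le_norm:
  assumes F: "F \<in> fin_comm" and z: "cmod z = 1"
  shows "cmod (fin_hat F x z) \<le> norm (j F)"
proof -
  obtain d where d: "{k. F k \<noteq> (\<lambda>_. 0)} \<subseteq> {- int d..int d}" using fin_comm_degree[OF F] by blast
  show ?thesis
  proof (rule le_of_power_le[where c = "2 * real d"])
    fix m
    let ?N = "(2::nat) ^ m"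
    obtain G where G: "G \<in> fin_comm" "{k. G k \<noteq> (\<lambda>_. 0)} \<subseteq> {- int (?N * d)..int (?N * d)}"
      "j G = j F ^ ?N" "\<And>x z. z \<noteq> 0 \<Longrightarrow> fin_hat G x z = fin_hat F x z ^ ?N"
      using fin_comm_powers[OF F d, of ?N] by blast
    have z0: "z \<noteq> 0" using z by auto
    have "cmod (fin_hat F x z) ^ ?N = cmod (fin_hat G x z)" using G(4)[OF z0] by (simp add: norm_power)
    also have "\<dots> \<le> (\<Sum>k\<in>{- int (?N * d)..int (?N * d)}. norm (j F) ^ ?N)"
      unfolding fin_hat_eq[OF finite_atLeastAtMost_int G(2)]
    proof (rule sum_norm_le)
      fix k
      have "cmod (G k x) \<le> norm (j F ^ ?N)" using coefficient_bound[OF fin_comm_fin_supp[OF G(1)], of k x] G(3) by simp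
      also have "\<dots> \<le> norm (j F) ^ ?N" by (rule norm_power_ineq)
      finally show "cmod (G k x * z powi k) \<le> norm (j F) ^ ?N" using z by (simp add: norm_mult norm_power_int)
    qed
    also have "\<dots> = (2 * real d * 2 ^ m + 1) * norm (j F) ^ ?N"
      by (simp add: algebra_simps nat_add_distrib nat_mult_distrib)
    finally show "cmod (fin_hat F x z) ^ ?N \<le> (2 * real d * 2 ^ m + 1) * norm (j F) ^ ?N" .
  qed simp_all
qed

lemma fin_comm_commute: "F \<in> fin_comm \<Longrightarrow> G \<in> fin_comm \<Longrightarrow> j F * j G = j G * j F"
  using fin_comm_mult_commute by (simp add: fin_comm_fin_supp flip: j_mult)

lemma fin_comm_adj: "F \<in> fin_comm \<Longrightarrow> fs_adj \<sigma> F \<in> fin_comm"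
proof -
  assume F: "F \<in> fin_comm"
  have "it k x = x" if "fs_adj \<sigma> F k x \<noteq> 0" for k x
  proof -
    have "F (- k) (it (- k) x) \<noteq> 0" using that by (simp add: fs_adj_def)
    then have "it (- k) (it (- k) x) = it (- k) x" using F by (auto simp: fin_comm_def)
    then show ?thesis by (metis it_cancel(1))
  qed
  with F show ?thesis by (simp add: fin_comm_def fin_supp_fs_adj)
qed

text \<open>Conversely each coefficient is an average of values of \<open>fin_hat F\<close> over roots of unity,
  and the norm is at most the sum of the sup-norms of the coefficients. Again powers remove the factor; here
  normality of \<open>j F\<close> is what makes the norm multiplicative on the powers.\<close>

lemma norm_le_fin_hat:
  assumes F: "F \<in> fin_comm" and K: "\<And>x z. cmod z = 1 \<Longrightarrow> cmod (fin_hat F x z) \<le> K"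
  shows "norm (j F) \<le> K"
proof -
  obtain d where d: "{k. F k \<noteq> (\<lambda>_. 0)} \<subseteq> {- int d..int d}" using fin_comm_degree[OF F] by blast
  have K0: "K \<ge> 0" using order_trans[OF norm_ge_zero K[of 1]] by simp
  have normal: "adj (j F) * j F = j F * adj (j F)"
    using fin_comm_commute[OF F fin_comm_adj[OF F]] by (simp add: j_adj[OF fin_comm_fin_supp[OF F]])
  show ?thesis
  proof (rule le_of_power_le[where c = "2 * real d"])
    fix m
    let ?N = "(2::nat) ^ m"
    obtain G where G: "G \<in> fin_comm" "{k. G k \<noteq> (\<lambda>_. 0)} \<subseteq> {- int (?N * d)..int (?N * d)}"
      "j G = j F ^ ?N" "\<And>x z. z \<noteq> 0 \<Longrightarrow> fin_hat G x z = fin_hat F x z ^ ?N"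
      using fin_comm_powers[OF F d, of ?N] by blast
    have "cmod (fin_hat G x z) \<le> K ^ ?N" if "cmod z = 1" for x z
    proof -
      have "z \<noteq> 0" using that by auto
      then show ?thesis using K[OF that, of x] by (simp add: G(4) norm_power power_mono)
    qed
    then have bound: "cmod (G k x) \<le> K ^ ?N" for k x by (rule coefficient_le_fin_hat[OF G(1)])
    have "norm (j F) ^ ?N = norm (j G)" using norm_power_normal[OF normal, of m] G(3) by simp
    also have "\<dots> \<le> (\<Sum>k\<in>{- int (?N * d)..int (?N * d)}. K ^ ?N)"
      by (rule norm_j_le[OF fin_comm_fin_supp[OF G(1)] _ G(2)]) (use bound in auto)
    also have "\<dots> = (2 * real d * 2 ^ m + 1) * K ^ ?N"
      by (simp add: algebra_simps nat_add_distrib nat_mult_distrib)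
    finally show "norm (j F) ^ ?N \<le> (2 * real d * 2 ^ m + 1) * K ^ ?N" .
  qed (use K0 in simp_all)
qed

lemma fin_comm_in_comm: "F \<in> fin_comm \<Longrightarrow> j F \<in> comm"
  by (auto simp: commutant_CX fin_comm_fin_supp) (auto simp: fin_comm_def)

lemma cesaro_fin_comm: "a \<in> comm \<Longrightarrow> cesaro (Suc N) a \<in> fin_comm"
  by (simp add: fin_comm_def fin_supp_cesaro) (simp add: commutant_CX cesaro_def)

lemma cesaro_Suc_tendsto: "(\<lambda>N. j (cesaro (Suc N) a)) \<longlonglongrightarrow> a"
  using LIMSEQ_Suc[OF cesaro_tendsto] .

lemma comm_zero: "0 \<in> comm"
  by (simp add: commutant_CX)

lemma comm_add: "a \<in> comm \<Longrightarrow> b \<in> comm \<Longrightarrow> a + b \<in> comm"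
  by (simp add: commutant_def algebra_simps)

lemma comm_diff: "a \<in> comm \<Longrightarrow> b \<in> comm \<Longrightarrow> a - b \<in> comm"
  by (simp add: commutant_def algebra_simps)

lemma comm_scale: "a \<in> comm \<Longrightarrow> c *\<^sub>C a \<in> comm"
  by (simp add: commutant_def mult_scaleC_left mult_scaleC_right)

lemma comm_mult: "a \<in> comm \<Longrightarrow> b \<in> comm \<Longrightarrow> a * b \<in> comm"
  unfolding commutant_def by (auto, metis mult.assoc)

lemma comm_adj:
  assumes "a \<in> comm"
  shows "adj a \<in> comm"
  unfolding commutant_CX
proof (intro allI impI)
  fix k x assume "coef (adj a) k x \<noteq> 0"
  then have "it (- k) (it (- k) x) = it (- k) x"
    using assms by (simp add: coef_adj commutant_CX)
  then show "it k x = x" by (metis it_cancel(1))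
qed

lemma closed_comm: "closed comm"
proof -
  have "comm = (\<Inter>b\<in>CX j. {a. a * b = b * a})" by (auto simp: commutant_def)
  then show ?thesis by (simp only:) (intro closed_INT ballI closed_Collect_eq continuous_intros)
qed

lemma comm_commute:
  assumes "a \<in> comm" "b \<in> comm"
  shows "a * b = b * a"
proof -
  let ?F = "\<lambda>N. cesaro (Suc N) a" and ?G = "\<lambda>N. cesaro (Suc N) b"
  have "(\<lambda>N. j (?F N) * j (?G N)) \<longlonglongrightarrow> a * b" "(\<lambda>N. j (?G N) * j (?F N)) \<longlonglongrightarrow> b * a"
    by (intro tendsto_intros cesaro_Suc_tendsto)+
  then show ?thesis using fin_comm_commute[OF cesaro_fin_comm[OF assms(1)] cesaro_fin_comm[OF assms(2)]]
    by (simp add: LIMSEQ_unique)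
qed

text \<open>The Fourier series need not converge, but its Fejer means do, uniformly in \<open>x\<close> and
  \<open>z\<close>.\<close>

definition hat :: "'b \<Rightarrow> 'a \<Rightarrow> complex \<Rightarrow> complex" where
  "hat a x z = lim (\<lambda>N. fin_hat (cesaro (Suc N) a) x z)"

lemma hat_approx:
  assumes a: "a \<in> comm" and F: "F \<in> fin_comm" and z: "cmod z = 1"
  shows "cmod (hat a x z - fin_hat F x z) \<le> norm (a - j F)"
proof -
  let ?s = "\<lambda>N. fin_hat (cesaro (Suc N) a) x z" and ?u = "\<lambda>N. j (cesaro (Suc N) a)"
  have diff: "cmod (?s N - fin_hat G x z) \<le> norm (?u N - j G)" if "G \<in> fin_comm" for G N
    using fin_hat_le_norm[OF fin_comm_diff[OF cesaro_fin_comm[OF a] that] z, of N x] cesaro_fin_comm[OF a] that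
    by (simp add: fin_hat_diff j_diff fin_comm_fin_supp)
  have "Cauchy ?s"
    unfolding Cauchy_def dist_norm
  proof (intro allI impI)
    fix e :: real assume "e > 0"
    then obtain M where "\<And>m n. m \<ge> M \<Longrightarrow> n \<ge> M \<Longrightarrow> norm (?u m - ?u n) < e"
      using LIMSEQ_imp_Cauchy[OF cesaro_Suc_tendsto, of a] unfolding Cauchy_def dist_norm by blast
    note M = this
    show "\<exists>M. \<forall>m\<ge>M. \<forall>n\<ge>M. cmod (?s m - ?s n) < e"
    proof (intro exI allI impI)
      fix m n assume "m \<ge> M" "n \<ge> M"
      then show "cmod (?s m - ?s n) < e"
        by (rule le_less_trans[OF diff[OF cesaro_fin_comm[OF a]] M])
    qed
  qed
  then have "?s \<longlonglongrightarrow> hat a x z"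
    unfolding hat_def using Cauchy_convergent convergent_LIMSEQ_iff by blast
  then have "(\<lambda>N. cmod (?s N - fin_hat F x z)) \<longlonglongrightarrow> cmod (hat a x z - fin_hat F x z)"
    by (intro tendsto_intros)
  moreover have "(\<lambda>N. norm (?u N - j F)) \<longlonglongrightarrow> norm (a - j F)"
    by (intro tendsto_intros cesaro_Suc_tendsto)
  ultimately show ?thesis by (rule LIMSEQ_le) (use diff[OF F] in auto)
qed

lemma hat_tendsto:
  assumes "a \<in> comm" "\<And>N. F N \<in> fin_comm" "(\<lambda>N. j (F N)) \<longlonglongrightarrow> a" "cmod z = 1"
  shows "(\<lambda>N. fin_hat (F N) x z) \<longlonglongrightarrow> hat a x z"
proof -
  have "(\<lambda>N. norm (a - j (F N))) \<longlonglongrightarrow> norm (a - a)"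
    by (intro tendsto_intros assms)
  then have lim: "(\<lambda>N. norm (a - j (F N))) \<longlonglongrightarrow> 0" by simp
  have "cmod (fin_hat (F N) x z - hat a x z) \<le> norm (a - j (F N))" for N
    using hat_approx[OF assms(1,2,4)] by (subst norm_minus_commute)
  then have "(\<lambda>N. fin_hat (F N) x z - hat a x z) \<longlonglongrightarrow> 0"
    by (intro Lim_null_comparison[OF always_eventually lim] allI)
  then show ?thesis by (simp add: LIM_zero_cancel)
qed

lemma hat_j: "F \<in> fin_comm \<Longrightarrow> cmod z = 1 \<Longrightarrow> hat (j F) x z = fin_hat F x z"
  using hat_approx[OF fin_comm_in_comm, of F F z x] by simp

lemma hat_diff:
  assumes "a \<in> comm" "b \<in> comm" "cmod z = 1"
  shows "hat (a - b) x z = hat a x z - hat b x z"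
proof (rule LIMSEQ_unique)
  let ?F = "\<lambda>N. cesaro (Suc N) a" and ?G = "\<lambda>N. cesaro (Suc N) b"
  have "(\<lambda>N. j (\<lambda>n x. ?F N n x - ?G N n x)) \<longlonglongrightarrow> a - b"
    using tendsto_diff[OF cesaro_Suc_tendsto cesaro_Suc_tendsto, of a b] cesaro_fin_comm[OF assms(1)] cesaro_fin_comm[OF assms(2)]
    by (simp add: j_diff fin_comm_fin_supp)
  then show "(\<lambda>N. fin_hat (\<lambda>n x. ?F N n x - ?G N n x) x z) \<longlonglongrightarrow> hat (a - b) x z"
    using assms by (intro hat_tendsto comm_diff fin_comm_diff cesaro_fin_comm)
  show "(\<lambda>N. fin_hat (\<lambda>n x. ?F N n x - ?G N n x) x z) \<longlonglongrightarrow> hat a x z - hat b x z"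
    using assms by (auto simp: fin_hat_diff cesaro_fin_comm intro!: tendsto_diff hat_tendsto cesaro_Suc_tendsto)
qed

lemma hat_mult:
  assumes "a \<in> comm" "b \<in> comm" "cmod z = 1"
  shows "hat (a * b) x z = hat a x z * hat b x z"
proof (rule LIMSEQ_unique)
  let ?F = "\<lambda>N. cesaro (Suc N) a" and ?G = "\<lambda>N. cesaro (Suc N) b"
  have z: "z \<noteq> 0" using assms(3) by auto
  have "(\<lambda>N. j (fs_mult \<sigma> (?F N) (?G N))) \<longlonglongrightarrow> a * b"
    using tendsto_mult[OF cesaro_Suc_tendsto cesaro_Suc_tendsto, of a b] cesaro_fin_comm[OF assms(1)] cesaro_fin_comm[OF assms(2)]
    by (simp add: j_mult fin_comm_fin_supp)
  then show "(\<lambda>N. fin_hat (fs_mult \<sigma> (?F N) (?G N)) x z) \<longlonglongrightarrow> hat (a * b) x z"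
    using assms by (intro hat_tendsto comm_mult fin_comm_mult cesaro_fin_comm)
  show "(\<lambda>N. fin_hat (fs_mult \<sigma> (?F N) (?G N)) x z) \<longlonglongrightarrow> hat a x z * hat b x z"
    using assms z by (auto simp: fin_hat_mult cesaro_fin_comm intro!: tendsto_mult hat_tendsto cesaro_Suc_tendsto)
qed

lemma hat_mon:
  assumes "continuous_on UNIV f" "\<And>x. f x \<noteq> 0 \<Longrightarrow> it k x = x"
  shows "C f * U k \<in> comm" "cmod z = 1 \<Longrightarrow> hat (C f * U k) x z = f x * z powi k"
  using fin_comm_mon[OF assms] fin_comm_in_comm hat_j by (auto simp: C_U[OF assms(1)] fin_hat_mon)

lemma hat_C:
  assumes "continuous_on UNIV f"
  shows "C f \<in> comm" "cmod z = 1 \<Longrightarrow> hat (C f) x z = f x"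
  using hat_mon[OF assms, of 0] by auto

lemma hat_zero: "cmod z = 1 \<Longrightarrow> hat 0 x z = 0"
  using hat_diff[OF comm_zero comm_zero] by simp

lemma hat_add:
  assumes "a \<in> comm" "b \<in> comm" "cmod z = 1"
  shows "hat (a + b) x z = hat a x z + hat b x z"
  using hat_diff[OF comm_add[OF assms(1,2)] assms(2,3)] by simp

lemma scaleC_eq: "c *\<^sub>C a = C (\<lambda>_. c) * a"
proof -
  have "C (\<lambda>_. c) = c *\<^sub>C 1" using C_scale[of "\<lambda>_. 1" c] by (simp add: C_one)
  then show ?thesis by (simp add: mult_scaleC_left)
qed

lemma hat_scale:
  assumes "a \<in> comm" "cmod z = 1"
  shows "hat (c *\<^sub>C a) x z = c * hat a x z"
  using assms by (simp add: scaleC_eq hat_mult hat_C)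

lemma hat_adj:
  assumes "a \<in> comm" "cmod z = 1"
  shows "hat (adj a) x z = cnj (hat a x z)"
proof (rule LIMSEQ_unique)
  let ?F = "\<lambda>N. cesaro (Suc N) a"
  have fin_hat: "fin_hat (fs_adj \<sigma> F) x z = cnj (fin_hat F x z)" if F: "F \<in> fin_comm" for F
  proof -
    let ?K = "uminus ` {k. F k \<noteq> (\<lambda>_. 0)}"
    have sub: "{k. fs_adj \<sigma> F k \<noteq> (\<lambda>_. 0)} \<subseteq> ?K"
    proof
      fix k assume "k \<in> {k. fs_adj \<sigma> F k \<noteq> (\<lambda>_. 0)}"
      then have "F (- k) \<noteq> (\<lambda>_. 0)" by (auto simp: fs_adj_def)
      then show "k \<in> ?K" by (auto intro!: image_eqI[of _ _ "- k"])
    qed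
    have "fs_adj \<sigma> F k x = cnj (F (- k) x)" for k
    proof (cases "it k x = x")
      case True
      then have "it (- k) x = x" by (metis it_cancel(2))
      then show ?thesis by (simp add: fs_adj_def)
    next
      case False
      then have "it (- k) x \<noteq> x" by (metis it_cancel(1))
      then have "F (- k) x = 0" using F by (auto simp: fin_comm_def)
      moreover have "fs_adj \<sigma> F k x = 0" using fin_comm_adj[OF F] False by (auto simp: fin_comm_def)
      ultimately show ?thesis by simp
    qed
    then have "fin_hat (fs_adj \<sigma> F) x z = (\<Sum>k\<in>?K. cnj (F (- k) x) * z powi k)"
      using finite_fin_comm[OF F] sub by (subst fin_hat_eq[of ?K]) auto
    also have "\<dots> = cnj (fin_hat F x z)"
      by (subst sum.reindex) (simp_all add: fin_hat_def cnj_powi[OF assms(2)] inj_on_def)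
    finally show ?thesis .
  qed
  have "(\<lambda>N. adj (j (?F N))) \<longlonglongrightarrow> adj a"
    using continuous_on_adj[OF continuous_on_id, of "UNIV :: 'b set"] cesaro_Suc_tendsto[of a]
      isCont_tendsto_compose[of a adj] by (simp add: continuous_on_eq_continuous_at)
  then have "(\<lambda>N. j (fs_adj \<sigma> (?F N))) \<longlonglongrightarrow> adj a"
    using cesaro_fin_comm[OF assms(1)] by (simp add: j_adj fin_comm_fin_supp)
  then show "(\<lambda>N. fin_hat (fs_adj \<sigma> (?F N)) x z) \<longlonglongrightarrow> hat (adj a) x z"
    using assms by (intro hat_tendsto comm_adj fin_comm_adj cesaro_fin_comm)
  show "(\<lambda>N. fin_hat (fs_adj \<sigma> (?F N)) x z) \<longlonglongrightarrow> cnj (hat a x z)"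
    using assms by (auto simp: fin_hat cesaro_fin_comm intro!: tendsto_cnj hat_tendsto cesaro_Suc_tendsto)
qed

lemma hat_bound: "a \<in> comm \<Longrightarrow> cmod z = 1 \<Longrightarrow> cmod (hat a x z) \<le> norm a"
  using hat_approx[of a "mon (\<lambda>_. 0) 0" z x] C_mon[of "\<lambda>_. 0"] C_scale[of "\<lambda>_. 0" 0]
  by (simp add: fin_comm_mon fin_hat_mon)

lemma norm_le_hat:
  assumes a: "a \<in> comm" and K: "\<And>x z. cmod z = 1 \<Longrightarrow> cmod (hat a x z) \<le> K"
  shows "norm a \<le> K"
proof -
  let ?F = "\<lambda>N. cesaro (Suc N) a"
  have "norm (j (?F N)) \<le> K + norm (a - j (?F N))" for N
  proof (rule norm_le_fin_hat[OF cesaro_fin_comm[OF a]])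
    fix x z assume z: "cmod z = 1"
    show "cmod (fin_hat (?F N) x z) \<le> K + norm (a - j (?F N))"
      using K[OF z, of x] hat_approx[OF a cesaro_fin_comm[OF a] z, of x N]
        norm_triangle_ineq3[of "fin_hat (?F N) x z" "hat a x z"] by (simp add: norm_minus_commute)
  qed
  moreover have "(\<lambda>N. norm (j (?F N))) \<longlonglongrightarrow> norm a" by (intro tendsto_intros cesaro_Suc_tendsto)
  moreover have "(\<lambda>N. K + norm (a - j (?F N))) \<longlonglongrightarrow> K + norm (a - a)"
    by (intro tendsto_intros cesaro_Suc_tendsto)
  ultimately have "norm a \<le> K + norm (a - a)" by (intro LIMSEQ_le) auto
  then show ?thesis by simp
qed

lemma hat_eqI:
  assumes "a \<in> comm" "b \<in> comm" "\<And>x z. cmod z = 1 \<Longrightarrow> hat a x z = hat b x z"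
  shows "a = b"
  using norm_le_hat[OF comm_diff[OF assms(1,2)], of 0] assms by (simp add: hat_diff)

lemma hat_eq_0: "(\<And>k. coef a k x = 0) \<Longrightarrow> hat a x z = 0"
  by (simp add: hat_def cesaro_def fin_hat_def)

text \<open>Conjugation by \<open>u\<^sup>i\<close> translates the base point and leaves the circle variable
  alone.\<close>

lemma hat_conj:
  assumes "a \<in> comm"
  shows "U i * a * U (- i) \<in> comm" "hat (U i * a * U (- i)) x z = hat a (it (- i) x) z"
proof -
  have coef: "coef (U i * a * U (- i)) k x = coef a k (it (- i) x)" for k x
    by (simp add: coef_mult_U coef_U_mult)
  show "U i * a * U (- i) \<in> comm"
    unfolding commutant_CX coef
  proof (intro allI impI)
    fix k x assume "coef a k (it (- i) x) \<noteq> 0"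
    then have "it k (it (- i) x) = it (- i) x" using assms by (simp add: commutant_CX)
    then have "it i (it k (it (- i) x)) = x" by simp
    then show "it k x = x" by (simp flip: it_add)
  qed
  have ces: "cesaro N (U i * a * U (- i)) k x = cesaro N a k (it (- i) x)" for N k x
    by (simp add: cesaro_def coef)
  have "fin_hat (cesaro (Suc N) (U i * a * U (- i))) x z = fin_hat (cesaro (Suc N) a) (it (- i) x) z" for N
    unfolding fin_hat_eq[OF finite_atLeastAtMost_int cesaro_supp[OF zero_less_Suc]] ces ..
  then show "hat (U i * a * U (- i)) x z = hat a (it (- i) x) z" by (simp add: hat_def)
qed

lemma continuous_hat:
  assumes "a \<in> comm" "cmod z = 1"
  shows "continuous_on UNIV (\<lambda>x. hat a x z)"
proof -
  let ?F = "\<lambda>N. cesaro (Suc N) a"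
  have lim: "(\<lambda>N. norm (a - j (?F N))) \<longlonglongrightarrow> norm (a - a)"
    by (intro tendsto_intros cesaro_Suc_tendsto)
  have "uniform_limit UNIV (\<lambda>N x. fin_hat (?F N) x z) (\<lambda>x. hat a x z) sequentially"
  proof (rule uniform_limitI)
    fix e :: real assume "e > 0"
    with lim have "\<forall>\<^sub>F N in sequentially. norm (a - j (?F N)) < e"
      by (intro order_tendstoD(2)) auto
    then show "\<forall>\<^sub>F N in sequentially. \<forall>x\<in>UNIV. dist (fin_hat (?F N) x z) (hat a x z) < e"
    proof eventually_elim
      case (elim N)
      then show ?case using hat_approx[OF assms(1) cesaro_fin_comm[OF assms(1)] assms(2), of _ N]
        by (auto simp: dist_norm norm_minus_commute intro: le_less_trans)
    qed
  qed
  moreover have "continuous_on UNIV (\<lambda>x. fin_hat (?F N) x z)" for N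
    using cesaro_fin_comm[OF assms(1), of N] unfolding fin_hat_def
    by (auto simp: fin_comm_def fin_supp_def intro!: continuous_intros)
  ultimately show ?thesis by (intro uniform_limit_theorem[of _ "\<lambda>N x. fin_hat (?F N) x z"]) auto
qed

lemma hat_limit:
  assumes "\<And>N. a N \<in> comm" "a \<longlonglongrightarrow> b" "cmod z = 1"
  shows "(\<lambda>N. hat (a N) x z) \<longlonglongrightarrow> hat b x z"
proof -
  have b: "b \<in> comm" using closed_sequentially[OF closed_comm] assms by blast
  have "(\<lambda>N. norm (a N - b)) \<longlonglongrightarrow> norm (b - b)" by (intro tendsto_intros assms)
  then have lim: "(\<lambda>N. norm (a N - b)) \<longlonglongrightarrow> 0" by simp
  have "cmod (hat (a N) x z - hat b x z) \<le> norm (a N - b)" for N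
    using hat_bound[OF comm_diff[OF assms(1) b] assms(3), of N x] by (simp add: hat_diff assms b)
  then have "(\<lambda>N. hat (a N) x z - hat b x z) \<longlonglongrightarrow> 0"
    by (intro Lim_null_comparison[OF always_eventually lim] allI)
  then show ?thesis by (simp add: LIM_zero_cancel)
qed

lemma polynomial_calculus:
  assumes r: "r \<in> comm" and p: "real_polynomial_function p"
    and real: "\<And>x z. cmod z = 1 \<Longrightarrow> hat r x z \<in> \<real>"
  shows "\<exists>e\<in>comm. \<forall>x z. cmod z = 1 \<longrightarrow> hat e x z = of_real (p (Re (hat r x z)))"
  using p
proof (induction p rule: real_polynomial_function.induct)
  case (linear f)
  have "f t = t * f 1" for t using linear_cmul[OF bounded_linear.linear[OF linear], of t 1] by simp
  then have "hat (of_real (f 1) *\<^sub>C r) x z = of_real (f (Re (hat r x z)))" if "cmod z = 1" for x z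
    using real[OF that, of x] that r
    by (metis (no_types, lifting) hat_scale mult.commute of_real_Re of_real_mult)
  then show ?case using comm_scale[OF r] by blast
next
  case (const c)
  show ?case using hat_C[of "\<lambda>_. of_real c"] by (intro bexI[of _ "C (\<lambda>_. of_real c)"]) auto
next
  case (add f g)
  then obtain e e' where "e \<in> comm" "\<forall>x z. cmod z = 1 \<longrightarrow> hat e x z = of_real (f (Re (hat r x z)))"
    "e' \<in> comm" "\<forall>x z. cmod z = 1 \<longrightarrow> hat e' x z = of_real (g (Re (hat r x z)))" by blast
  then show ?case by (intro bexI[of _ "e + e'"]) (auto simp: hat_add comm_add)
next
  case (mult f g)
  then obtain e e' where "e \<in> comm" "\<forall>x z. cmod z = 1 \<longrightarrow> hat e x z = of_real (f (Re (hat r x z)))"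
    "e' \<in> comm" "\<forall>x z. cmod z = 1 \<longrightarrow> hat e' x z = of_real (g (Re (hat r x z)))" by blast
  then show ?case by (intro bexI[of _ "e * e'"]) (auto simp: hat_mult comm_mult)
qed

text \<open>Approximate \<open>h\<close> uniformly by polynomials on the range of the transform; since the
  transform is isometric, the polynomials in \<open>r\<close> form a Cauchy sequence.\<close>

lemma continuous_calculus:
  fixes h :: "real \<Rightarrow> real"
  assumes r: "r \<in> comm" and h: "continuous_on UNIV h"
    and real: "\<And>x z. cmod z = 1 \<Longrightarrow> hat r x z \<in> \<real>"
  obtains e where "e \<in> comm" "\<And>x z. cmod z = 1 \<Longrightarrow> hat e x z = of_real (h (Re (hat r x z)))"
proof -
  let ?t = "\<lambda>x z. Re (hat r x z)"
  have range: "?t x z \<in> {- norm r..norm r}" if "cmod z = 1" for x z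
    using hat_bound[OF r that, of x] abs_Re_le_cmod[of "hat r x z"] by auto
  have "\<exists>e. e \<in> comm \<and> (\<forall>x z. cmod z = 1 \<longrightarrow> cmod (hat e x z - of_real (h (?t x z))) \<le> inverse (Suc m))" for m
  proof -
    obtain p where p: "real_polynomial_function p" "\<And>t. t \<in> {- norm r..norm r} \<Longrightarrow> \<bar>h t - p t\<bar> < inverse (Suc m)"
      using Stone_Weierstrass_real_polynomial_function[of "{- norm r..norm r}" h "inverse (Suc m)"]
        continuous_on_subset[OF h] by auto
    obtain e where e: "e \<in> comm" "\<And>x z. cmod z = 1 \<Longrightarrow> hat e x z = of_real (p (?t x z))"
      using polynomial_calculus[OF r p(1) real] by blast
    have "cmod (hat e x z - of_real (h (?t x z))) \<le> inverse (Suc m)" if z: "cmod z = 1" for x z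
      using p(2)[OF range[OF z], of x] unfolding e(2)[OF z] of_real_diff[symmetric] norm_of_real
      by (simp only: abs_minus_commute less_imp_le)
    with e show ?thesis by blast
  qed
  then have "\<forall>m. \<exists>e. e \<in> comm \<and> (\<forall>x z. cmod z = 1 \<longrightarrow> cmod (hat e x z - of_real (h (?t x z))) \<le> inverse (Suc m))" by blast
  from choice[OF this] obtain e where e: "\<And>m. e m \<in> comm"
    "\<And>m x z. cmod z = 1 \<Longrightarrow> cmod (hat (e m) x z - of_real (h (?t x z))) \<le> inverse (real (Suc m))" by blast
  have close: "norm (e m - e n) \<le> inverse (real (Suc m)) + inverse (real (Suc n))" for m n
  proof (rule norm_le_hat[OF comm_diff[OF e(1) e(1)]])
    fix x z assume z: "cmod z = 1"
    show "cmod (hat (e m - e n) x z) \<le> inverse (real (Suc m)) + inverse (real (Suc n))"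
      using norm_triangle_ineq4[of "hat (e m) x z - of_real (h (?t x z))" "hat (e n) x z - of_real (h (?t x z))"]
        e(2)[OF z, of m x] e(2)[OF z, of n x] z by (simp add: hat_diff e(1))
  qed
  have "Cauchy e"
    unfolding Cauchy_def dist_norm
  proof (intro allI impI)
    fix \<epsilon> :: real assume \<epsilon>: "\<epsilon> > 0"
    obtain M where M: "inverse (real (Suc M)) < \<epsilon> / 2" using reals_Archimedean[of "\<epsilon> / 2"] \<epsilon> by auto
    have "norm (e m - e n) < \<epsilon>" if "m \<ge> M" "n \<ge> M" for m n
    proof -
      have "inverse (real (Suc m)) \<le> inverse (real (Suc M))" "inverse (real (Suc n)) \<le> inverse (real (Suc M))"
        using that by (auto intro!: le_imp_inverse_le)
      then show ?thesis using close[of m n] M by linarith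
    qed
    then show "\<exists>M. \<forall>m\<ge>M. \<forall>n\<ge>M. norm (e m - e n) < \<epsilon>" by blast
  qed
  then obtain l where l: "e \<longlonglongrightarrow> l" using Cauchy_convergent convergent_def by blast
  have "hat l x z = of_real (h (?t x z))" if z: "cmod z = 1" for x z
  proof (rule LIMSEQ_unique)
    show "(\<lambda>m. hat (e m) x z) \<longlonglongrightarrow> hat l x z" by (rule hat_limit[OF e(1) l z])
    have "(\<lambda>m. hat (e m) x z - of_real (h (?t x z))) \<longlonglongrightarrow> 0"
      by (rule Lim_null_comparison[OF always_eventually LIMSEQ_inverse_real_of_nat]) (use e(2)[OF z] in auto)
    then show "(\<lambda>m. hat (e m) x z) \<longlonglongrightarrow> of_real (h (?t x z))" by (simp add: LIM_zero_cancel)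
  qed
  moreover have "l \<in> comm" using closed_sequentially[OF closed_comm e(1) l] .
  ultimately show ?thesis using that by blast
qed

end

section \<open>Ideals and the commutant\<close>

lemma neumann_left_inverse:
  fixes w :: "'b::{real_normed_algebra_1, banach}"
  assumes "norm w < 1"
  obtains y where "y * (1 + w) = 1"
proof
  have s: "summable (\<lambda>i. (- w) ^ i)"
    using assms by (intro complete_algebra_summable_geometric) simp
  have "(\<Sum>i. (- w) ^ i) * (1 + w) = (\<Sum>i. (- w) ^ i) - (\<Sum>i. (- w) ^ i) * (- w)"
    by (simp add: algebra_simps)
  also have "(\<Sum>i. (- w) ^ i) * (- w) = (\<Sum>i. (- w) ^ Suc i)"
    using suminf_mult2[OF s, of "- w"] by (simp only: power_Suc2)
  also have "\<dots> = (\<Sum>i. (- w) ^ i) - 1" using suminf_split_head[OF s] by simp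
  finally show "(\<Sum>i. (- w) ^ i) * (1 + w) = 1" by simp
qed

lemma ideal_zero: "two_sided_ideal J \<Longrightarrow> 0 \<in> J"
  and ideal_left: "two_sided_ideal J \<Longrightarrow> x \<in> J \<Longrightarrow> a * x \<in> J"
  and ideal_right: "two_sided_ideal J \<Longrightarrow> x \<in> J \<Longrightarrow> x * a \<in> J"
  by (auto simp: two_sided_ideal_def csubspace_def)

context crossed_product
begin

text \<open>Put \<open>r = d d\<^sup>*\<close>, which is approximated by \<open>c d\<^sup>*\<close> in
  \<open>J\<close> with error less than some \<open>\<eta>\<close> below the norm of \<open>r\<close>. With
  \<open>q = max (r - \<eta>) 0\<close> and \<open>p = 1 / max r \<eta>\<close>, whose norm is at most \<open>1
  / \<eta>\<close>, one has \<open>r p q = q\<close>. Hence \<open>1 + (c d\<^sup>* - r) p\<close> is invertible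
  and maps \<open>q\<close> to \<open>c d\<^sup>* p q\<close>, an element of \<open>J\<close>, so
  \<open>q\<close> itself is in \<open>J\<close>.\<close>

lemma ideal_meets_commutant:
  assumes J: "two_sided_ideal J" and c: "c \<in> J" and d: "d \<in> comm" and cd: "norm (c - d) < norm d"
  obtains q where "q \<in> J" "q \<in> comm" "q \<noteq> 0"
proof -
  define r where "r = d * adj d"
  have r: "r \<in> comm" using d by (simp add: r_def comm_mult comm_adj)
  have hat_r: "hat r x z = of_real ((cmod (hat d x z))\<^sup>2)" if "cmod z = 1" for x z
    unfolding r_def complex_norm_square using d that by (simp add: hat_mult hat_adj comm_adj)
  have norm_r: "norm r = norm d * norm d"
    using cstar_identity[of "adj d"] by (simp add: r_def adj_adj power2_eq_square)
  have "norm (c * adj d - r) \<le> norm (c - d) * norm d"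
    using norm_mult_ineq[of "c - d" "adj d"] by (simp add: r_def algebra_simps)
  also have "\<dots> < norm r"
    unfolding norm_r using cd norm_ge_zero[of "c - d"] by (intro mult_strict_right_mono) linarith+
  finally obtain \<eta> where \<eta>: "norm (c * adj d - r) < \<eta>" "\<eta> < norm r" using dense by blast
  then have pos: "\<eta> > 0" using norm_ge_zero[of "c * adj d - r"] by linarith
  have real: "hat r x z \<in> \<real>" if "cmod z = 1" for x z using hat_r[OF that] by simp
  have ne: "max t \<eta> \<noteq> 0" for t using pos by (simp add: max_def)
  have "continuous_on UNIV (\<lambda>t. 1 / max t \<eta>)" using ne by (intro continuous_intros) auto
  then obtain p where p: "p \<in> comm"
    "\<And>x z. cmod z = 1 \<Longrightarrow> hat p x z = of_real (1 / max (Re (hat r x z)) \<eta>)"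
    using continuous_calculus[OF r _ real] by metis
  have "continuous_on UNIV (\<lambda>t. max (t - \<eta>) 0)" by (intro continuous_intros)
  then obtain q where q: "q \<in> comm"
    "\<And>x z. cmod z = 1 \<Longrightarrow> hat q x z = of_real (max (Re (hat r x z) - \<eta>) 0)"
    using continuous_calculus[OF r _ real] by metis
  have rpq: "r * p * q = q"
  proof (rule hat_eqI)
    fix x z assume z: "cmod z = 1"
    let ?t = "(cmod (hat d x z))\<^sup>2"
    have "hat (r * p * q) x z = of_real (?t * (1 / max ?t \<eta>) * max (?t - \<eta>) 0)"
      using r p q z hat_r[OF z, of x] by (simp add: hat_mult comm_mult)
    also have "?t * (1 / max ?t \<eta>) * max (?t - \<eta>) 0 = max (?t - \<eta>) 0"
      using pos by (auto simp: max_def)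
    finally show "hat (r * p * q) x z = hat q x z" using q(2)[OF z, of x] hat_r[OF z, of x] by simp
  qed (use r p q in \<open>simp_all add: comm_mult\<close>)
  have "norm p \<le> 1 / \<eta>"
  proof (rule norm_le_hat[OF p(1)])
    fix x z assume z: "cmod z = 1"
    have "\<bar>1 / max (Re (hat r x z)) \<eta>\<bar> \<le> 1 / \<eta>" using pos by (simp add: divide_simps max_def)
    then show "cmod (hat p x z) \<le> 1 / \<eta>" by (simp only: p(2)[OF z] norm_of_real)
  qed
  then have "norm ((c * adj d - r) * p) \<le> norm (c * adj d - r) * (1 / \<eta>)"
    by (intro order_trans[OF norm_mult_ineq] mult_left_mono) auto
  also have "\<dots> < 1" using \<eta>(1) pos by (simp add: divide_simps)
  finally obtain y where y: "y * (1 + (c * adj d - r) * p) = 1" by (rule neumann_left_inverse)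
  have "(1 + (c * adj d - r) * p) * q = c * (adj d * p * q)"
    using rpq by (simp add: algebra_simps)
  then have "q = y * (c * (adj d * p * q))" using y by (metis mult.assoc mult.left_neutral)
  moreover have "y * (c * (adj d * p * q)) \<in> J" by (intro ideal_left[OF J] ideal_right[OF J] c)
  ultimately have "q \<in> J" by simp
  moreover have "q \<noteq> 0"
  proof
    assume "q = 0"
    have "cmod (hat r x z) \<le> \<eta>" if z: "cmod z = 1" for x z
    proof -
      have "max (Re (hat r x z) - \<eta>) 0 = 0" using q(2)[OF z, of x] hat_zero[OF z] \<open>q = 0\<close> by simp
      then show ?thesis using hat_r[OF z, of x] by (simp add: norm_power)
    qed
    then have "norm r \<le> \<eta>" by (rule norm_le_hat[OF r])
    then show False using \<eta>(2) by simp
  qed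
  ultimately show ?thesis using that q(1) by blast
qed

text \<open>If \<open>\<sigma>\<^sup>k\<close> is not the identity on \<open>W\<close>, shrink \<open>W\<close>
  around a point that it moves. Both alternatives are inherited by smaller sets, so finitely many
  \<open>k\<close> can be treated in turn.\<close>

lemma locally_fixed_or_displaced:
  assumes "finite S" "open V" "V \<noteq> {}"
  shows "\<exists>W. open W \<and> W \<noteq> {} \<and> W \<subseteq> V \<and> (\<forall>k\<in>S. (\<forall>x\<in>W. it k x = x) \<or> (\<forall>x\<in>W. it k x \<notin> W))"
  using assms(1)
proof (induction S rule: finite_induct)
  case empty
  then show ?case using assms by auto
next
  case (insert k S)
  then obtain W where W: "open W" "W \<noteq> {}" "W \<subseteq> V"
    "\<And>k. k \<in> S \<Longrightarrow> (\<forall>x\<in>W. it k x = x) \<or> (\<forall>x\<in>W. it k x \<notin> W)" by blast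
  show ?case
  proof (cases "\<forall>x\<in>W. it k x = x")
    case True
    then show ?thesis using W by blast
  next
    case False
    then obtain x where x: "x \<in> W" "it k x \<noteq> x" by blast
    then obtain A B where AB: "open A" "open B" "x \<in> A" "it k x \<in> B" "A \<inter> B = {}"
      using hausdorff[of x "it k x"] by auto
    let ?W = "W \<inter> A \<inter> it k -` B"
    have "open ?W" using W AB continuous_it[of k]
      by (intro open_Int open_vimage) auto
    moreover have "x \<in> ?W" using x AB by auto
    moreover have "\<forall>l\<in>insert k S. (\<forall>x\<in>?W. it l x = x) \<or> (\<forall>x\<in>?W. it l x \<notin> ?W)"
      using W(4) AB(5) by blast
    ultimately show ?thesis using W(3) by (intro exI[of _ ?W]) blast
  qed
qed

text \<open>The cut-off \<open>f b f\<close> has coefficients \<open>f(x) b\<^sub>k(x)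
  f(\<sigma>\<^sup>-\<^sup>k x)\<close>. Where \<open>\<sigma>\<^sup>k\<close> displaces the support of
  \<open>f\<close> these vanish, and elsewhere \<open>x\<close> is fixed by \<open>\<sigma>\<^sup>k\<close>;
  hence \<open>f b f\<close> commutes with \<open>C(X)\<close>.\<close>

lemma intersection_property_commutant: "intersection_property comm"
  unfolding intersection_property_def
proof (intro allI impI, elim conjE)
  fix J :: "'b set" assume J: "two_sided_ideal J" and "J \<noteq> {0}"
  then obtain a' where a': "a' \<in> J" "a' \<noteq> 0" using ideal_zero[OF J] by blast
  then obtain k y where "coef a' k y \<noteq> 0" using coef_eqI[of a' 0] by auto
  define a where "a = a' * U (- k)"
  define \<delta> where "\<delta> = cmod (coef a 0 y)"
  have a: "a \<in> J" using ideal_right[OF J a'(1)] by (simp add: a_def)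
  have \<delta>: "\<delta> > 0" using \<open>coef a' k y \<noteq> 0\<close> by (simp add: \<delta>_def a_def coef_mult_U)
  \<comment> \<open>Where the zeroth coefficient of \<open>a\<close> exceeds \<open>\<delta> / 2\<close>, that of \<open>b\<close> exceeds the error \<open>\<delta> / 4\<close>.\<close>
  obtain b where b: "b \<in> fin_supp" "norm (a - j b) < \<delta> / 4" using approx[of "\<delta> / 4"] \<delta> by auto
  let ?S = "{k. b k \<noteq> (\<lambda>_. 0)}" and ?U = "{x. \<delta> / 2 < cmod (coef a 0 x)}"
  have "finite ?S" using b by (simp add: fin_supp_def)
  moreover have "open ?U" by (intro open_Collect_less continuous_intros continuous_coef)
  moreover have "?U \<noteq> {}" using \<delta> by (auto simp: \<delta>_def intro!: exI[of _ y])
  ultimately obtain W where W: "open W" "W \<noteq> {}" "W \<subseteq> ?U"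
    "\<And>k. k \<in> ?S \<Longrightarrow> (\<forall>x\<in>W. it k x = x) \<or> (\<forall>x\<in>W. it k x \<notin> W)"
    using locally_fixed_or_displaced[of ?S ?U] by blast
  then obtain w where w: "w \<in> W" by blast
  obtain f :: "'a \<Rightarrow> real" where f: "continuous_on UNIV f" "\<And>x. 0 \<le> f x" "\<And>x. f x \<le> 1"
    "\<And>x. x \<notin> W \<Longrightarrow> f x = 0" "f w = 1" using bump[OF W(1) w] by blast
  define g where "g x = complex_of_real (f x)" for x
  have g: "continuous_on UNIV g" unfolding g_def using f(1) by (intro continuous_intros)
  have norm_g: "norm (C g) \<le> 1" by (rule norm_C_le[OF g]) (simp add: g_def f)
  define d where "d = C g * j b * C g"
  have coef_d: "coef d k x = g x * b k x * g (it (- k) x)" for k x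
    using b g by (simp add: d_def coef_mult_C coef_C_mult)
  have "d \<in> comm"
    unfolding commutant_CX coef_d
  proof (intro allI impI)
    fix k x assume "g x * b k x * g (it (- k) x) \<noteq> 0"
    then have "k \<in> ?S" "x \<in> W" "it (- k) x \<in> W" using f(4) by (auto simp: g_def)
    then show "it k x = x" using W(4)[of k] by (metis it_cancel(1))
  qed
  moreover have "C g * a * C g \<in> J" by (intro ideal_left[OF J] ideal_right[OF J] a)
  moreover have "norm (C g * a * C g - d) < norm d"
  proof -
    have "C g * a * C g - d = C g * (a - j b) * C g" by (simp add: d_def algebra_simps)
    also have "norm \<dots> \<le> norm (C g) * norm (a - j b) * norm (C g)"
      by (meson mult_right_mono norm_ge_zero norm_mult_ineq order_trans)
    also have "\<dots> \<le> 1 * norm (a - j b) * 1"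
      using norm_g by (intro mult_mono) auto
    also have "\<dots> < \<delta> / 4" using b by simp
    also have "\<delta> / 4 < norm d"
    proof -
      have it0: "it (- 0) w = w" by simp
      have "cmod (b 0 w) = cmod (coef d 0 w)" unfolding coef_d it0 using f(5) by (simp add: g_def)
      then have "cmod (b 0 w) \<le> norm d" using coef_bound[of d 0 w] by simp
      moreover have "cmod (coef a 0 w - b 0 w) < \<delta> / 4"
        using coef_approx[OF b(1), of a 0 w] b(2) by linarith
      moreover have "\<delta> / 2 < cmod (coef a 0 w)" using w W(3) by auto
      ultimately show ?thesis using norm_triangle_ineq2[of "coef a 0 w" "b 0 w"] by linarith
    qed
    finally show ?thesis .
  qed
  ultimately obtain q where "q \<in> J" "q \<in> comm" "q \<noteq> 0" using ideal_meets_commutant[OF J] by blast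
  then show "J \<inter> comm \<noteq> {0}" by blast
qed

section \<open>Subalgebras of the commutant defined by gluing fibres\<close>

text \<open>A triple \<open>(x, z, w)\<close> in \<open>R\<close> identifies the points \<open>z\<close> and
  \<open>w\<close> of the circle over \<open>x\<close>. Transforms of functions in \<open>C(X)\<close> do not
  depend on the circle variable, so \<open>C(X)\<close> satisfies every such condition.\<close>

definition glue :: "('a \<times> complex \<times> complex) set \<Rightarrow> 'b set" where
  "glue R = {a \<in> comm. \<forall>x z w. (x, z, w) \<in> R \<longrightarrow> cmod z = 1 \<longrightarrow> cmod w = 1 \<longrightarrow> hat a x z = hat a x w}"

lemma cstar_subalgebra_glue: "cstar_subalgebra (glue R)"
proof -
  have "closed (glue R)"
    unfolding closed_sequential_limits
  proof (intro allI impI, elim conjE)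
    fix s l assume s: "\<forall>n. s n \<in> glue R" and l: "s \<longlonglongrightarrow> l"
    have sD: "s n \<in> comm" for n using s by (auto simp: glue_def)
    have "hat l x z = hat l x w" if R: "(x, z, w) \<in> R" and z: "cmod z = 1" "cmod w = 1" for x z w
    proof (rule LIMSEQ_unique)
      show "(\<lambda>n. hat (s n) x z) \<longlonglongrightarrow> hat l x z" by (rule hat_limit[OF sD l z(1)])
      have "hat (s n) x z = hat (s n) x w" for n using s R z by (auto simp: glue_def)
      then show "(\<lambda>n. hat (s n) x z) \<longlonglongrightarrow> hat l x w" using hat_limit[OF sD l z(2)] by simp
    qed
    moreover have "l \<in> comm" using closed_sequentially[OF closed_comm sD l] .
    ultimately show "l \<in> glue R" by (auto simp: glue_def)
  qed
  moreover have "0 \<in> glue R" by (auto simp: glue_def comm_zero hat_zero)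
  moreover have "x + y \<in> glue R" "x * y \<in> glue R" "c *\<^sub>C x \<in> glue R" "adj x \<in> glue R"
    if "x \<in> glue R" "y \<in> glue R" for x y c
    using that by (simp_all add: glue_def comm_add comm_mult comm_scale comm_adj hat_add hat_mult hat_scale hat_adj)
  ultimately show ?thesis by (auto simp: cstar_subalgebra_def csubspace_def)
qed

lemma CX_subset_glue: "CX j \<subseteq> glue R"
proof
  fix a assume "a \<in> CX j"
  then obtain f where f: "continuous_on UNIV f" "a = C f" using CX_eq by auto
  then show "a \<in> glue R" using hat_C[OF f(1)] by (simp add: glue_def)
qed

lemma CX_subset_comm: "CX j \<subseteq> comm"
  using CX_subset_glue[of "{}"] by (auto simp: glue_def)

lemma commutative_commutant: "commutative_unital_cstar_subalgebra comm"
proof -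
  have "comm = glue {}" by (auto simp: glue_def)
  moreover have "1 \<in> comm" by (simp add: commutant_def)
  ultimately show ?thesis
    using cstar_subalgebra_glue[of "{}"] by (auto simp: commutative_unital_cstar_subalgebra_def comm_commute)
qed

section \<open>Topological freeness\<close>

lemma commutant_topologically_free:
  assumes "topologically_free \<sigma>"
  shows "comm = CX j"
proof
  show "comm \<subseteq> CX j"
  proof
    fix a assume a: "a \<in> comm"
    have "coef a k x = 0" if "k \<noteq> 0" for k x
    proof -
      have "coef a k y = 0" if y: "\<forall>n>0. (\<sigma> ^^ n) y \<noteq> y" for y
      proof (rule ccontr)
        assume "coef a k y \<noteq> 0"
        then have "it k y = y" using a by (simp add: commutant_CX)
        moreover then have "it (- k) y = y" by (metis it_cancel(2))
        ultimately have "it \<bar>k\<bar> y = y" by (simp add: abs_if)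
        then show False using y \<open>k \<noteq> 0\<close> by (simp add: int_iterate_def)
      qed
      then have "closure {x. \<forall>n>0. (\<sigma> ^^ n) x \<noteq> x} \<subseteq> {x. coef a k x = 0}"
        by (intro closure_minimal closed_Collect_eq continuous_intros continuous_coef) auto
      then show ?thesis using assms by (auto simp: topologically_free_def)
    qed
    then have "a = C (coef a 0)" by (intro coef_eqI) (auto simp: coef_C continuous_coef)
    then show "a \<in> CX j" using C_in_CX[OF continuous_coef[of a 0]] by simp
  qed
qed (rule CX_subset_comm)

text \<open>The periodic points are the countable union of the closed sets fixed by
  \<open>\<sigma>\<^sup>n\<close>; if none of these had interior points, their union would not either, by
  Baire's theorem for compact Hausdorff spaces.\<close>

lemma periodic_interior:
  assumes "\<not> topologically_free \<sigma>"
  shows "\<exists>n>0. interior {x. it n x = x} \<noteq> {}"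
proof (rule ccontr)
  assume "\<not> ?thesis"
  then have empty: "interior {x. it n x = x} = {}" if "n > 0" for n using that by blast
  let ?G = "(\<lambda>n. {x. it (int n) x = x}) ` {0<..}"
  have "compact_space (euclidean :: 'a topology)" using compact_X by (simp add: compact_space_def)
  moreover have H: "Hausdorff_space (euclidean :: 'a topology)"
    using hausdorff by (auto simp: Hausdorff_space_def disjnt_def)
  ultimately have "locally_compact_space (euclidean :: 'a topology)" "regular_space (euclidean :: 'a topology)"
    by (auto intro: compact_imp_locally_compact_space compact_Hausdorff_imp_regular_space)
  then have "euclidean interior_of \<Union>?G = {}"
  proof (intro Baire_category_alt)
    fix T assume "T \<in> ?G"
    then obtain n where n: "n > 0" "T = {x. it (int n) x = x}" by auto
    then have "closed T" using continuous_it by (auto intro!: closed_Collect_eq continuous_on_id)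
    then show "closedin euclidean T \<and> euclidean interior_of T = {}"
      using n empty[of "int n"] by simp
  qed auto
  moreover have "\<Union>?G = - {x. \<forall>n>0. (\<sigma> ^^ n) x \<noteq> x}"
    by (auto simp: int_iterate_def)
  ultimately have "closure {x. \<forall>n>0. (\<sigma> ^^ n) x \<noteq> x} = UNIV"
    by (simp add: closure_interior)
  then show False using assms by (simp add: topologically_free_def)
qed

end

section \<open>Systems that are not topologically free\<close>

locale periodic_crossed_product = crossed_product +
  fixes n :: int and V :: "'a set"
  assumes n: "n > 0"
  defines "V \<equiv> interior {x. it n x = x}"
  assumes V_nonempty: "V \<noteq> {}"
begin

lemma open_V: "open V"
  by (simp add: V_def)

lemma V_periodic: "x \<in> V \<Longrightarrow> it n x = x"
  using interior_subset by (auto simp: V_def)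

lemma V_periodic_mult: "x \<in> V \<Longrightarrow> it (n * int m) x = x"
proof (induction m)
  case (Suc m)
  then show ?case using it_add[of "n * int m" n x] by (simp add: V_periodic distrib_left add.commute)
qed simp

text \<open>The map \<open>\<sigma>\<^sup>i\<close> is a homeomorphism commuting with
  \<open>\<sigma>\<^sup>n\<close>, so the preimage of \<open>V\<close> is an open set of fixed points of
  \<open>\<sigma>\<^sup>n\<close>.\<close>

lemma V_invariant: "it i x \<in> V \<Longrightarrow> x \<in> V"
proof -
  have "{x. it i x \<in> V} \<subseteq> V"
    unfolding V_def
  proof (rule interior_maximal)
    have "open (it i -` V)" using continuous_it open_V by (intro open_vimage)
    then show "open {x. it i x \<in> interior {x. it n x = x}}" by (simp add: vimage_def V_def)
    show "{x. it i x \<in> interior {x. it n x = x}} \<subseteq> {x. it n x = x}"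
    proof (intro subsetI CollectI)
      fix x assume "x \<in> {x. it i x \<in> interior {x. it n x = x}}"
      then have "it n (it i x) = it i x" by (intro V_periodic) (simp add: V_def)
      then have "it i (it n x) = it i x" by (simp add: add.commute flip: it_add)
      then have "it (- i) (it i (it n x)) = it (- i) (it i x)" by simp
      then show "it n x = x" by simp
    qed
  qed
  then show "it i x \<in> V \<Longrightarrow> x \<in> V" by blast
qed

definition x0 :: 'a where "x0 = (SOME x. x \<in> V)"

lemma x0: "x0 \<in> V"
  using V_nonempty by (auto simp: x0_def some_in_eq)

lemma complex_bump:
  assumes "open W" "x \<in> W"
  obtains g :: "'a \<Rightarrow> complex" where "continuous_on UNIV g"
    "\<And>x. g x \<in> \<real>" "\<And>x. x \<notin> W \<Longrightarrow> g x = 0" "g x = 1"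
proof -
  obtain f :: "'a \<Rightarrow> real" where "continuous_on UNIV f" "\<And>x. x \<notin> W \<Longrightarrow> f x = 0" "f x = 1"
    using bump[OF assms] by metis
  then show ?thesis using that[of "\<lambda>x. of_real (f x)"] continuous_on_of_real by auto
qed

lemma V_mon:
  assumes "continuous_on UNIV f" "\<And>x. x \<notin> V \<Longrightarrow> f x = 0"
  shows "C f * U (n * int m) \<in> comm"
    and "cmod z = 1 \<Longrightarrow> hat (C f * U (n * int m)) x z = f x * z powi (n * int m)"
proof -
  have per: "it (n * int m) x = x" if "f x \<noteq> 0" for x using assms(2) that V_periodic_mult by blast
  show "C f * U (n * int m) \<in> comm" by (rule hat_mon(1)[OF assms(1) per])
  show "hat (C f * U (n * int m)) x z = f x * z powi (n * int m)" if "cmod z = 1"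
    by (rule hat_mon(2)[OF assms(1) per that])
qed

lemma not_in_CX:
  assumes "coef a k x \<noteq> 0" "k \<noteq> 0"
  shows "a \<notin> CX j"
  using assms by (auto simp: CX_eq coef_C)

lemma cis_powi_n: "cis (t / of_int n) powi (n * int m) = cis (real m * t)"
  using n by (simp add: cis_power_int mult.commute)

subsection \<open>A proper subalgebra with the intersection property\<close>

text \<open>The function \<open>f z\<^sup>n\<close> takes the values \<open>1\<close> and \<open>-1\<close> at
  \<open>1\<close> and \<open>\<zeta>\<close> over a point with \<open>f = 1\<close>, whereas \<open>f
  z\<^sup>2\<^sup>n\<close> does not separate these two points.\<close>

definition \<zeta> :: complex where "\<zeta> = cis (pi / of_int n)"

lemma \<zeta>: "cmod \<zeta> = 1" "\<zeta> powi n = -1" "\<zeta> powi (n * 2) = 1"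
  using cis_powi_n[of pi 1] cis_powi_n[of pi 2] by (simp_all add: \<zeta>_def)

definition B1 :: "'b set" where "B1 = glue {(x0, 1, \<zeta>)}"

lemma B1_iff: "a \<in> B1 \<longleftrightarrow> a \<in> comm \<and> hat a x0 1 = hat a x0 \<zeta>"
  using \<zeta>(1) by (auto simp: B1_def glue_def)

lemma B1_proper: "CX j \<subset> B1" "B1 \<subset> comm"
proof -
  obtain g :: "'a \<Rightarrow> complex" where g: "continuous_on UNIV g" "\<And>x. x \<notin> V \<Longrightarrow> g x = 0" "g x0 = 1"
    using complex_bump[OF open_V x0] by metis
  have hat_m: "hat (C g * U (n * int m)) x z = g x * z powi (n * int m)" if "cmod z = 1" for x z m
    by (rule V_mon(2)[OF g(1,2) that])
  have "hat (C g * U (n * int 2)) x0 1 = hat (C g * U (n * int 2)) x0 \<zeta>"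
    using \<zeta> hat_m[of 1 2 x0] hat_m[of \<zeta> 2 x0] by simp
  then have "C g * U (n * int 2) \<in> B1"
    using V_mon(1)[OF g(1,2), of 2] unfolding B1_iff by blast
  moreover have "C g * U (n * int 2) \<notin> CX j"
    by (rule not_in_CX[of _ "n * int 2" x0]) (use n g in \<open>auto simp: coef_C_U\<close>)
  ultimately show "CX j \<subset> B1" using CX_subset_glue[of "{(x0, 1, \<zeta>)}"] by (auto simp: B1_def)
  have "hat (C g * U (n * int 1)) x0 1 \<noteq> hat (C g * U (n * int 1)) x0 \<zeta>"
    using \<zeta> g(3) hat_m[of 1 1 x0] hat_m[of \<zeta> 1 x0] by simp
  then have "C g * U (n * int 1) \<notin> B1" unfolding B1_iff by blast
  then show "B1 \<subset> comm" using V_mon(1)[OF g(1,2), of 1] by (auto simp: B1_iff)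
qed

text \<open>Otherwise a non-zero value would recur infinitely often, although an approximation with finite
  support forces all but finitely many coefficients at \<open>x\<close> to be small.\<close>

lemma coef_not_periodic:
  assumes "coef a k x \<noteq> 0"
  shows "\<exists>l. coef a l x \<noteq> coef a (l - n * 2) x"
proof (rule ccontr)
  assume "\<not> ?thesis"
  then have eq: "coef a l x = coef a (l - n * 2) x" for l by blast
  have const: "coef a (k - n * 2 * int m) x = coef a k x" for m
  proof (induction m)
    case (Suc m)
    then show ?case using eq[of "k - n * 2 * int m"] by (simp add: algebra_simps)
  qed simp
  obtain b where b: "b \<in> fin_supp" "norm (a - j b) < cmod (coef a k x)"
    using approx[of "cmod (coef a k x)"] assms by auto
  have "b (k - n * 2 * int m) \<noteq> (\<lambda>_. 0)" for m
    using coef_approx[OF b(1), of a "k - n * 2 * int m" x] b(2) by (auto simp: const)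
  then have "range (\<lambda>m. k - n * 2 * int m) \<subseteq> {k. b k \<noteq> (\<lambda>_. 0)}" by auto
  then have "finite (range (\<lambda>m. k - n * 2 * int m))" using b(1) by (auto simp: fin_supp_def intro: finite_subset)
  moreover have "inj (\<lambda>m. k - n * 2 * int m)" using n by (auto simp: inj_on_def)
  ultimately show False using finite_imageD by blast
qed

text \<open>Take \<open>e \<noteq> 0\<close> in the commutant and in \<open>J\<close>. If \<open>hat e\<close>
  vanishes over \<open>x0\<close>, then \<open>e\<close> is in \<open>B1\<close>. Otherwise multiply it by
  \<open>f (1 - u\<^sup>2\<^sup>n)\<close>, whose transform is zero at both glued points; the product is
  non-zero because the coefficients of \<open>e\<close> at \<open>x0\<close> are not periodic.\<close>

lemma intersection_property_B1: "intersection_property B1"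
  unfolding intersection_property_def
proof (intro allI impI, elim conjE)
  fix J :: "'b set" assume J: "two_sided_ideal J" and "J \<noteq> {0}"
  then obtain e where e: "e \<in> J" "e \<in> comm" "e \<noteq> 0"
    using intersection_property_commutant ideal_zero[OF J] comm_zero
    unfolding intersection_property_def by blast
  show "J \<inter> B1 \<noteq> {0}"
  proof (cases "\<forall>k. coef e k x0 = 0")
    case True
    then have "e \<in> B1" using e by (simp add: B1_iff hat_eq_0)
    then show ?thesis using e by blast
  next
    case False
    obtain g :: "'a \<Rightarrow> complex" where g: "continuous_on UNIV g" "\<And>x. x \<notin> V \<Longrightarrow> g x = 0" "g x0 = 1"
      using complex_bump[OF open_V x0] by metis
    define q where "q = C g - C g * U (n * int 2)"
    have q: "q \<in> comm" unfolding q_def by (intro comm_diff V_mon(1) hat_C(1) g)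
    have hat_q: "hat q x0 z = 1 - z powi (n * int 2)" if "cmod z = 1" for z
      unfolding q_def
      using hat_diff[OF hat_C(1)[OF g(1)] V_mon(1)[OF g(1,2), of 2] that, of x0]
        V_mon(2)[OF g(1,2) that, where m = 2] hat_C(2)[OF g(1) that] g(3) by simp
    have "e * q \<in> B1"
      using e q \<zeta> by (simp add: B1_iff comm_mult hat_mult hat_q)
    moreover have "e * q \<in> J" by (rule ideal_right[OF J e(1)])
    moreover have "e * q \<noteq> 0"
    proof
      assume "e * q = 0"
      have c: "coef e l x0 * g (it (- l) x0) = coef e l x0" for l
      proof (cases "coef e l x0 = 0")
        case False
        then have "it l x0 = x0" using e(2) by (simp add: commutant_CX)
        then have "it (- l) x0 = x0" by (metis it_cancel(2))
        then show ?thesis using g(3) by simp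
      qed simp
      obtain l where l: "coef e l x0 \<noteq> coef e (l - n * 2) x0"
        using coef_not_periodic False by blast
      have "coef (e * q) l x0 = coef e l x0 * g (it (- l) x0) - coef e (l - n * 2) x0 * g (it (- (l - n * 2)) x0)"
        unfolding q_def right_diff_distrib using g(1) by (simp add: coef_diff coef_mult_C coef_mult_mon)
      then show False using l \<open>e * q = 0\<close> unfolding c by simp
    qed
    ultimately show ?thesis by blast
  qed
qed

subsection \<open>A proper subalgebra without the intersection property\<close>

definition B2 :: "'b set" where "B2 = glue {(x, z, w). w = cnj z}"

lemma B2_iff: "a \<in> B2 \<longleftrightarrow> a \<in> comm \<and> (\<forall>x z. cmod z = 1 \<longrightarrow> hat a x z = hat a x (cnj z))"
  by (auto simp: B2_def glue_def)

text \<open>The transform is \<open>f (Im z\<^sup>n + 1/2)\<close>, whose positive and negative parts separate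
  the arcs \<open>Im z\<^sup>n > -1/2\<close> and \<open>Im z\<^sup>n < -1/2\<close>. The first of these and its
  complex conjugate together cover the circle.\<close>

lemma shifted_imaginary_part:
  assumes f: "continuous_on UNIV f" "\<And>x. x \<notin> V \<Longrightarrow> f x = (0::real)"
  obtains r where "r \<in> comm" "\<And>x z. cmod z = 1 \<Longrightarrow> hat r x z = of_real (f x * (Im (z powi n) + 1/2))"
proof -
  define g where "g x = complex_of_real (f x)" for x
  have g: "continuous_on UNIV g" unfolding g_def using f(1) by (intro continuous_intros)
  have per: "it n x = x" if "g x \<noteq> 0" for x using f(2) that V_periodic by (auto simp: g_def)
  have per': "it (- n) x = x" if "g x \<noteq> 0" for x using per[OF that] by (metis it_cancel(2))
  note p = hat_mon[OF g per] and m = hat_mon[OF g per'] and c = hat_C[OF g]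
  define s where "s = C g * U n - C g * U (- n)"
  have s: "s \<in> comm" "\<And>x z. cmod z = 1 \<Longrightarrow> hat s x z = g x * (z powi n - z powi (- n))"
    unfolding s_def using p m by (auto simp: hat_diff algebra_simps intro!: comm_diff)
  let ?r = "(- \<i> / 2) *\<^sub>C s + (1 / 2) *\<^sub>C C g"
  show ?thesis
  proof (rule that[of ?r])
    show "?r \<in> comm" using s c by (intro comm_add comm_scale)
    fix x z assume z: "cmod z = 1"
    have "hat ?r x z = (- \<i> / 2) * (g x * (z powi n - cnj (z powi n))) + (1 / 2) * g x"
      using s c z by (simp add: hat_add hat_scale comm_scale cnj_powi)
    also have "\<dots> = of_real (f x * (Im (z powi n) + 1/2))"
      by (simp add: g_def complex_eq_iff algebra_simps del: complex_cnj_power_int)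
    finally show "hat ?r x z = of_real (f x * (Im (z powi n) + 1/2))" .
  qed
qed

lemma shifted_imaginary_calculus:
  assumes f: "continuous_on UNIV f" "\<And>x. x \<notin> V \<Longrightarrow> f x = (0::real)" and h: "continuous_on UNIV (h :: real \<Rightarrow> real)"
  obtains e where "e \<in> comm" "\<And>x z. cmod z = 1 \<Longrightarrow> hat e x z = of_real (h (f x * (Im (z powi n) + 1/2)))"
proof -
  obtain r where r: "r \<in> comm" "\<And>x z. cmod z = 1 \<Longrightarrow> hat r x z = of_real (f x * (Im (z powi n) + 1/2))"
    using shifted_imaginary_part[OF f] by blast
  obtain e where "e \<in> comm" "\<And>x z. cmod z = 1 \<Longrightarrow> hat e x z = of_real (h (Re (hat r x z)))"
    by (rule continuous_calculus[OF r(1) h]) (use r(2) in auto)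
  then show ?thesis using that r(2) by simp
qed

text \<open>Elements that are zero over \<open>V\<close> on the arcs where \<open>Im z\<^sup>n < -1/2\<close>;
  over points outside \<open>V\<close> they are unrestricted.\<close>

definition vanishing_on_arc :: "'b set" where
  "vanishing_on_arc = {s \<in> comm. \<forall>x z. x \<in> V \<longrightarrow> cmod z = 1 \<longrightarrow> Im (z powi n) < - 1/2 \<longrightarrow> hat s x z = 0}"

text \<open>The factor \<open>c\<close> makes the left annihilator a two-sided ideal.\<close>

definition annihilator :: "'b set" where "annihilator = {a. \<forall>c. \<forall>s\<in>vanishing_on_arc. a * c * s = 0}"

lemma two_sided_ideal_annihilator: "two_sided_ideal annihilator"
proof -
  have "a * b \<in> annihilator" "b * a \<in> annihilator" if a: "a \<in> annihilator" for a b
  proof -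
    have "a * (b * c) * s = 0" "b * (a * c * s) = 0" if "s \<in> vanishing_on_arc" for c s
      using a that by (auto simp: annihilator_def)
    then show "a * b \<in> annihilator" "b * a \<in> annihilator"
      by (auto simp: annihilator_def mult.assoc)
  qed
  moreover have "csubspace annihilator"
    by (auto simp: csubspace_def annihilator_def distrib_right mult_scaleC_left) (use scaleC_eq in simp)
  ultimately show ?thesis by (simp add: two_sided_ideal_def)
qed

text \<open>Let \<open>e\<close> be the negative part of \<open>f (Im u\<^sup>n + 1/2)\<close>, so that \<open>e
  t = 0\<close> for every \<open>t\<close> in \<open>vanishing_on_arc\<close>. For a monomial \<open>g
  u\<^sup>k\<close> one writes \<open>e g u\<^sup>k s = e g (u\<^sup>k s u\<^sup>-\<^sup>k) u\<^sup>k\<close>,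
  and \<open>g u\<^sup>k s u\<^sup>-\<^sup>k\<close> is again in \<open>vanishing_on_arc\<close>, because
  \<open>V\<close> is invariant.\<close>

lemma annihilator_nonzero: "annihilator \<noteq> {0}"
proof -
  obtain f :: "'a \<Rightarrow> real" where f: "continuous_on UNIV f" "\<And>x. 0 \<le> f x"
    "\<And>x. x \<notin> V \<Longrightarrow> f x = 0" "f x0 = 1" using bump[OF open_V x0] by metis
  have "continuous_on UNIV (\<lambda>t::real. max (- t) 0)" by (intro continuous_intros)
  then obtain e where e: "e \<in> comm"
    "\<And>x z. cmod z = 1 \<Longrightarrow> hat e x z = of_real (max (- (f x * (Im (z powi n) + 1/2))) 0)"
    using shifted_imaginary_calculus[OF f(1,3)] by blast
  let ?z = "cis ((- pi / 2) / of_int n)"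
  have "?z powi n = cis (- pi / 2)" using cis_powi_n[of "- pi / 2" 1] by simp
  then have "hat e x0 ?z = 1 / 2" using e(2)[of ?z x0] f(4) by (simp add: complex_eq_iff)
  then have "e \<noteq> 0" using hat_zero[of ?z x0] by auto
  have kill: "e * t = 0" if t: "t \<in> vanishing_on_arc" for t
  proof (rule hat_eqI)
    have tD: "t \<in> comm" using t by (simp add: vanishing_on_arc_def)
    show "e * t \<in> comm" "0 \<in> comm" using e tD by (auto simp: comm_mult comm_zero)
    fix x z assume z: "cmod z = 1"
    have "hat e x z = 0 \<or> hat t x z = 0"
    proof (cases "x \<in> V \<and> Im (z powi n) < - 1/2")
      case True
      then show ?thesis using t z by (simp add: vanishing_on_arc_def)
    next
      case False
      then have "f x * (Im (z powi n) + 1/2) \<ge> 0"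
        using f(2)[of x] f(3)[of x] by (cases "x \<in> V") auto
      then show ?thesis using e(2)[OF z, of x] by simp
    qed
    then show "hat (e * t) x z = hat 0 x z" using e tD z by (auto simp: hat_mult hat_zero)
  qed
  have "e * c * s = 0" if s: "s \<in> vanishing_on_arc" for c s
  proof (rule dense_induct[where a = c])
    show "closed {c. e * c * s = 0}" by (intro closed_Collect_eq continuous_intros)
    fix b :: "int \<Rightarrow> 'a \<Rightarrow> complex" assume "b \<in> fin_supp"
    then show "e * j b * s = 0"
    proof (induction b rule: fin_supp_induct)
      case (mon f k)
      let ?t = "C f * (U k * s * U (- k))"
      have sD: "s \<in> comm" using s by (simp add: vanishing_on_arc_def)
      note conj = hat_conj[OF sD]
      have "?t \<in> vanishing_on_arc"
        unfolding vanishing_on_arc_def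
      proof (intro CollectI conjI allI impI)
        show "?t \<in> comm" by (rule comm_mult[OF hat_C(1)[OF mon] conj(1)])
        fix x z assume x: "x \<in> V" and z: "cmod z = 1" "Im (z powi n) < - 1/2"
        have "it (- k) x \<in> V" using V_invariant[of k "it (- k) x"] x by simp
        then have "hat s (it (- k) x) z = 0" using s z by (simp add: vanishing_on_arc_def)
        then show "hat ?t x z = 0" using conj(1) hat_C[OF mon] z by (simp add: hat_mult conj(2))
      qed
      then have "e * ?t * U k = 0" by (simp add: kill)
      moreover have "e * ?t * U k = e * (C f * U k) * s" by (simp add: mult.assoc U_mult)
      ultimately show ?case using C_U[OF mon] by simp
    next
      case (add a b)
      then show ?case by (simp add: j_add distrib_left distrib_right)
    qed
  qed
  then have "e \<in> annihilator" by (simp add: annihilator_def)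
  then show ?thesis using \<open>e \<noteq> 0\<close> by blast
qed

text \<open>Over \<open>V\<close>, products with positive parts of \<open>f (Im u\<^sup>n + 1/2)\<close> show
  that \<open>hat a\<close> vanishes for \<open>Im z\<^sup>n > -1/2\<close>, and then everywhere by symmetry.
  Off the closure of \<open>V\<close>, products with functions that vanish on \<open>V\<close> do the same, and
  the boundary of \<open>V\<close> follows by continuity of \<open>hat a\<close> in \<open>x\<close>.\<close>

lemma annihilator_meets_B2: "annihilator \<inter> B2 = {0}"
proof -
  have "a = 0" if a: "a \<in> annihilator" "a \<in> B2" for a
  proof -
    have aD: "a \<in> comm" using a(2) by (simp add: B2_iff)
    have sym: "hat a x z = hat a x (cnj z)" if "cmod z = 1" for x z
      using a(2) that unfolding B2_iff by blast
    have prod: "hat a x z * hat s x z = 0" if "s \<in> vanishing_on_arc" "cmod z = 1" for s x z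
    proof -
      have "a * 1 * s = 0" using a(1) that by (simp only: annihilator_def mem_Collect_eq)
      then show ?thesis using that aD hat_mult[of a s z x] by (simp add: vanishing_on_arc_def hat_zero)
    qed
    have V: "hat a x z = 0" if x: "x \<in> V" and z: "cmod z = 1" for x z
    proof -
      obtain f :: "'a \<Rightarrow> real" where f: "continuous_on UNIV f" "\<And>x. 0 \<le> f x"
        "\<And>x. x \<notin> V \<Longrightarrow> f x = 0" "f x = 1" using bump[OF open_V x] by metis
      have "continuous_on UNIV (\<lambda>t::real. max t 0)" by (intro continuous_intros)
      then obtain s where s: "s \<in> comm"
        "\<And>x z. cmod z = 1 \<Longrightarrow> hat s x z = of_real (max (f x * (Im (z powi n) + 1/2)) 0)"
        using shifted_imaginary_calculus[OF f(1,3)] by blast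
      have "s \<in> vanishing_on_arc"
        using s f(2) by (auto simp: vanishing_on_arc_def max_def mult_le_0_iff not_le zero_less_mult_iff)
      have upper: "hat a x w = 0" if w: "cmod w = 1" "Im (w powi n) > - 1/2" for w
      proof -
        have "hat s x w = of_real (Im (w powi n) + 1/2)" using s(2)[OF w(1), of x] f(4) w(2) by simp
        moreover have "Im (w powi n) + 1/2 \<noteq> 0" using w(2) by linarith
        ultimately have "hat s x w \<noteq> 0" by (metis of_real_eq_0_iff)
        then show ?thesis using prod[OF \<open>s \<in> vanishing_on_arc\<close> w(1), of x] by simp
      qed
      show ?thesis
      proof (cases "Im (z powi n) > - 1/2")
        case True
        then show ?thesis using upper z by blast
      next
        case False
        have "Im (cnj z powi n) > - 1/2" using False by (simp flip: complex_cnj_power_int)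
        then show ?thesis using upper[of "cnj z"] z sym[OF z, of x] by simp
      qed
    qed
    show "a = 0"
    proof (rule hat_eqI[OF aD comm_zero])
      fix x z assume z: "cmod z = 1"
      have "hat a x z = 0"
      proof (cases "x \<in> closure V")
        case True
        have "closure V \<subseteq> {x. hat a x z = 0}"
          using V z by (intro closure_minimal closed_Collect_eq continuous_hat aD continuous_intros) auto
        then show ?thesis using True by blast
      next
        case False
        then have "open (- closure V)" "x \<in> - closure V" by auto
        then obtain g :: "'a \<Rightarrow> complex" where g: "continuous_on UNIV g"
          "\<And>x. x \<notin> - closure V \<Longrightarrow> g x = 0" "g x = 1"
          using complex_bump by metis
        have "g y = 0" if "y \<in> V" for y using g(2)[of y] closure_subset that by auto
        then have "C g \<in> vanishing_on_arc" using hat_C[OF g(1)] by (simp add: vanishing_on_arc_def)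
        from prod[OF this z, of x] show ?thesis using hat_C(2)[OF g(1) z] g(3) by simp
      qed
      then show "hat a x z = hat 0 x z" using hat_zero[OF z] by simp
    qed
  qed
  moreover have "0 \<in> B2" by (auto simp: B2_iff comm_zero hat_zero)
  ultimately show ?thesis using ideal_zero[OF two_sided_ideal_annihilator] by blast
qed

lemma B2_proper: "CX j \<subset> B2" "B2 \<subset> comm"
proof -
  obtain g :: "'a \<Rightarrow> complex" where g: "continuous_on UNIV g" "\<And>x. g x \<in> \<real>"
    "\<And>x. x \<notin> V \<Longrightarrow> g x = 0" "g x0 = 1" using complex_bump[OF open_V x0] by metis
  define a where "a = C g * U (n * int 1)"
  have a: "a \<in> comm" and hat_a: "hat a x z = g x * z powi n" if "cmod z = 1" for x z
    unfolding a_def using V_mon(1)[OF g(1,3), of 1] V_mon(2)[OF g(1,3) that, where m = 1] by simp_all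
  have aD: "a \<in> comm" using a[of 1] by simp
  have cnj_g: "cnj (g x) = g x" for x using g(2) by (simp add: Reals_cnj_iff)
  have "a + adj a \<in> B2"
    using aD by (simp add: B2_iff comm_add comm_adj hat_add hat_adj hat_a cnj_g add.commute)
  moreover have "a + adj a \<notin> CX j"
    by (rule not_in_CX[of _ n x0]) (use n g in \<open>auto simp: a_def coef_add coef_adj coef_C_U\<close>)
  ultimately show "CX j \<subset> B2" using CX_subset_glue[of "{(x, z, w). w = cnj z}"] by (auto simp: B2_def)
  let ?z = "cis ((pi / 2) / of_int n)"
  have z: "?z powi n = \<i>" using cis_powi_n[of "pi / 2" 1] by simp
  then have "hat a x0 (cnj ?z) = - \<i>"
    using hat_a[of "cnj ?z" x0] g(4) by (simp del: complex_cnj_power_int cis_cnj flip: complex_cnj_power_int)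
  then have "hat a x0 ?z \<noteq> hat a x0 (cnj ?z)"
    using g(4) z by (simp add: hat_a complex_eq_iff)
  then have "a \<notin> B2" using norm_cis unfolding B2_iff by blast
  moreover have "B2 \<subseteq> comm" by (auto simp: B2_iff)
  ultimately show "B2 \<subset> comm" using aD by blast
qed

lemma zero_in_CX: "0 \<in> CX j"
proof -
  have "C (\<lambda>_. 0) = 0" using C_scale[of "\<lambda>_. 0" 0] by simp
  then show ?thesis using C_in_CX[of "\<lambda>_. 0"] by simp
qed

lemma not_intersection_property:
  assumes "B \<subseteq> B2" and zero: "0 \<in> B"
  shows "\<not> intersection_property B"
proof
  assume "intersection_property B"
  then have "annihilator \<inter> B \<noteq> {0}"
    using two_sided_ideal_annihilator annihilator_nonzero by (simp add: intersection_property_def)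
  moreover have "annihilator \<inter> B = {0}"
    using annihilator_meets_B2 assms ideal_zero[OF two_sided_ideal_annihilator] zero by blast
  ultimately show False by simp
qed

end

theorem theorem5p9:
  fixes \<sigma> :: "'a::t2_space \<Rightarrow> 'a"
    and j :: "(int \<Rightarrow> 'a \<Rightarrow> complex) \<Rightarrow> 'b::unital_cstar_algebra"
  assumes "topological_dynamical_system \<sigma>"
    and "is_crossed_product \<sigma> j"
  defines "case_i \<equiv> topologically_free \<sigma> \<and> CX j = commutant (CX j)"
    and "case_ii \<equiv> \<not> topologically_free \<sigma> \<and> CX j \<subset> commutant (CX j) \<and>
          \<not> intersection_property (CX j) \<and>
          (\<exists>B1 B2. cstar_subalgebra B1 \<and> CX j \<subset> B1 \<and> B1 \<subset> commutant (CX j) \<and>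
                   cstar_subalgebra B2 \<and> CX j \<subset> B2 \<and> B2 \<subset> commutant (CX j) \<and>
                   intersection_property B1 \<and> \<not> intersection_property B2)"
  shows "commutative_unital_cstar_subalgebra (commutant (CX j)) \<and>
         intersection_property (commutant (CX j)) \<and>
         (case_i \<or> case_ii) \<and> \<not> (case_i \<and> case_ii)"
proof -
  interpret crossed_product \<sigma> j
    using assms(1,2) by unfold_locales
  have "case_ii" if nf: "\<not> topologically_free \<sigma>"
  proof -
    obtain n where n: "n > 0" "interior {x. it n x = x} \<noteq> {}" using periodic_interior[OF nf] by blast
    interpret periodic_crossed_product \<sigma> j n "interior {x. it n x = x}"
      using n by unfold_locales
    have "\<not> intersection_property (CX j)"
      by (rule not_intersection_property[OF psubset_imp_subset[OF B2_proper(1)] zero_in_CX])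
    moreover have "\<not> intersection_property B2"
      by (rule not_intersection_property[OF subset_refl]) (use B2_proper(1) zero_in_CX in auto)
    moreover have "cstar_subalgebra B1" "cstar_subalgebra B2"
      using cstar_subalgebra_glue by (simp_all add: B1_def B2_def)
    ultimately show ?thesis
      unfolding case_ii_def
      by (intro conjI exI[of _ B1] exI[of _ B2] nf psubset_trans[OF B1_proper] B1_proper B2_proper
          intersection_property_B1)
  qed
  moreover have "case_i" if "topologically_free \<sigma>"
    using that commutant_topologically_free by (simp add: case_i_def)
  moreover have "\<not> (case_i \<and> case_ii)" by (auto simp: case_i_def case_ii_def)
  ultimately show ?thesis using commutative_commutant intersection_property_commutant by blast
qed

end
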